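(* (a) Let $S$ be a regular local ring and $I \subsetneq S$ an ideal. Then there exists an element $s \in S$, $s \neq 0$, such that the minimal free resolution of $S/(sI)$ over $S$ admits a DGA structure. (b) Let $S = \Bbbk[x_1,\dots,x_n]$ be a polynomial ring over a field $\Bbbk$ and $I \subsetneq S$ a homogeneous ideal. Then there exists a homogeneous element $s \in S$, $s \neq 0$, such that the minimal free resolution of $S/(sI)$ over $S$ admits a DGA structure. (c) If, in (b), $I$ is a monomial ideal, then $s$ can be chosen to be the least common multiple of the (minimal monomial) generators of $I$.
   Context: Let $\mathbb{F}: \cdots \to \mathbb{F}_2 \to \mathbb{F}_1 \to \mathbb{F}_0 = S$ be a minimal free resolution with differential $\partial$, identified with $\bigoplus_i \mathbb{F}_i$, and let $|f|$ denote the homological degree of $f$. A DGA (differential graded algebra) structure on $\mathbb{F}$ is an $S$-linear map $* : \mathbb{F} \otimes_S \mathbb{F} \to \mathbb{F}$ such that for all (homologically homogeneous) $a,b,c \in \mathbb{F}$: (1) $*$ extends the usual multiplication on $\mathbb{F}_0 = S$, and $1 \in \mathbb{F}_0$ acts as the identity; (2) $\partial(a*b) = \partial(a)*b + (-1)^{|a|} a*\partial(b)$; (3) $|a*b| = |a|+|b|$; (4) $a*b = (-1)^{|a||b|} b*a$; (5) $(a*b)*c = a*(b*c)$. In the monomial case (c), the resolution is $\mathbb{Z}^n$-graded (fine grading of $S$) and the DGA structure is required to respect the $\mathbb{Z}^n$-grading, i.e. $\deg(a*b)=\deg a+\deg b$ for homogeneous $a,b$. *)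

theory Defs
  imports Complex_Main "HOL-Library.Poly_Mapping" "HOL-Library.Extended_Nat"
begin

section \<open>Ideals\<close>

text \<open>The ring S is a type of class \<^class>\<open>comm_ring_1\<close>; an ideal is a submodule of S over
  itself.\<close>

definition is_ideal :: "'a::comm_ring_1 set \<Rightarrow> bool" where
  "is_ideal = module.subspace (*)"

definition ideal_gen :: "'a::comm_ring_1 set \<Rightarrow> 'a set" where
  "ideal_gen = module.span (*)"

definition prime_ideal :: "'a::comm_ring_1 set \<Rightarrow> bool" where
  "prime_ideal P \<longleftrightarrow> is_ideal P \<and> P \<noteq> UNIV \<and> (\<forall>a b. a * b \<in> P \<longrightarrow> a \<in> P \<or> b \<in> P)"

definition maximal_ideal :: "'a::comm_ring_1 set \<Rightarrow> bool" where
  "maximal_ideal M \<longleftrightarrow>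
     is_ideal M \<and> M \<noteq> UNIV \<and> (\<forall>J. is_ideal J \<and> M \<subseteq> J \<and> J \<noteq> UNIV \<longrightarrow> J = M)"

section \<open>Regular local rings\<close>

definition noetherian :: "'a::comm_ring_1 itself \<Rightarrow> bool" where
  "noetherian _ \<longleftrightarrow> (\<forall>I :: 'a set. is_ideal I \<longrightarrow> (\<exists>B. finite B \<and> I = ideal_gen B))"

definition krull_dim :: "'a::comm_ring_1 itself \<Rightarrow> enat" where
  "krull_dim _ = (SUP l \<in> {l. \<exists>P :: nat \<Rightarrow> 'a set.
     (\<forall>i\<le>l. prime_ideal (P i)) \<and> (\<forall>i<l. P i \<subset> P (Suc i))}. enat l)"

text \<open>\<open>M\<close> is the maximal ideal of a regular local ring \<open>'a\<close>: regularity means that \<open>M\<close> can be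
  generated by as many elements as the Krull dimension (by the height theorem, fewer never
  suffice in a Noetherian local ring).\<close>

definition regular_local_ring :: "'a::comm_ring_1 set \<Rightarrow> bool" where
  "regular_local_ring M \<longleftrightarrow>
     noetherian TYPE('a) \<and>
     maximal_ideal M \<and> (\<forall>M'. maximal_ideal M' \<longrightarrow> M' = M) \<and>
     (\<exists>B. finite B \<and> M = ideal_gen B \<and> enat (card B) = krull_dim TYPE('a))"

section \<open>Minimal free resolutions\<close>

text \<open>A sequence of finitely generated free modules is given by its ranks \<open>r\<close>: the module in
  homological degree \<open>i\<close> has the basis \<open>(i, 0), \<dots>, (i, r i - 1)\<close>, and the direct sum of all of
  them consists of the finitely supported families of coefficients on the union of these bases.\<close>

type_synonym 'a felem = "(nat \<times> nat) \<Rightarrow>\<^sub>0 'a"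

definition smult :: "'a::comm_ring_1 \<Rightarrow> 'a felem \<Rightarrow> 'a felem" where
  "smult c x = Poly_Mapping.map ((*) c) x"

lemma lookup_smult [simp]: "Poly_Mapping.lookup (smult c x) k = c * Poly_Mapping.lookup x k"
  unfolding smult_def by transfer (simp add: when_def)

lemma module_smult: "module smult"
  by unfold_locales (auto intro!: poly_mapping_eqI simp: lookup_add algebra_simps)

definition free_part :: "(nat \<Rightarrow> nat) \<Rightarrow> nat \<Rightarrow> 'a::comm_ring_1 felem set" where
  "free_part r i = {x. Poly_Mapping.keys x \<subseteq> {i} \<times> {..<r i}}"

definition free_sum :: "(nat \<Rightarrow> nat) \<Rightarrow> 'a::comm_ring_1 felem set" where
  "free_sum r = {x. Poly_Mapping.keys x \<subseteq> (SIGMA i:UNIV. {..<r i})}"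

definition linear_over :: "'a::comm_ring_1 felem set \<Rightarrow> ('a felem \<Rightarrow> 'a felem) \<Rightarrow> bool" where
  "linear_over F f \<longleftrightarrow>
     (\<forall>x\<in>F. \<forall>y\<in>F. f (x + y) = f x + f y) \<and> (\<forall>c. \<forall>x\<in>F. f (smult c x) = smult c (f x))"

text \<open>The embedding of S as the module in degree 0 of a resolution with \<open>r 0 = 1\<close>.\<close>

definition of_ring :: "'a::comm_ring_1 \<Rightarrow> 'a felem" where
  "of_ring a = Poly_Mapping.single (0, 0) a"

text \<open>A free resolution of \<open>S/J\<close> whose module in degree 0 is \<open>S\<close>, the augmentation being the
  projection of \<open>S\<close> onto \<open>S/J\<close> (so that exactness in degree 0 says that the image of the first
  differential is \<open>J\<close>). The differential is a map on the direct sum, zero on degree 0.\<close>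

definition free_resolution ::
  "'a::comm_ring_1 set \<Rightarrow> (nat \<Rightarrow> nat) \<Rightarrow> ('a felem \<Rightarrow> 'a felem) \<Rightarrow> bool" where
  "free_resolution J r d \<longleftrightarrow>
     r 0 = 1 \<and>
     linear_over (free_sum r) d \<and>
     (\<forall>x\<in>free_part r 0. d x = 0) \<and>
     (\<forall>i. d ` free_part r (Suc i) \<subseteq> free_part r i) \<and>
     d ` free_part r 1 = of_ring ` J \<and>
     (\<forall>i. {x \<in> free_part r (Suc i). d x = 0} = d ` free_part r (Suc (Suc i)))"

text \<open>Minimality with respect to \<open>M\<close>, the maximal ideal or, for graded resolutions over a
  polynomial ring, the ideal generated by the variables: the differential maps the module in
  degree \<open>i + 1\<close> into \<open>M\<close> times the module in degree \<open>i\<close>.\<close>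

definition minimal_free_resolution ::
  "'a::comm_ring_1 set \<Rightarrow> 'a set \<Rightarrow> (nat \<Rightarrow> nat) \<Rightarrow> ('a felem \<Rightarrow> 'a felem) \<Rightarrow> bool" where
  "minimal_free_resolution M J r d \<longleftrightarrow>
     free_resolution J r d \<and>
     (\<forall>i. d ` free_part r (Suc i)
            \<subseteq> module.span smult {smult a x |a x. a \<in> M \<and> x \<in> free_part r i})"

section \<open>DGA structures\<close>

definition dga_structure ::
  "(nat \<Rightarrow> nat) \<Rightarrow> ('a::comm_ring_1 felem \<Rightarrow> 'a felem) \<Rightarrow> ('a felem \<Rightarrow> 'a felem \<Rightarrow> 'a felem) \<Rightarrow> bool"
  where
  "dga_structure r d mul \<longleftrightarrow>
     (\<forall>y\<in>free_sum r. linear_over (free_sum r) (\<lambda>x. mul x y)) \<and>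
     (\<forall>x\<in>free_sum r. linear_over (free_sum r) (\<lambda>y. mul x y)) \<and>
     (\<forall>a b. mul (of_ring a) (of_ring b) = of_ring (a * b)) \<and>
     (\<forall>x\<in>free_sum r. mul (of_ring 1) x = x \<and> mul x (of_ring 1) = x) \<and>
     (\<forall>i j. \<forall>x\<in>free_part r i. \<forall>y\<in>free_part r j.
        d (mul x y) = mul (d x) y + smult ((-1) ^ i) (mul x (d y))) \<and>
     (\<forall>i j. \<forall>x\<in>free_part r i. \<forall>y\<in>free_part r j. mul x y \<in> free_part r (i + j)) \<and>
     (\<forall>i j. \<forall>x\<in>free_part r i. \<forall>y\<in>free_part r j.
        mul x y = smult ((-1) ^ (i * j)) (mul y x)) \<and>
     (\<forall>i j k. \<forall>x\<in>free_part r i. \<forall>y\<in>free_part r j. \<forall>z\<in>free_part r k.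
        mul (mul x y) z = mul x (mul y z))"

text \<open>``The'' minimal free resolution, which is only unique up to isomorphism, is rendered by
  existence together with quantification over all of them.\<close>

definition mfr_admits_dga :: "'a::comm_ring_1 set \<Rightarrow> 'a set \<Rightarrow> bool" where
  "mfr_admits_dga M J \<longleftrightarrow>
     (\<exists>r d. minimal_free_resolution M J r d) \<and>
     (\<forall>r d. minimal_free_resolution M J r d \<longrightarrow> (\<exists>mul. dga_structure r d mul))"

section \<open>Gradings\<close>

text \<open>A grading of S by a group \<open>'g\<close> is given by its homogeneous components \<open>C g\<close>. A graded free
  module is a direct sum of shifts of S, given by the degrees \<open>\<delta>\<close> of its basis elements.\<close>

definition graded_piece ::
  "('g::ab_group_add \<Rightarrow> 'a::comm_ring_1 set) \<Rightarrow> (nat \<Rightarrow> nat) \<Rightarrow> (nat \<times> nat \<Rightarrow> 'g) \<Rightarrow> 'g \<Rightarrow> 'a felem set"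
  where
  "graded_piece C r \<delta> g = {x \<in> free_sum r. \<forall>k. Poly_Mapping.lookup x k \<in> C (g - \<delta> k)}"

definition graded_minimal_free_resolution ::
  "('g::ab_group_add \<Rightarrow> 'a::comm_ring_1 set) \<Rightarrow> 'a set \<Rightarrow> 'a set \<Rightarrow>
   (nat \<Rightarrow> nat) \<Rightarrow> (nat \<times> nat \<Rightarrow> 'g) \<Rightarrow> ('a felem \<Rightarrow> 'a felem) \<Rightarrow> bool" where
  "graded_minimal_free_resolution C M J r \<delta> d \<longleftrightarrow>
     minimal_free_resolution M J r d \<and>
     \<delta> (0, 0) = 0 \<and>
     (\<forall>g. d ` graded_piece C r \<delta> g \<subseteq> graded_piece C r \<delta> g)"

definition graded_mult ::
  "('g::ab_group_add \<Rightarrow> 'a::comm_ring_1 set) \<Rightarrow> (nat \<Rightarrow> nat) \<Rightarrow> (nat \<times> nat \<Rightarrow> 'g) \<Rightarrow>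
   ('a felem \<Rightarrow> 'a felem \<Rightarrow> 'a felem) \<Rightarrow> bool" where
  "graded_mult C r \<delta> mul \<longleftrightarrow>
     (\<forall>g h. \<forall>x\<in>graded_piece C r \<delta> g. \<forall>y\<in>graded_piece C r \<delta> h. mul x y \<in> graded_piece C r \<delta> (g + h))"

definition graded_mfr_admits_dga ::
  "('g::ab_group_add \<Rightarrow> 'a::comm_ring_1 set) \<Rightarrow> 'a set \<Rightarrow> 'a set \<Rightarrow> bool" where
  "graded_mfr_admits_dga C M J \<longleftrightarrow>
     (\<exists>r \<delta> d. graded_minimal_free_resolution C M J r \<delta> d) \<and>
     (\<forall>r \<delta> d. graded_minimal_free_resolution C M J r \<delta> d \<longrightarrow> (\<exists>mul. dga_structure r d mul))"

definition graded_mfr_admits_graded_dga ::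
  "('g::ab_group_add \<Rightarrow> 'a::comm_ring_1 set) \<Rightarrow> 'a set \<Rightarrow> 'a set \<Rightarrow> bool" where
  "graded_mfr_admits_graded_dga C M J \<longleftrightarrow>
     (\<exists>r \<delta> d. graded_minimal_free_resolution C M J r \<delta> d) \<and>
     (\<forall>r \<delta> d. graded_minimal_free_resolution C M J r \<delta> d \<longrightarrow>
        (\<exists>mul. dga_structure r d mul \<and> graded_mult C r \<delta> mul))"

section \<open>Polynomial rings\<close>

text \<open>Polynomials over \<open>'k\<close> in variables indexed by the finite type \<open>'n\<close>, as finitely supported
  functions on the exponent vectors.\<close>

type_synonym ('n, 'k) mpol = "('n \<Rightarrow>\<^sub>0 nat) \<Rightarrow>\<^sub>0 'k"

definition monomial :: "('n \<Rightarrow>\<^sub>0 nat) \<Rightarrow> ('n, 'k::field) mpol" where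
  "monomial u = Poly_Mapping.single u 1"

definition vars_ideal :: "('n::finite, 'k::field) mpol set" where
  "vars_ideal = ideal_gen {monomial (Poly_Mapping.single i 1) |i. True}"

definition std_component :: "int \<Rightarrow> ('n::finite, 'k::field) mpol set" where
  "std_component g =
     {p. \<forall>u\<in>Poly_Mapping.keys p. int (\<Sum>i\<in>UNIV. Poly_Mapping.lookup u i) = g}"

definition fine_component :: "('n \<Rightarrow>\<^sub>0 int) \<Rightarrow> ('n::finite, 'k::field) mpol set" where
  "fine_component g =
     {p. \<forall>u\<in>Poly_Mapping.keys p. \<forall>i. int (Poly_Mapping.lookup u i) = Poly_Mapping.lookup g i}"

definition homogeneous :: "('n::finite, 'k::field) mpol \<Rightarrow> bool" where
  "homogeneous p \<longleftrightarrow> (\<exists>g. p \<in> std_component g)"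

definition homogeneous_ideal :: "('n::finite, 'k::field) mpol set \<Rightarrow> bool" where
  "homogeneous_ideal I \<longleftrightarrow> (\<exists>G. (\<forall>p\<in>G. homogeneous p) \<and> I = ideal_gen G)"

definition monomial_ideal :: "('n::finite, 'k::field) mpol set \<Rightarrow> bool" where
  "monomial_ideal I \<longleftrightarrow> (\<exists>U. I = ideal_gen (monomial ` U))"

text \<open>Exponent vectors of the minimal monomial generators.\<close>

definition min_gens :: "('n::finite, 'k::field) mpol set \<Rightarrow> ('n \<Rightarrow>\<^sub>0 nat) set" where
  "min_gens I =
     {u. monomial u \<in> I \<and>
         (\<forall>v. monomial v \<in> I \<and> (monomial v :: ('n, 'k) mpol) dvd monomial u \<longrightarrow> v = u)}"

text \<open>The supremum is a maximum, as there are only finitely many minimal generators; it is 0 for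
  the zero ideal, whose empty set of generators has least common multiple 1.\<close>

definition lcm_exponent :: "('n::finite \<Rightarrow>\<^sub>0 nat) set \<Rightarrow> ('n \<Rightarrow>\<^sub>0 nat)" where
  "lcm_exponent U = Abs_poly_mapping (\<lambda>i. SUP u\<in>U. Poly_Mapping.lookup u i)"

definition gens_lcm :: "('n::finite, 'k::field) mpol set \<Rightarrow> ('n, 'k) mpol" where
  "gens_lcm I = monomial (lcm_exponent (min_gens I))"

end

theory Submission
  imports Defs "HOL-Computational_Algebra.Primes"
begin

text \<open>
  Let \<open>F\<close> be a free resolution of \<open>S/(sI)\<close>, where multiplication by \<open>s\<close> is injective on \<open>I\<close>.
  Dividing the first differential by \<open>s\<close> turns \<open>F\<close> into a resolution of \<open>S/I\<close>; let
  \<open>\<alpha> : F\<^sub>1 \<rightarrow> I\<close> be the divided differential. Suppose that on this resolution of \<open>S/I\<close>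
  multiplication by \<open>s\<close> is null-homotopic through a linear map \<open>H\<close> of degree 1 with \<open>H H = 0\<close>.
  Extend \<open>\<alpha>\<close> by zero to the other degrees and put, for \<open>a\<close> and \<open>b\<close> of positive degree,
  \<open>a * b = \<alpha>(a) H(b) + (-1)\<^bsup>|a|\<^esup> \<alpha>(b) H(a)\<close>. The Leibniz rule is the homotopy identity, and the
  associative law holds because every triple product of elements of positive degree vanishes: a
  product has degree at least 2 and lies in the image of \<open>H\<close>, so \<open>\<alpha>\<close> and \<open>H\<close> kill it. This is
  \<open>dga_from_homotopy\<close>, which applies to any free resolution of \<open>S/(sI)\<close>.

  So it remains to find \<open>s\<close> with such an \<open>H\<close>. Each \<open>q \<in> I\<close> annihilates \<open>S/I\<close>, so multiplication
  by \<open>q\<close> is null-homotopic through some \<open>H\<close>, and then \<open>H \<partial> H\<close> is a null homotopy of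
  multiplication by \<open>q\<^sup>2\<close> whose square is zero (\<open>square_zero_homotopy_exists\<close>). For a polynomial
  ring and a homogeneous ideal \<open>I \<noteq> 0\<close> this gives \<open>s = q\<^sup>2\<close> for a nonzero homogeneous \<open>q \<in> I\<close>.
  Over a local ring there are two cases. If all elements of \<open>I\<close> are nilpotent, some \<open>s \<noteq> 0\<close>
  kills \<open>I\<close>, and products of positive degree may be zero. Otherwise a power \<open>t\<close> of an element
  of \<open>I\<close> satisfies \<open>Ann t = Ann t\<^sup>2 \<noteq> S\<close>; then \<open>t\<close> acts injectively on \<open>tI\<close>, and the argument applies
  to the ideal \<open>tI\<close> and \<open>q = t\<^sup>2\<close>, so that \<open>s = t\<^sup>5\<close>.

  For a monomial ideal, \<open>s\<close> is the least common multiple of the generators, which need not be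
  of the form \<open>q\<^sup>2\<close> with \<open>q \<in> I\<close>, and \<open>H\<close> comes from a different source. The degrees of a
  minimal finely graded resolution of \<open>S/I\<close> lie between 0 and the degree of \<open>s\<close>
  (\<open>fine_degree_bounds\<close>): a homogeneous syzygy of larger degree is a variable times another
  syzygy, so it is no minimal generator. Setting all variables to 1 gives an exact complex of
  vector spaces, on which the identity has a square-zero null homotopy. Restoring the degrees multiplies its matrix entries by Laurent monomials, and by the
  bounds \<open>s\<close> clears all denominators (\<open>fine_square_zero_homotopy\<close>). A minimal resolution that is
  only graded by total degree is isomorphic to a finely graded one, because a graded endomorphism
  lifting the identity differs from the identity by a strictly triangular matrix, and the
  multiplication is transported along the isomorphism (\<open>std_dga_transfer\<close>).

  Minimal resolutions with finite ranks exist over Noetherian rings in which homogeneous elements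
  outside \<open>M\<close> are units (\<open>graded_minimal_free_resolution_exists\<close>); for polynomial rings this
  uses Hilbert's basis theorem (\<open>noetherian_mpol\<close>).
\<close>

section \<open>Linear maps between free modules\<close>

interpretation felem: module "smult :: 'a::comm_ring_1 \<Rightarrow> 'a felem \<Rightarrow> 'a felem"
  by (rule module_smult)

abbreviation (input) keys where "keys \<equiv> Poly_Mapping.keys"

abbreviation (input) lookup where "lookup \<equiv> Poly_Mapping.lookup"

abbreviation (input) single where "single \<equiv> Poly_Mapping.single"

abbreviation coeff :: "'a::comm_ring_1 felem \<Rightarrow> nat \<times> nat \<Rightarrow> 'a" where
  "coeff \<equiv> lookup"

abbreviation basis :: "nat \<times> nat \<Rightarrow> 'a::comm_ring_1 felem" where
  "basis k \<equiv> single k 1"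

abbreviation linear_map :: "('a::comm_ring_1 felem \<Rightarrow> 'a felem) \<Rightarrow> bool" where
  "linear_map \<equiv> module_hom smult smult"

lemma linear_mapI:
  assumes "\<And>x y. f (x + y) = f x + f y" "\<And>c x. f (smult c x) = smult c (f x)"
  shows "linear_map f"
  using assms by unfold_locales auto

lemma linear_add: "linear_map f \<Longrightarrow> f (x + y) = f x + f y"
  by (rule module_hom.add)

lemma linear_smult: "linear_map f \<Longrightarrow> f (smult c x) = smult c (f x)"
  by (rule module_hom.scale)

lemma linear_zero: "linear_map f \<Longrightarrow> f 0 = 0"
  by (rule module_hom.zero)

lemma linear_diff: "linear_map f \<Longrightarrow> f (x - y) = f x - f y"
  by (rule module_hom.diff)

lemma linear_sum: "linear_map f \<Longrightarrow> f (sum g A) = (\<Sum>a\<in>A. f (g a))"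
  by (rule module_hom.sum)

lemma coeff_basis: "coeff (basis k) l = (if l = k then 1 else 0)"
  by (auto simp: lookup_single)

lemma felem_expand: "x = (\<Sum>k\<in>keys x. smult (coeff x k) (basis k))"
  by (rule poly_mapping_eqI)
     (auto simp: lookup_sum coeff_basis if_distrib in_keys_iff cong: if_cong)

definition lin_ext :: "(nat \<times> nat \<Rightarrow> 'a::comm_ring_1 felem) \<Rightarrow> 'a felem \<Rightarrow> 'a felem" where
  "lin_ext g x = (\<Sum>k\<in>keys x. smult (coeff x k) (g k))"

lemma lin_ext_superset:
  assumes "finite A" "keys x \<subseteq> A"
  shows "lin_ext g x = (\<Sum>k\<in>A. smult (coeff x k) (g k))"
  unfolding lin_ext_def
  by (rule sum.mono_neutral_left) (use assms in \<open>auto simp: in_keys_iff\<close>)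

lemma linear_lin_ext: "linear_map (lin_ext g)"
proof (rule linear_mapI)
  fix x y :: "'a felem"
  let ?A = "keys x \<union> keys y"
  have "keys (x + y) \<subseteq> ?A"
    by (rule keys_add)
  then show "lin_ext g (x + y) = lin_ext g x + lin_ext g y"
    by (simp add: lin_ext_superset[of ?A] lookup_add felem.scale_left_distrib sum.distrib)
next
  fix c :: 'a and x :: "'a felem"
  have "keys (smult c x) \<subseteq> keys x"
    by (auto simp: in_keys_iff)
  then show "lin_ext g (smult c x) = smult c (lin_ext g x)"
    by (simp add: lin_ext_superset[of "keys x"] felem.scale_sum_right)
qed

lemma lin_ext_basis [simp]: "lin_ext g (basis k) = g k"
  by (simp add: lin_ext_superset[of "{k}"])

lemma linear_expand:
  assumes "linear_map f"
  shows "f x = (\<Sum>k\<in>keys x. smult (coeff x k) (f (basis k)))"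
  using arg_cong[OF felem_expand, of f x] by (simp only: linear_sum[OF assms] linear_smult[OF assms])

lemma linear_eq_on_basis:
  assumes "linear_map f" "linear_map g" "\<And>k. k \<in> keys x \<Longrightarrow> f (basis k) = g (basis k)"
  shows "f x = g x"
  unfolding linear_expand[OF assms(1), of x] linear_expand[OF assms(2), of x]
  by (rule sum.cong) (simp_all only: assms(3))

lemma linear_in_subspace:
  assumes "linear_map f" "felem.subspace N" "\<And>k. k \<in> keys x \<Longrightarrow> f (basis k) \<in> N"
  shows "f x \<in> N"
  by (subst linear_expand[OF assms(1)])
     (intro felem.subspace_sum felem.subspace_scale assms)

lemma linear_comp:
  assumes f: "linear_map f" and g: "linear_map g"
  shows "linear_map (\<lambda>x. f (g x))"
  by (rule linear_mapI)
     (simp_all add: linear_add[OF f] linear_add[OF g] linear_smult[OF f] linear_smult[OF g])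

lemma linear_plus:
  assumes f: "linear_map f" and g: "linear_map g"
  shows "linear_map (\<lambda>x. f x + g x)"
  by (rule linear_mapI)
     (simp_all add: linear_add[OF f] linear_add[OF g] linear_smult[OF f] linear_smult[OF g]
       felem.scale_right_distrib)

lemma linear_minus:
  assumes f: "linear_map f" and g: "linear_map g"
  shows "linear_map (\<lambda>x. f x - g x)"
  by (rule linear_mapI)
     (simp_all add: linear_add[OF f] linear_add[OF g] linear_smult[OF f] linear_smult[OF g]
       felem.scale_right_diff_distrib)

lemma linear_scale:
  assumes f: "linear_map f"
  shows "linear_map (\<lambda>x. smult c (f x))"
  by (rule linear_mapI)
     (simp_all add: linear_add[OF f] linear_smult[OF f] felem.scale_right_distrib mult.commute)

lemma linear_id: "linear_map (\<lambda>x. x)"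
  by (rule linear_mapI) simp_all

lemma linear_0: "linear_map (\<lambda>x. 0)"
  by (rule linear_mapI) simp_all

lemma of_ring_eq_smult: "of_ring a = smult a (basis (0, 0))"
  by (rule poly_mapping_eqI) (simp add: of_ring_def lookup_single when_def)

lemma coeff_of_ring [simp]: "coeff (of_ring a) (0, 0) = a"
  by (simp add: of_ring_def)

lemma of_ring_inject [simp]: "of_ring a = of_ring b \<longleftrightarrow> a = b"
  by (metis coeff_of_ring)

lemma of_ring_eq_0 [simp]: "of_ring a = 0 \<longleftrightarrow> a = 0"
  by (metis coeff_of_ring lookup_zero of_ring_eq_smult felem.scale_zero_left)

lemma of_ring_0: "of_ring 0 = 0"
  by (simp add: of_ring_eq_smult)

lemma smult_of_ring [simp]: "smult a (of_ring b) = of_ring (a * b)"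
  by (simp add: of_ring_eq_smult)

subsection \<open>The graded parts\<close>

lemma in_free_part_iff:
  "x \<in> free_part r i \<longleftrightarrow> (\<forall>k. \<not> (fst k = i \<and> snd k < r i) \<longrightarrow> coeff x k = 0)"
  unfolding free_part_def by (auto simp: subset_iff in_keys_iff)

lemma in_free_sum_iff:
  "x \<in> free_sum r \<longleftrightarrow> (\<forall>k. \<not> snd k < r (fst k) \<longrightarrow> coeff x k = 0)"
  unfolding free_sum_def by (auto simp: subset_iff in_keys_iff)

lemma subspace_free_part: "felem.subspace (free_part r i)"
  by (rule felem.subspaceI) (auto simp: in_free_part_iff lookup_add)

lemma subspace_free_sum: "felem.subspace (free_sum r)"
  by (rule felem.subspaceI) (auto simp: in_free_sum_iff lookup_add)

lemma free_part_subset_sum: "free_part r i \<subseteq> free_sum r"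
  by (force simp: free_part_def free_sum_def)

lemma basis_in_free_part: "basis (i, j) \<in> free_part r i \<longleftrightarrow> j < r i"
  by (simp add: free_part_def)

lemma basis_in_free_sum: "basis (i, j) \<in> free_sum r \<longleftrightarrow> j < r i"
  by (simp add: free_sum_def)

lemma keys_free_part:
  assumes "x \<in> free_part r i" "k \<in> keys x"
  obtains j where "k = (i, j)" "j < r i"
  using assms by (force simp: free_part_def)

lemma keys_free_sum:
  assumes "x \<in> free_sum r" "k \<in> keys x"
  obtains i j where "k = (i, j)" "j < r i"
  using assms by (force simp: free_sum_def)

lemma of_ring_in_free_part: "r 0 = 1 \<Longrightarrow> of_ring a \<in> free_part r 0"
  by (simp add: of_ring_def free_part_def)

lemma free_part_0:
  assumes "r 0 = 1" "x \<in> free_part r 0"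
  shows "x = of_ring (coeff x (0, 0))"
proof (rule poly_mapping_eqI)
  fix k
  show "coeff x k = coeff (of_ring (coeff x (0, 0))) k"
    using assms by (cases "k = (0, 0)") (auto simp: free_part_def of_ring_def lookup_single in_keys_iff)
qed

lemma coeff_free_part_other: "x \<in> free_part r i \<Longrightarrow> fst k \<noteq> i \<Longrightarrow> coeff x k = 0"
  by (auto simp: free_part_def in_keys_iff)

lemma linear_eq_on_free_part:
  assumes "linear_map f" "linear_map g" "\<And>j. j < r i \<Longrightarrow> f (basis (i, j)) = g (basis (i, j))"
    and "x \<in> free_part r i"
  shows "f x = g x"
proof (rule linear_eq_on_basis[OF assms(1,2)])
  fix k assume "k \<in> keys x"
  then obtain j where "k = (i, j)" "j < r i"
    using assms(4) by (auto elim: keys_free_part)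
  then show "f (basis k) = g (basis k)"
    using assms(3) by simp
qed

lemma linear_free_part_into:
  assumes "linear_map f" "\<And>j. j < r i \<Longrightarrow> f (basis (i, j)) \<in> N" "felem.subspace N"
    and "x \<in> free_part r i"
  shows "f x \<in> N"
proof (rule linear_in_subspace[OF assms(1,3)])
  fix k assume "k \<in> keys x"
  then obtain j where "k = (i, j)" "j < r i"
    using assms(4) by (auto elim: keys_free_part)
  then show "f (basis k) \<in> N"
    using assms(2) by simp
qed

section \<open>Ideals\<close>

lemma module_mult: "module ((*) :: 'a::comm_ring_1 \<Rightarrow> 'a \<Rightarrow> 'a)"
  by unfold_locales (simp_all add: algebra_simps)

lemma is_idealD:
  assumes "is_ideal I"
  shows "0 \<in> I" and "a \<in> I \<Longrightarrow> b \<in> I \<Longrightarrow> a + b \<in> I" and "a \<in> I \<Longrightarrow> b \<in> I \<Longrightarrow> a - b \<in> I"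
    and "a \<in> I \<Longrightarrow> c * a \<in> I" and "a \<in> I \<Longrightarrow> a * c \<in> I"
proof -
  have I: "module.subspace (*) I"
    using assms by (simp add: is_ideal_def)
  show "0 \<in> I" "a \<in> I \<Longrightarrow> b \<in> I \<Longrightarrow> a + b \<in> I" "a \<in> I \<Longrightarrow> b \<in> I \<Longrightarrow> a - b \<in> I"
    "a \<in> I \<Longrightarrow> c * a \<in> I"
    using module.subspace_0[OF module_mult I] module.subspace_add[OF module_mult I]
      module.subspace_diff[OF module_mult I] module.subspace_scale[OF module_mult I] by blast+
  then show "a \<in> I \<Longrightarrow> a * c \<in> I"
    by (simp add: mult.commute)
qed

lemma is_idealI:
  assumes "0 \<in> I" "\<And>a b. a \<in> I \<Longrightarrow> b \<in> I \<Longrightarrow> a + b \<in> I" "\<And>c a. a \<in> I \<Longrightarrow> c * a \<in> I"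
  shows "is_ideal I"
  unfolding is_ideal_def by (rule module.subspaceI[OF module_mult]) (use assms in auto)

lemma subspace_of_ring_ideal:
  assumes "is_ideal I"
  shows "felem.subspace (of_ring ` I)"
proof (rule felem.subspaceI)
  show "0 \<in> of_ring ` I"
    using is_idealD(1)[OF assms] by (metis image_eqI of_ring_0)
  show "x + y \<in> of_ring ` I" if "x \<in> of_ring ` I" "y \<in> of_ring ` I" for x y
    using that is_idealD(2)[OF assms] by (auto simp: of_ring_eq_smult simp flip: felem.scale_left_distrib)
  show "smult c x \<in> of_ring ` I" if "x \<in> of_ring ` I" for c x
    using that is_idealD(4)[OF assms] by auto
qed

lemma ideal_eq_UNIV_iff:
  assumes "is_ideal I"
  shows "I = UNIV \<longleftrightarrow> 1 \<in> I"
proof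
  assume "1 \<in> I"
  then have "c \<in> I" for c
    using is_idealD(4)[OF assms, of 1 c] by simp
  then show "I = UNIV" by blast
qed simp

lemma is_ideal_times:
  assumes "is_ideal I"
  shows "is_ideal ((*) s ` I)"
proof (rule is_idealI)
  show "0 \<in> (*) s ` I"
    using is_idealD(1)[OF assms] by (metis image_eqI mult_zero_right)
  show "a + b \<in> (*) s ` I" if "a \<in> (*) s ` I" "b \<in> (*) s ` I" for a b
    using that is_idealD(2)[OF assms] by (auto simp flip: distrib_left)
  show "c * a \<in> (*) s ` I" if a: "a \<in> (*) s ` I" for c a
  proof -
    obtain b where "b \<in> I" "a = s * b"
      using a by blast
    then have "c * a = s * (c * b)" "c * b \<in> I"
      using is_idealD(4)[OF assms] by (auto simp: ac_simps)
    then show ?thesis by blast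
  qed
qed

lemma times_ideal_subset: "is_ideal I \<Longrightarrow> (*) s ` I \<subseteq> I"
  using is_idealD(4) by blast

section \<open>Lifting along resolutions\<close>

lemma free_resolutionD:
  assumes "free_resolution J r d"
  shows "r 0 = 1"
    and "x \<in> free_part r 0 \<Longrightarrow> d x = 0"
    and "x \<in> free_part r (Suc i) \<Longrightarrow> d x \<in> free_part r i"
    and "d ` free_part r 1 = of_ring ` J"
    and "x \<in> free_part r (Suc i) \<Longrightarrow> d x = 0 \<Longrightarrow> x \<in> d ` free_part r (Suc (Suc i))"
    and "x \<in> free_part r (Suc i) \<Longrightarrow> d (d x) = 0"
proof -
  show 1: "r 0 = 1" "x \<in> free_part r 0 \<Longrightarrow> d x = 0" for x
    using assms by (auto simp: free_resolution_def)
  show 2: "x \<in> free_part r (Suc i) \<Longrightarrow> d x \<in> free_part r i" for x i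
    using assms by (auto simp: free_resolution_def)
  show "d ` free_part r 1 = of_ring ` J"
    using assms by (auto simp: free_resolution_def)
  have ex: "{x \<in> free_part r (Suc i). d x = 0} = d ` free_part r (Suc (Suc i))" for i
    using assms by (simp add: free_resolution_def)
  show "x \<in> free_part r (Suc i) \<Longrightarrow> d x = 0 \<Longrightarrow> x \<in> d ` free_part r (Suc (Suc i))"
    using ex by blast
  show "x \<in> free_part r (Suc i) \<Longrightarrow> d (d x) = 0"
    by (cases i) (use 1 2 ex in blast)+
qed

text \<open>Two standard constructions share one recursion over a basis. For \<open>p = 1\<close> and \<open>\<epsilon> = -1\<close> the
  equation \<open>d' T = \<theta> + \<epsilon> T d\<close> says that \<open>T\<close> is a null homotopy of \<open>\<theta>\<close>; for \<open>p = 0\<close>, \<open>\<theta> = 0\<close> and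
  \<open>\<epsilon> = 1\<close> it says that \<open>T\<close> is a map of complexes. The sets \<open>A k\<close> allow the values to be chosen
  homogeneous. The right-hand side is a cycle by the second condition on \<open>\<theta>\<close>, hence a boundary
  by exactness; in the lowest degree, where exactness gives nothing, this is the hypothesis on
  the starting values.\<close>

lemma lift_along_resolution:
  fixes d d' \<theta> :: "'a::comm_ring_1 felem \<Rightarrow> 'a felem" and \<epsilon> :: 'a
  assumes lin: "linear_map d" "linear_map d'" "linear_map \<theta>"
    and d: "\<And>i x. x \<in> free_part r (Suc i) \<Longrightarrow> d x \<in> free_part r i"
      "\<And>i x. x \<in> free_part r (Suc i) \<Longrightarrow> d (d x) = 0"
    and exact: "\<And>n y. y \<in> free_part r' (Suc (n + p)) \<Longrightarrow> d' y = 0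
      \<Longrightarrow> y \<in> d' ` free_part r' (Suc (Suc (n + p)))"
    and \<theta>: "\<And>n x. x \<in> free_part r (Suc n) \<Longrightarrow> \<theta> x \<in> free_part r' (n + p)"
      "\<And>n x. x \<in> free_part r (Suc (Suc n)) \<Longrightarrow> d' (\<theta> x) + smult \<epsilon> (\<theta> (d x)) = 0"
    and base: "\<And>j. j < r 0 \<Longrightarrow> T0 (0, j) \<in> free_part r' p \<inter> A (0, j)"
      "\<And>x. x \<in> free_part r (Suc 0) \<Longrightarrow>
        \<theta> x + smult \<epsilon> (lin_ext T0 (d x)) \<in> d' ` free_part r' (Suc p)"
    and select: "\<And>n j t y. j < r (Suc n) \<Longrightarrow> (\<And>l. l < r n \<Longrightarrow> t (n, l) \<in> A (n, l)) \<Longrightarrow>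
      y = \<theta> (basis (Suc n, j)) + smult \<epsilon> (lin_ext t (d (basis (Suc n, j)))) \<Longrightarrow>
      y \<in> d' ` free_part r' (Suc (n + p)) \<Longrightarrow>
      \<exists>z. z \<in> free_part r' (Suc (n + p)) \<and> z \<in> A (Suc n, j) \<and> d' z = y"
  shows "\<exists>T. linear_map T \<and> (\<forall>i. \<forall>x\<in>free_part r i. T x \<in> free_part r' (i + p)) \<and>
    (\<forall>i. \<forall>j<r i. T (basis (i, j)) \<in> A (i, j)) \<and>
    (\<forall>j<r 0. T (basis (0, j)) = T0 (0, j)) \<and>
    (\<forall>i. \<forall>x\<in>free_part r (Suc i). d' (T x) = \<theta> x + smult \<epsilon> (T (d x)))"
proof -
  \<comment> \<open>The recursion carries the values on the basis in degree \<open>n\<close> and the fact that the next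
    equation is solvable.\<close>
  define P where "P n t \<longleftrightarrow> (\<forall>j<r n. t (n, j) \<in> free_part r' (n + p) \<inter> A (n, j)) \<and>
    (\<forall>x\<in>free_part r (Suc n). \<theta> x + smult \<epsilon> (lin_ext t (d x)) \<in> d' ` free_part r' (Suc (n + p))) \<and>
    (n = 0 \<longrightarrow> t = T0)" for n t
  define Q where "Q n t t' \<longleftrightarrow> (\<forall>j<r (Suc n). d' (t' (Suc n, j)) =
    \<theta> (basis (Suc n, j)) + smult \<epsilon> (lin_ext t (d (basis (Suc n, j)))))" for n t t'
  have step: "d' (lin_ext t' x) = \<theta> x + smult \<epsilon> (lin_ext t (d x))"
    if "Q n t t'" "x \<in> free_part r (Suc n)" for n t t' x
  proof (rule linear_eq_on_free_part[OF _ _ _ that(2)])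
    show "linear_map (\<lambda>x. d' (lin_ext t' x))"
      by (rule linear_comp[OF lin(2) linear_lin_ext])
    show "linear_map (\<lambda>x. \<theta> x + smult \<epsilon> (lin_ext t (d x)))"
      by (rule linear_plus[OF lin(3) linear_scale[OF linear_comp[OF linear_lin_ext lin(1)]]])
    fix j assume "j < r (Suc n)"
    then show "d' (lin_ext t' (basis (Suc n, j))) =
        \<theta> (basis (Suc n, j)) + smult \<epsilon> (lin_ext t (d (basis (Suc n, j))))"
      using that(1) by (simp add: Q_def)
  qed
  have "\<exists>f. \<forall>n. P n (f n) \<and> Q n (f n) (f (Suc n))"
  proof (rule dependent_nat_choice)
    show "\<exists>t. P 0 t"
      using base by (intro exI[of _ T0]) (auto simp: P_def)
  next
    fix t n assume P: "P n t"
    have "\<exists>z. z \<in> free_part r' (Suc (n + p)) \<and> z \<in> A (Suc n, j) \<and>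
        d' z = \<theta> (basis (Suc n, j)) + smult \<epsilon> (lin_ext t (d (basis (Suc n, j))))"
      if "j < r (Suc n)" for j
      using P that by (intro select[OF that, of t]) (auto simp: P_def basis_in_free_part)
    then obtain z where z: "\<And>j. j < r (Suc n) \<Longrightarrow> z j \<in> free_part r' (Suc (n + p)) \<and> z j \<in> A (Suc n, j) \<and>
        d' (z j) = \<theta> (basis (Suc n, j)) + smult \<epsilon> (lin_ext t (d (basis (Suc n, j))))"
      by metis
    define t' where "t' k = z (snd k)" for k :: "nat \<times> nat"
    have Q: "Q n t t'"
      using z by (simp add: Q_def t'_def)
    have "\<theta> x + smult \<epsilon> (lin_ext t' (d x)) \<in> d' ` free_part r' (Suc (Suc (n + p)))"
      if x: "x \<in> free_part r (Suc (Suc n))" for x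
    proof (rule exact)
      have "lin_ext t' (d x) \<in> free_part r' (Suc (n + p))"
        using z by (intro linear_free_part_into[OF linear_lin_ext _ subspace_free_part d(1)[OF x]])
          (simp add: t'_def)
      then show "\<theta> x + smult \<epsilon> (lin_ext t' (d x)) \<in> free_part r' (Suc (n + p))"
        using \<theta>(1)[OF x] by (simp add: felem.subspace_add felem.subspace_scale subspace_free_part)
      have "d' (lin_ext t' (d x)) = \<theta> (d x)"
        using step[OF Q d(1)[OF x]] d(2)[OF x] by (simp add: linear_zero[OF linear_lin_ext])
      then show "d' (\<theta> x + smult \<epsilon> (lin_ext t' (d x))) = 0"
        using \<theta>(2)[OF x] by (simp add: linear_add[OF lin(2)] linear_smult[OF lin(2)])
    qed
    then have "P (Suc n) t'"
      using z by (auto simp: P_def t'_def)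
    with Q show "\<exists>t'. P (Suc n) t' \<and> Q n t t'"
      by blast
  qed
  then obtain f where P: "\<And>n. P n (f n)" and Q: "\<And>n. Q n (f n) (f (Suc n))"
    by blast
  define T where "T = lin_ext (\<lambda>k. f (fst k) k)"
  have lin_T: "linear_map T"
    by (simp add: T_def linear_lin_ext)
  have T: "T x = lin_ext (f i) x" if "x \<in> free_part r i" for i x
    by (rule linear_eq_on_free_part[OF lin_T linear_lin_ext _ that]) (simp add: T_def)
  show ?thesis
  proof (intro exI conjI allI ballI impI)
    fix i and x :: "'a felem" assume "x \<in> free_part r i"
    then show "T x \<in> free_part r' (i + p)"
      by (rule linear_free_part_into[OF lin_T _ subspace_free_part, rotated])
        (use P[of i] in \<open>simp add: T_def P_def\<close>)
  next
    fix i and x :: "'a felem" assume "x \<in> free_part r (Suc i)"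
    then show "d' (T x) = \<theta> x + smult \<epsilon> (T (d x))"
      using step[OF Q] d(1) T by metis
  qed (use P lin_T in \<open>auto simp: T_def P_def\<close>)
qed

text \<open>In degree 0 the map must already be a boundary; above, exactness solves the equations.\<close>

lemma null_homotopy:
  fixes d \<phi> :: "'a::comm_ring_1 felem \<Rightarrow> 'a felem"
  assumes res: "free_resolution J r d" and lin: "linear_map d" "linear_map \<phi>"
    and \<phi>: "\<And>i x. x \<in> free_part r i \<Longrightarrow> \<phi> x \<in> free_part r i"
      "\<And>i x. x \<in> free_part r i \<Longrightarrow> d (\<phi> x) = \<phi> (d x)"
      "\<phi> (basis (0, 0)) \<in> d ` free_part r (Suc 0)"
  shows "\<exists>H. linear_map H \<and> (\<forall>i. \<forall>x\<in>free_part r i. H x \<in> free_part r (Suc i)) \<and>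
    (\<forall>i. \<forall>x\<in>free_part r i. d (H x) + H (d x) = \<phi> x)"
proof -
  note D = free_resolutionD[OF res]
  obtain e where e: "e \<in> free_part r (Suc 0)" "d e = \<phi> (basis (0, 0))"
    using \<phi>(3) by auto
  have e_lin: "d (lin_ext (\<lambda>_. e) x) = \<phi> x" if "x \<in> free_part r 0" for x
    by (rule linear_eq_on_free_part[OF linear_comp[OF lin(1) linear_lin_ext] lin(2) _ that])
       (simp add: D(1) e)
  have "\<exists>T. linear_map T \<and> (\<forall>i. \<forall>x\<in>free_part r i. T x \<in> free_part r (i + 1)) \<and>
    (\<forall>i. \<forall>j<r i. T (basis (i, j)) \<in> UNIV) \<and>
    (\<forall>j<r 0. T (basis (0, j)) = e) \<and>
    (\<forall>i. \<forall>x\<in>free_part r (Suc i). d (T x) = \<phi> x + smult (-1) (T (d x)))"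
  proof (rule lift_along_resolution[where A = "\<lambda>_. UNIV" and ?T0.0 = "\<lambda>_. e"])
    show "y \<in> d ` free_part r (Suc (Suc (n + 1)))" if "y \<in> free_part r (Suc (n + 1))" "d y = 0" for n y
      using D(5)[OF that] by simp
    show "\<phi> x \<in> free_part r (n + 1)" if "x \<in> free_part r (Suc n)" for n x
      using \<phi>(1)[OF that] by simp
    show "d (\<phi> x) + smult (- 1) (\<phi> (d x)) = 0" if "x \<in> free_part r (Suc (Suc n))" for n x
      using \<phi>(2)[OF that] by simp
    show "e \<in> free_part r 1 \<inter> UNIV" if "j < r 0" for j
      using e by simp
    show "\<phi> x + smult (- 1) (lin_ext (\<lambda>_. e) (d x)) \<in> d ` free_part r (Suc 1)"
      if x: "x \<in> free_part r (Suc 0)" for x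
    proof -
      have "lin_ext (\<lambda>_. e) (d x) \<in> free_part r (Suc 0)"
        by (rule linear_free_part_into[OF linear_lin_ext _ subspace_free_part D(3)[OF x]])
           (simp add: e)
      then have "\<phi> x + smult (- 1) (lin_ext (\<lambda>_. e) (d x)) \<in> free_part r (Suc 0)"
        using \<phi>(1)[OF x] by (simp add: felem.subspace_diff subspace_free_part)
      moreover have "d (\<phi> x + smult (- 1) (lin_ext (\<lambda>_. e) (d x))) = 0"
        using e_lin[OF D(3)[OF x]] \<phi>(2)[OF x]
        by (simp add: linear_diff[OF lin(1)])
      ultimately show ?thesis
        using D(5) by auto
    qed
  qed (use lin D in auto)
  then obtain H where H: "linear_map H" "\<And>i x. x \<in> free_part r i \<Longrightarrow> H x \<in> free_part r (Suc i)"
    "H (basis (0, 0)) = e"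
    "\<And>i x. x \<in> free_part r (Suc i) \<Longrightarrow> d (H x) = \<phi> x - H (d x)"
    using D(1) by auto
  have "d (H x) + H (d x) = \<phi> x" if x: "x \<in> free_part r i" for i x
  proof (cases i)
    case 0
    have "d (H x) = \<phi> x"
      using x unfolding 0
      by (rule linear_eq_on_free_part[OF linear_comp[OF lin(1) H(1)] lin(2), rotated])
         (simp add: D(1) H(3) e)
    then show ?thesis
      using x 0 by (simp add: D(2) linear_zero[OF H(1)])
  qed (use H(4) x in simp)
  with H show ?thesis
    by blast
qed

section \<open>Square-zero homotopies\<close>

definition square_zero_homotopy ::
  "(nat \<Rightarrow> nat) \<Rightarrow> ('a::comm_ring_1 felem \<Rightarrow> 'a felem) \<Rightarrow> 'a \<Rightarrow> ('a felem \<Rightarrow> 'a felem) \<Rightarrow> bool" where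
  "square_zero_homotopy r d s H \<longleftrightarrow> linear_map H \<and>
     (\<forall>i. \<forall>x\<in>free_part r i. H x \<in> free_part r (Suc i)) \<and>
     (\<forall>i. \<forall>x\<in>free_part r i. d (H x) + H (d x) = smult s x) \<and>
     (\<forall>i. \<forall>x\<in>free_part r i. H (H x) = 0)"

text \<open>Multiplication by \<open>q\<close> is null-homotopic, say through \<open>H\<close>, as \<open>q\<close> kills the resolved module
  \<open>S/J\<close>. Then \<open>d H d = q d\<close>, so \<open>H d H\<close> is a null homotopy of multiplication by \<open>q\<^sup>2\<close>.
  Its square is \<open>H (d H H) d H\<close>, where \<open>d H H = q H - H d H\<close>, and the two resulting terms
  \<open>q H H d H\<close> and \<open>H H d H d H = q H H d H\<close> cancel.\<close>

lemma square_zero_homotopy_exists: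
  fixes d :: "'a::comm_ring_1 felem \<Rightarrow> 'a felem"
  assumes res: "free_resolution J r d" and lin: "linear_map d" and q: "q \<in> J"
  shows "\<exists>H. square_zero_homotopy r d (q * q) H"
proof -
  note D = free_resolutionD[OF res]
  have "\<exists>H. linear_map H \<and> (\<forall>i. \<forall>x\<in>free_part r i. H x \<in> free_part r (Suc i)) \<and>
    (\<forall>i. \<forall>x\<in>free_part r i. d (H x) + H (d x) = smult q x)"
  proof (rule null_homotopy[OF res lin])
    show "linear_map (smult q :: 'a felem \<Rightarrow> _)"
      by (rule linear_scale[OF linear_id])
    show "smult q (basis (0, 0)) \<in> d ` free_part r (Suc 0)"
      using D(4) q by (simp flip: of_ring_eq_smult)
  qed (simp_all add: felem.subspace_scale subspace_free_part linear_smult[OF lin])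
  then obtain H where H: "linear_map H" "\<And>i x. x \<in> free_part r i \<Longrightarrow> H x \<in> free_part r (Suc i)"
    and hom: "\<And>i x. x \<in> free_part r i \<Longrightarrow> d (H x) + H (d x) = smult q x"
    by blast
  note H0 = linear_zero[OF H(1)] and HS = linear_smult[OF H(1)] and HM = linear_diff[OF H(1)]
  have dH: "d (H x) = smult q x - H (d x)" if "x \<in> free_part r i" for i x
    using hom[OF that] by (simp add: algebra_simps)
  have dHd: "d (H (d x)) = smult q (d x)" if "x \<in> free_part r i" for i x
  proof (cases i)
    case 0
    with that show ?thesis by (simp add: D(2) H0 linear_zero[OF lin])
  next
    case (Suc n)
    with that have x: "x \<in> free_part r (Suc n)" by simp
    show ?thesis using dH[OF D(3)[OF x]] D(6)[OF x] by (simp add: H0)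
  qed
  have "square_zero_homotopy r d (q * q) (\<lambda>x. H (d (H x)))"
    unfolding square_zero_homotopy_def
  proof (intro conjI allI ballI)
    show "linear_map (\<lambda>x. H (d (H x)))"
      by (rule linear_comp[OF H(1) linear_comp[OF lin H(1)]])
  next
    fix i and x :: "'a felem" assume x: "x \<in> free_part r i"
    show "H (d (H x)) \<in> free_part r (Suc i)"
      using H(2) D(3) x by blast
    have "d (H (d (H x))) + H (d (H (d x))) = smult q (d (H x) + H (d x))"
      using dHd[OF x] dHd[OF H(2)[OF x]] by (simp add: HS felem.scale_right_distrib)
    then show "d (H (d (H x))) + H (d (H (d x))) = smult (q * q) x"
      using hom[OF x] by simp
    define y where "y = d (H x)"
    have y: "y \<in> free_part r i"
      using H(2) D(3) x by (auto simp: y_def)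
    have dHy: "d (H y) = smult q y"
      unfolding y_def by (rule dHd) (rule H(2)[OF x])
    have "d (H (H y)) = smult q (H y) - H (smult q y)"
      using dH[OF H(2)[OF y]] dHy by simp
    then have "H (d (H (H y))) = 0"
      by (simp add: H0 HS HM)
    then show "H (d (H (H (d (H x))))) = 0"
      by (simp add: y_def)
  qed
  then show ?thesis
    by blast
qed

section \<open>The multiplication of a square-zero homotopy\<close>

definition sign_map :: "'a::comm_ring_1 felem \<Rightarrow> 'a felem" where
  "sign_map = lin_ext (\<lambda>k. smult ((-1) ^ fst k) (basis k))"

lemma linear_sign_map: "linear_map sign_map"
  by (simp add: sign_map_def linear_lin_ext)

lemma sign_map_free_part: "x \<in> free_part r i \<Longrightarrow> sign_map x = smult ((-1) ^ i) x"
  by (rule linear_eq_on_free_part[OF linear_sign_map linear_scale[OF linear_id]])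
     (auto simp: sign_map_def)

text \<open>The product of \<open>x\<^sub>0 + x\<close> and \<open>y\<^sub>0 + y\<close>, where \<open>x\<^sub>0\<close> and \<open>y\<^sub>0\<close> are the parts of degree 0: the
  first three terms are \<open>x\<^sub>0y\<^sub>0 + x\<^sub>0y + y\<^sub>0x\<close>. The sign map carries the sign \<open>(-1)\<^bsup>|x|\<^esup>\<close>,
  so that the formula is bilinear on the whole direct sum.\<close>

definition dga_mult ::
  "('a::comm_ring_1 felem \<Rightarrow> 'a) \<Rightarrow> ('a felem \<Rightarrow> 'a felem) \<Rightarrow> 'a felem \<Rightarrow> 'a felem \<Rightarrow> 'a felem" where
  "dga_mult \<alpha> H x y =
     smult (coeff x (0, 0)) y + smult (coeff y (0, 0)) x - of_ring (coeff x (0, 0) * coeff y (0, 0))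
     + smult (\<alpha> x) (H y) + smult (\<alpha> y) (H (sign_map x))"

lemma linear_over_linear_map: "linear_map f \<Longrightarrow> linear_over F f"
  by (simp add: linear_over_def linear_add linear_smult)

text \<open>The Leibniz rule in degrees \<open>(1, 1)\<close> is where the element \<open>e\<close> drops out, as \<open>\<alpha>(x) \<alpha>(y) e\<close> occurs
  twice with opposite signs. If only one degree is 1, it is the homotopy identity multiplied by a
  scalar, and if both are at least 2, all terms vanish since \<open>\<alpha> d = 0\<close> on degree 2.\<close>

lemma dga_from_homotopy:
  fixes d H :: "'a::comm_ring_1 felem \<Rightarrow> 'a felem" and \<alpha> :: "'a felem \<Rightarrow> 'a"
  assumes res: "free_resolution J r d" and lin: "linear_map d"
    and \<alpha>: "\<And>x y. \<alpha> (x + y) = \<alpha> x + \<alpha> y" "\<And>c x. \<alpha> (smult c x) = c * \<alpha> x"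
      "\<And>i x. x \<in> free_part r i \<Longrightarrow> i \<noteq> 1 \<Longrightarrow> \<alpha> x = 0"
      "\<And>x. x \<in> free_part r 1 \<Longrightarrow> d x = of_ring (s * \<alpha> x)"
      "\<And>x. x \<in> free_part r 2 \<Longrightarrow> \<alpha> (d x) = 0"
    and lin_H: "linear_map H"
    and H: "\<And>i x. x \<in> free_part r i \<Longrightarrow> H x \<in> free_part r (Suc i)"
      "\<And>x. x \<in> free_part r 0 \<Longrightarrow> H x = 0"
      "\<And>i x. x \<in> free_part r i \<Longrightarrow> H (H x) = 0"
      "\<And>i x. x \<in> free_part r (Suc (Suc i)) \<Longrightarrow> d (H x) + H (d x) = smult s x"
      "\<And>x. x \<in> free_part r 1 \<Longrightarrow> d (H x) = smult s x - smult (\<alpha> x) e"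
  shows "dga_structure r d (dga_mult \<alpha> H)"
proof -
  note D = free_resolutionD[OF res]
  let ?m = "dga_mult \<alpha> H"
  note Hl = linear_add[OF lin_H] linear_smult[OF lin_H] linear_zero[OF lin_H] linear_diff[OF lin_H]
  note Dl = linear_add[OF lin] linear_smult[OF lin] linear_zero[OF lin] linear_diff[OF lin]
  note Sl = linear_add[OF linear_sign_map] linear_smult[OF linear_sign_map]
  have func: "linear_map (\<lambda>x. smult (coeff x (0, 0)) v)" "linear_map (\<lambda>x. smult (\<alpha> x) v)" for v
    by (rule linear_mapI; simp add: lookup_add \<alpha>(1,2) felem.scale_left_distrib)+
  have mult_eq: "?m x y = smult (coeff x (0, 0)) y + smult (coeff y (0, 0)) x
      - smult (coeff x (0, 0)) (of_ring (coeff y (0, 0)))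
      + smult (\<alpha> x) (H y) + smult (\<alpha> y) (H (sign_map x))" for x y
    by (simp add: dga_mult_def)
  have mult_eq': "?m x y = smult (coeff x (0, 0)) y + smult (coeff y (0, 0)) x
      - smult (coeff y (0, 0)) (of_ring (coeff x (0, 0)))
      + smult (\<alpha> x) (H y) + smult (\<alpha> y) (H (sign_map x))" for x y
    by (simp add: dga_mult_def mult.commute)
  have lin_left: "linear_map (\<lambda>x. ?m x y)" for y
    unfolding mult_eq
    by (rule linear_plus[OF linear_plus[OF linear_minus[OF linear_plus[OF func(1)
      linear_scale[OF linear_id]] func(1)] func(2)] linear_scale[OF linear_comp[OF lin_H linear_sign_map]]])
  have lin_right: "linear_map (\<lambda>y. ?m x y)" for x
    unfolding mult_eq'
    by (rule linear_plus[OF linear_plus[OF linear_minus[OF linear_plus[OF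
      linear_scale[OF linear_id] func(1)] func(1)] linear_scale[OF lin_H]] func(2)])
  have sub: "felem.subspace (free_part r i)" for i
    by (rule subspace_free_part)
  have H_sign: "H (sign_map x) = smult ((-1) ^ i) (H x)" if "x \<in> free_part r i" for x i
    using that by (simp add: sign_map_free_part Hl)
  have left_0: "?m x y = smult (coeff x (0, 0)) y" if x: "x \<in> free_part r 0" for x y
  proof -
    have "smult (coeff y (0, 0)) x = of_ring (coeff x (0, 0) * coeff y (0, 0))"
      using free_part_0[OF D(1) x] by (metis mult.commute smult_of_ring)
    then show ?thesis
      using x by (simp add: dga_mult_def \<alpha>(3) H_sign H(2))
  qed
  have right_0: "?m x y = smult (coeff y (0, 0)) x" if y: "y \<in> free_part r 0" for x y
  proof -
    have "smult (coeff x (0, 0)) y = of_ring (coeff x (0, 0) * coeff y (0, 0))"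
      using free_part_0[OF D(1) y] by (metis smult_of_ring)
    then show ?thesis
      using y by (simp add: dga_mult_def \<alpha>(3) H(2))
  qed
  have pos: "?m x y = smult (\<alpha> x) (H y) + smult ((-1) ^ i * \<alpha> y) (H x)"
    if "x \<in> free_part r i" "y \<in> free_part r j" "i \<noteq> 0" "j \<noteq> 0" for x y i j
    using that by (simp add: dga_mult_def coeff_free_part_other H_sign mult.commute)
  have \<alpha>_pos: "\<alpha> x = 0" if "x \<in> free_part r i" "i \<noteq> Suc 0" for x i
    using \<alpha>(3) that by simp
  have \<alpha>_d: "\<alpha> (d x) = 0" if x: "x \<in> free_part r (Suc (Suc i))" for x i
    using \<alpha>(5)[of x] \<alpha>_pos[OF D(3)[OF x]] x by (cases "i = 0") (auto simp: numeral_2_eq_2)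
  have part: "?m x y \<in> free_part r (i + j)" if x: "x \<in> free_part r i" and y: "y \<in> free_part r j" for x y i j
  proof (cases "i = 0 \<or> j = 0")
    case True
    then show ?thesis
      using x y by (auto simp: left_0 right_0 felem.subspace_scale sub)
  next
    case False
    have "smult (\<alpha> x) (H y) \<in> free_part r (i + j)"
      using H(1)[OF y] by (cases "i = 1") (auto simp: felem.subspace_scale felem.subspace_0 sub \<alpha>_pos[OF x])
    moreover have "smult ((-1) ^ i * \<alpha> y) (H x) \<in> free_part r (i + j)"
      using H(1)[OF x] by (cases "j = 1") (auto simp: felem.subspace_scale felem.subspace_0 sub \<alpha>_pos[OF y])
    ultimately show ?thesis
      using False by (simp add: pos[OF x y] felem.subspace_add sub)
  qed
  have comm: "?m x y = smult ((-1) ^ (i * j)) (?m y x)"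
    if x: "x \<in> free_part r i" and y: "y \<in> free_part r j" for x y i j
  proof (cases "i = 0 \<or> j = 0")
    case True
    then show ?thesis
      using x y by (auto simp: left_0 right_0)
  next
    case False
    then have "?m x y = smult (\<alpha> x) (H y) + smult ((-1) ^ i * \<alpha> y) (H x)"
      "?m y x = smult (\<alpha> y) (H x) + smult ((-1) ^ j * \<alpha> x) (H y)"
      using pos[OF x y] pos[OF y x] by auto
    then show ?thesis
      by (cases "i = 1"; cases "j = 1")
        (auto simp: \<alpha>_pos[OF x] \<alpha>_pos[OF y] felem.scale_right_distrib felem.scale_right_diff_distrib
          simp flip: power_mult_distrib mult.assoc)
  qed
  have leib: "d (?m x y) = ?m (d x) y + smult ((-1) ^ i) (?m x (d y))"
    if x: "x \<in> free_part r i" and y: "y \<in> free_part r j" for x y i j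
  proof -
    consider "i = 0" | "j = 0" | "i = 1" "j = 1" | j' where "i = 1" "j = Suc (Suc j')"
      | i' where "i = Suc (Suc i')" "j = 1" | i' j' where "i = Suc (Suc i')" "j = Suc (Suc j')"
      by (metis One_nat_def not0_implies_Suc)
    then show ?thesis
    proof cases
      case 1
      have "?m (d x) y = 0"
        using x 1 by (simp add: D(2) linear_zero[OF lin_left])
      then show ?thesis
        using x 1 by (simp add: left_0 Dl)
    next
      case 2
      have "?m x (d y) = 0"
        using y 2 by (simp add: D(2) linear_zero[OF lin_right])
      then show ?thesis
        using y 2 by (simp add: right_0 Dl)
    next
      case 3
      have x1: "x \<in> free_part r 1" and y1: "y \<in> free_part r 1"
        using x y 3 by auto
      have "?m (d x) y = smult (s * \<alpha> x) y" "?m x (d y) = smult (s * \<alpha> y) x"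
        using \<alpha>(4)[OF x1] \<alpha>(4)[OF y1] D(1)
        by (auto simp: left_0 right_0 of_ring_in_free_part)
      moreover have "d (?m x y) = smult (\<alpha> x) (d (H y)) - smult (\<alpha> y) (d (H x))"
        using pos[OF x1 y1] by (simp add: Dl)
      ultimately show ?thesis
        using 3 H(5)[OF x1] H(5)[OF y1]
        by (simp add: felem.scale_right_diff_distrib mult.commute)
    next
      case 4
      have x1: "x \<in> free_part r 1" and y1: "y \<in> free_part r (Suc (Suc j'))"
        using x y 4 by auto
      have dy: "d y \<in> free_part r (Suc j')"
        by (rule D(3)[OF y1])
      have \<alpha>0: "\<alpha> y = 0" "\<alpha> (d y) = 0"
        using \<alpha>_pos[OF y1] \<alpha>_d[OF y1] by auto
      have "?m (d x) y = smult (s * \<alpha> x) y"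
        using \<alpha>(4)[OF x1] D(1) by (auto simp: left_0 of_ring_in_free_part)
      moreover have "?m x (d y) = smult (\<alpha> x) (H (d y))"
        using pos[OF x1 dy] by (simp add: \<alpha>0)
      moreover have "d (?m x y) = smult (\<alpha> x) (d (H y))"
        using pos[OF x1 y1] by (simp add: \<alpha>0 Dl)
      moreover have "d (H y) = smult s y - H (d y)"
        using H(4)[OF y1] by (simp only: eq_diff_eq)
      ultimately show ?thesis
        using 4 by (simp add: felem.scale_right_diff_distrib mult.commute)
    next
      case 5
      have x1: "x \<in> free_part r (Suc (Suc i'))" and y1: "y \<in> free_part r 1"
        using x y 5 by auto
      have dx: "d x \<in> free_part r (Suc i')"
        by (rule D(3)[OF x1])
      have \<alpha>0: "\<alpha> x = 0" "\<alpha> (d x) = 0"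
        using \<alpha>_pos[OF x1] \<alpha>_d[OF x1] by auto
      have "?m x (d y) = smult (s * \<alpha> y) x"
        using \<alpha>(4)[OF y1] D(1) by (auto simp: right_0 of_ring_in_free_part)
      moreover have "?m (d x) y = - smult ((-1) ^ i' * \<alpha> y) (H (d x))"
        using pos[OF dx y1] by (simp add: \<alpha>0)
      moreover have "d (?m x y) = smult ((-1) ^ i' * \<alpha> y) (d (H x))"
        using pos[OF x1 y1] by (simp add: \<alpha>0 Dl)
      moreover have "d (H x) = smult s x - H (d x)"
        using H(4)[OF x1] by (simp only: eq_diff_eq)
      moreover have "smult ((-1) ^ i) (?m x (d y)) = smult ((-1) ^ i' * \<alpha> y) (smult s x)"
      proof -
        have "(-1) ^ i * (s * \<alpha> y) = (-1) ^ i' * \<alpha> y * s"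
          unfolding 5 by (simp add: ac_simps)
        then show ?thesis
          unfolding calculation(1) felem.scale_scale by (rule arg_cong)
      qed
      ultimately show ?thesis
        by (simp only: felem.scale_right_diff_distrib) simp
    next
      case 6
      have x1: "x \<in> free_part r (Suc (Suc i'))" and y1: "y \<in> free_part r (Suc (Suc j'))"
        using x y 6 by auto
      have dx: "d x \<in> free_part r (Suc i')" and dy: "d y \<in> free_part r (Suc j')"
        by (rule D(3)[OF x1], rule D(3)[OF y1])
      have \<alpha>0: "\<alpha> x = 0" "\<alpha> (d x) = 0" "\<alpha> y = 0" "\<alpha> (d y) = 0"
        using \<alpha>_pos[OF x1] \<alpha>_d[OF x1] \<alpha>_pos[OF y1] \<alpha>_d[OF y1] by auto
      show ?thesis
        using pos[OF x1 y1] pos[OF dx y1] pos[OF x1 dy] by (simp add: \<alpha>0 Dl)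
    qed
  qed
  have assoc: "?m (?m x y) z = ?m x (?m y z)"
    if x: "x \<in> free_part r i" and y: "y \<in> free_part r j" and z: "z \<in> free_part r k" for x y z i j k
  proof -
    consider "i = 0" | "j = 0" | "k = 0" | "i \<noteq> 0" "j \<noteq> 0" "k \<noteq> 0"
      by blast
    then show ?thesis
    proof cases
      case 1
      then show ?thesis using x by (simp add: left_0 linear_smult[OF lin_left])
    next
      case 2
      then show ?thesis
        using y by (simp add: left_0 right_0 linear_smult[OF lin_left] linear_smult[OF lin_right])
    next
      case 3
      then show ?thesis using z by (simp add: right_0 linear_smult[OF lin_right])
    next
      case 4
      have xy: "?m x y \<in> free_part r (i + j)" and yz: "?m y z \<in> free_part r (j + k)"
        using part x y z by auto
      have "\<alpha> (?m x y) = 0" "\<alpha> (?m y z) = 0"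
        using \<alpha>_pos[OF xy] \<alpha>_pos[OF yz] 4 by auto
      moreover have "H (?m x y) = 0" "H (?m y z) = 0"
        using pos[OF x y] pos[OF y z] H(3)[OF x] H(3)[OF y] H(3)[OF z] 4 by (auto simp: Hl)
      ultimately show ?thesis
        using pos[OF xy z] pos[OF x yz] 4 by simp
    qed
  qed
  have one: "of_ring a \<in> free_part r 0" for a :: 'a
    using D(1) by (rule of_ring_in_free_part)
  show ?thesis
    unfolding dga_structure_def
  proof (intro conjI allI ballI)
    show "?m (of_ring a) (of_ring b) = of_ring (a * b)" for a b
      by (simp add: left_0 one)
    show "?m (of_ring 1) x = x" "?m x (of_ring 1) = x" for x
      by (simp_all add: left_0 right_0 one)
  qed (fact part comm leib assoc | rule linear_over_linear_map lin_left lin_right)+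
qed

section \<open>Dividing the first differential\<close>

text \<open>The choice is unique when multiplication by \<open>s\<close> is injective on \<open>I\<close>; the differential must be
  divided on basis elements only, since linearity does the rest.\<close>

definition rescaled ::
  "'a::comm_ring_1 \<Rightarrow> 'a set \<Rightarrow> ('a felem \<Rightarrow> 'a felem) \<Rightarrow> 'a felem \<Rightarrow> 'a felem" where
  "rescaled s I d = lin_ext (\<lambda>k. if fst k = 0 then 0
     else if fst k = 1 then of_ring (SOME a. a \<in> I \<and> d (basis k) = of_ring (s * a))
     else d (basis k))"

lemma linear_rescaled: "linear_map (rescaled s I d)"
  by (simp add: rescaled_def linear_lin_ext)

lemma rescaled_eq:
  assumes res: "free_resolution ((*) s ` I) r d" and lin: "linear_map d" and I: "is_ideal I"
  shows "x \<in> free_part r 0 \<Longrightarrow> rescaled s I d x = 0"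
    and "x \<in> free_part r (Suc 0) \<Longrightarrow> rescaled s I d x \<in> of_ring ` I"
    and "x \<in> free_part r (Suc 0) \<Longrightarrow> d x = smult s (rescaled s I d x)"
    and "x \<in> free_part r (Suc (Suc i)) \<Longrightarrow> rescaled s I d x = d x"
proof -
  note D = free_resolutionD[OF res]
  show "x \<in> free_part r 0 \<Longrightarrow> rescaled s I d x = 0"
    by (rule linear_eq_on_free_part[OF linear_rescaled linear_0]) (auto simp: rescaled_def)
  have *: "\<exists>a. a \<in> I \<and> d (basis (1, j)) = of_ring (s * a)" if "j < r 1" for j
  proof -
    have "d (basis (1, j)) \<in> of_ring ` (*) s ` I"
      using D(4) that by (metis basis_in_free_part imageI)
    then show ?thesis by auto
  qed
  have b: "rescaled s I d (basis (Suc 0, j)) \<in> of_ring ` I \<and>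
    d (basis (Suc 0, j)) = smult s (rescaled s I d (basis (Suc 0, j)))" if "j < r (Suc 0)" for j
    using someI_ex[OF *[of j]] that by (auto simp: rescaled_def)
  show "rescaled s I d x \<in> of_ring ` I" if "x \<in> free_part r (Suc 0)"
    by (rule linear_free_part_into[OF linear_rescaled _ subspace_of_ring_ideal[OF I] that])
      (use b in blast)
  show "d x = smult s (rescaled s I d x)" if "x \<in> free_part r (Suc 0)"
    by (rule linear_eq_on_free_part[OF lin linear_scale[OF linear_rescaled] _ that]) (use b in blast)
  show "x \<in> free_part r (Suc (Suc i)) \<Longrightarrow> rescaled s I d x = d x"
    by (rule linear_eq_on_free_part[OF linear_rescaled lin]) (auto simp: rescaled_def)
qed

text \<open>Injectivity of \<open>s\<close> on \<open>I\<close> gives the divided differential the same kernel as the original one,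
  so exactness in degree 1 survives, and it makes the preimage of each \<open>a \<in> I\<close> unique.\<close>

lemma free_resolution_rescaled:
  assumes res: "free_resolution ((*) s ` I) r d" and lin: "linear_map d" and I: "is_ideal I"
    and inj: "\<And>a. a \<in> I \<Longrightarrow> s * a = 0 \<Longrightarrow> a = 0"
  shows "free_resolution I r (rescaled s I d)"
proof -
  note D = free_resolutionD[OF res]
  note R = rescaled_eq[OF res lin I]
  let ?d = "rescaled s I d"
  have ker: "?d x = 0 \<longleftrightarrow> d x = 0" if x: "x \<in> free_part r (Suc i)" for x i
  proof (cases i)
    case 0
    obtain a where a: "?d x = of_ring a" "a \<in> I"
      using R(2) x 0 by auto
    moreover have "d x = of_ring (s * a)"
      using R(3) x 0 a by simp
    ultimately show ?thesis
      using inj[of a] by auto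
  qed (use R(4) x in auto)
  have im: "?d ` free_part r (Suc (Suc i)) = d ` free_part r (Suc (Suc i))" for i
    using R(4) by simp
  have "?d ` free_part r 1 = of_ring ` I"
  proof
    show "?d ` free_part r 1 \<subseteq> of_ring ` I"
      using R(2) by (simp add: image_subset_iff)
    show "of_ring ` I \<subseteq> ?d ` free_part r 1"
    proof
      fix y assume "y \<in> of_ring ` I"
      then obtain a where a: "a \<in> I" "y = of_ring a"
        by auto
      then have "of_ring (s * a) \<in> d ` free_part r 1"
        using D(4) by auto
      then obtain x where x: "x \<in> free_part r 1" "d x = of_ring (s * a)"
        by auto
      then obtain b where b: "?d x = of_ring b" "b \<in> I"
        using R(2)[of x] by auto
      then have "s * a = s * b"
        using R(3)[of x] x by simp
      then have "a - b = 0"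
        using is_idealD(3)[OF I a(1) b(2)] by (intro inj[of "a - b"]) (simp_all add: right_diff_distrib)
      then have "?d x = y"
        using a b by simp
      then show "y \<in> ?d ` free_part r 1"
        using x(1) by blast
    qed
  qed
  moreover have sub: "?d ` free_part r (Suc i) \<subseteq> free_part r i" for i
  proof (cases i)
    case 0
    have "of_ring ` I \<subseteq> free_part r 0"
      using D(1) by (auto simp: of_ring_in_free_part)
    then show ?thesis
      using R(2) 0 by blast
  next
    case (Suc n)
    then show ?thesis
      unfolding Suc im image_subset_iff by (intro ballI D(3))
  qed
  moreover have ex: "{x \<in> free_part r (Suc i). ?d x = 0} = ?d ` free_part r (Suc (Suc i))" for i
  proof -
    have "{x \<in> free_part r (Suc i). d x = 0} = d ` free_part r (Suc (Suc i))"
      using res by (simp add: free_resolution_def)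
    moreover have "{x \<in> free_part r (Suc i). ?d x = 0} = {x \<in> free_part r (Suc i). d x = 0}"
      using ker by blast
    ultimately show ?thesis
      unfolding im by simp
  qed
  ultimately show ?thesis
    unfolding free_resolution_def
    using D(1) sub ex R(1) linear_over_linear_map[OF linear_rescaled] by simp
qed

text \<open>The functional \<open>\<alpha>\<close> of the introduction, extended by zero to all degrees other than 1.\<close>

definition augmentation :: "('a::comm_ring_1 felem \<Rightarrow> 'a felem) \<Rightarrow> 'a felem \<Rightarrow> 'a" where
  "augmentation d x = coeff (lin_ext (\<lambda>k. if fst k = 1 then d (basis k) else 0) x) (0, 0)"

definition positive_part :: "('a::comm_ring_1 felem \<Rightarrow> 'a felem) \<Rightarrow> 'a felem \<Rightarrow> 'a felem" where
  "positive_part H = lin_ext (\<lambda>k. if fst k = 0 then 0 else H (basis k))"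

lemma augmentation_simps [simp]:
  "augmentation d (x + y) = augmentation d x + augmentation d y"
  "augmentation d (smult c x) = c * augmentation d x"
  by (simp_all add: augmentation_def linear_add[OF linear_lin_ext] linear_smult[OF linear_lin_ext] lookup_add)

lemma augmentation_free_part:
  assumes "linear_map d"
  shows "x \<in> free_part r (Suc 0) \<Longrightarrow> augmentation d x = coeff (d x) (0, 0)"
    and "x \<in> free_part r i \<Longrightarrow> i \<noteq> 1 \<Longrightarrow> augmentation d x = 0"
proof -
  let ?A = "lin_ext (\<lambda>k. if fst k = 1 then d (basis k) else 0)"
  show "augmentation d x = coeff (d x) (0, 0)" if "x \<in> free_part r (Suc 0)"
    unfolding augmentation_def
    by (subst linear_eq_on_free_part[OF linear_lin_ext assms _ that]) auto
  show "augmentation d x = 0" if "x \<in> free_part r i" "i \<noteq> 1"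
    unfolding augmentation_def
    by (subst linear_eq_on_free_part[OF linear_lin_ext linear_0 _ that(1)]) (use that(2) in auto)
qed

lemma positive_part_free_part:
  assumes "linear_map H"
  shows "x \<in> free_part r 0 \<Longrightarrow> positive_part H x = 0"
    and "x \<in> free_part r (Suc i) \<Longrightarrow> positive_part H x = H x"
proof -
  show "x \<in> free_part r 0 \<Longrightarrow> positive_part H x = 0"
    unfolding positive_part_def
    by (rule linear_eq_on_free_part[OF linear_lin_ext linear_0]) auto
  show "x \<in> free_part r (Suc i) \<Longrightarrow> positive_part H x = H x"
    unfolding positive_part_def
    by (rule linear_eq_on_free_part[OF linear_lin_ext assms]) auto
qed

text \<open>The homotopy identity in degree 1 reads \<open>d H x = s x - \<alpha>(x) H(1)\<close>, because \<open>H\<close> is linear and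
  the divided differential of \<open>x\<close> is the scalar \<open>\<alpha>(x)\<close>. So \<open>H\<close> may be replaced by zero in degree 0,
  with \<open>e = H(1)\<close>.\<close>

lemma dga_of_square_zero_homotopy:
  assumes res: "free_resolution ((*) s ` I) r d" and lin: "linear_map d" and I: "is_ideal I"
    and inj: "\<And>a. a \<in> I \<Longrightarrow> s * a = 0 \<Longrightarrow> a = 0"
    and H: "square_zero_homotopy r (rescaled s I d) s H"
  shows "dga_structure r d (dga_mult (augmentation (rescaled s I d)) (positive_part H))"
proof -
  let ?d = "rescaled s I d"
  note R = rescaled_eq[OF res lin I]
  have "free_resolution I r ?d"
    by (rule free_resolution_rescaled[OF res lin I]) (rule inj)
  note D = free_resolutionD[OF this]
  note lin_d = linear_rescaled[of s I d]
  note aug = augmentation_free_part[OF lin_d]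
  have lin_H: "linear_map H"
    and Hp: "\<And>x i. x \<in> free_part r i \<Longrightarrow> H x \<in> free_part r (Suc i)"
    and hom: "\<And>x i. x \<in> free_part r i \<Longrightarrow> ?d (H x) + H (?d x) = smult s x"
    and HH: "\<And>x i. x \<in> free_part r i \<Longrightarrow> H (H x) = 0"
    using H by (auto simp: square_zero_homotopy_def)
  note pos = positive_part_free_part[OF lin_H]
  have d1: "?d x = of_ring (augmentation ?d x)" if "x \<in> free_part r (Suc 0)" for x
    using D(3)[OF that] D(1) free_part_0[of r "?d x"] aug(1)[OF that] by simp
  show ?thesis
  proof (rule dga_from_homotopy[OF res lin, where s = s and e = "H (basis (0, 0))"])
    show "augmentation ?d x = 0" if "x \<in> free_part r i" "i \<noteq> 1" for i x
      using aug(2) that .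
    show "d x = of_ring (s * augmentation ?d x)" if "x \<in> free_part r 1" for x
      using that d1[of x] R(3)[of x] by (metis One_nat_def smult_of_ring)
    show "augmentation ?d (d x) = 0" if "x \<in> free_part r 2" for x
    proof -
      have x: "x \<in> free_part r (Suc (Suc 0))"
        using that by (simp add: numeral_2_eq_2)
      show ?thesis
        using aug(1)[of "?d x" r] D(3,6)[OF x] R(4)[OF x] by simp
    qed
    show "linear_map (positive_part H)"
      by (simp add: positive_part_def linear_lin_ext)
    show "positive_part H x \<in> free_part r (Suc i)" if "x \<in> free_part r i" for i x
      using that pos Hp by (cases i) (auto simp: felem.subspace_0 subspace_free_part)
    show "positive_part H x = 0" if "x \<in> free_part r 0" for x
      using pos(1) that .
    show "positive_part H (positive_part H x) = 0" if "x \<in> free_part r i" for i x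
    proof (cases i)
      case 0
      then show ?thesis using that pos(1)
        by (simp add: linear_zero[OF linear_lin_ext] positive_part_def)
    next
      case (Suc n)
      then show ?thesis using that pos(2) Hp HH by metis
    qed
    show "d (positive_part H x) + positive_part H (d x) = smult s x"
      if x: "x \<in> free_part r (Suc (Suc i))" for i x
    proof -
      have "d x \<in> free_part r (Suc i)"
        using D(3)[OF x] R(4)[OF x] by simp
      then show ?thesis
        using hom[OF x] pos(2) x R(4)[OF x] R(4)[OF Hp[OF x]] by simp
    qed
    show "d (positive_part H x) = smult s x - smult (augmentation ?d x) (H (basis (0, 0)))"
      if x: "x \<in> free_part r 1" for x
    proof -
      have x: "x \<in> free_part r (Suc 0)" using x by simp
      have "H (?d x) = smult (augmentation ?d x) (H (basis (0, 0)))"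
        by (subst d1[OF x]) (simp add: of_ring_eq_smult linear_smult[OF lin_H])
      then show ?thesis
        using hom[OF x] pos(2)[OF x] R(4)[OF Hp[OF x]] by (simp add: eq_diff_eq)
    qed
  qed simp_all
qed

lemma dga_of_square_multiple:
  assumes res: "free_resolution ((*) (q * q) ` I) r d" and lin: "linear_map d" and I: "is_ideal I"
    and q: "q \<in> I" and inj: "\<And>a. a \<in> I \<Longrightarrow> q * q * a = 0 \<Longrightarrow> a = 0"
  shows "\<exists>m. dga_structure r d m"
proof -
  have "free_resolution I r (rescaled (q * q) I d)"
    by (rule free_resolution_rescaled[OF res lin I]) (rule inj)
  then obtain H where "square_zero_homotopy r (rescaled (q * q) I d) (q * q) H"
    using square_zero_homotopy_exists[OF _ linear_rescaled q] by blast
  then have "dga_structure r d (dga_mult (augmentation (rescaled (q * q) I d)) (positive_part H))"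
    by (intro dga_of_square_zero_homotopy[OF res lin I]) (rule inj)
  then show ?thesis
    by (rule exI[where P = "dga_structure r d"])
qed

text \<open>With \<open>d = 0\<close> on degree 1, products of elements of positive degree may all be zero.\<close>

lemma dga_of_zero_ideal:
  assumes res: "free_resolution {0} r d" and lin: "linear_map d"
  shows "dga_structure r d (dga_mult (\<lambda>_. 0) (\<lambda>_. 0))"
proof (rule dga_from_homotopy[OF res lin, where s = 0 and e = 0])
  show "d x = of_ring (0 * 0)" if "x \<in> free_part r 1" for x
    using free_resolutionD(4)[OF res] that by auto
qed (simp_all add: linear_0 linear_zero[OF lin] felem.subspace_0 subspace_free_part)

section \<open>Linear representatives of differentials\<close>

text \<open>The differentials of resolutions are linear on the free modules only and arbitrary elsewhere.
  The linear extension of their values on the basis is linear everywhere, and it has the same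
  restrictions.\<close>

lemma linear_over_eq_lin_ext:
  assumes d: "linear_over (free_sum r) d" and x: "x \<in> free_sum r"
  shows "d x = lin_ext (\<lambda>k. d (basis k)) x"
proof -
  have add: "d (x + y) = d x + d y" if "x \<in> free_sum r" "y \<in> free_sum r" for x y
    using d that by (simp add: linear_over_def)
  have sc: "d (smult c x) = smult c (d x)" if "x \<in> free_sum r" for c x
    using d that by (simp add: linear_over_def)
  note sub = felem.subspace_add[OF subspace_free_sum] felem.subspace_scale[OF subspace_free_sum]
  have 0: "0 \<in> free_sum r"
    by (simp add: felem.subspace_0 subspace_free_sum)
  have d0: "d 0 = 0"
    using sc[OF 0, of 0] by simp
  have "(\<Sum>k\<in>A. smult (coeff x k) (basis k)) \<in> free_sum r \<and>
    d (\<Sum>k\<in>A. smult (coeff x k) (basis k)) = (\<Sum>k\<in>A. smult (coeff x k) (d (basis k)))"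
    if "finite A" "A \<subseteq> keys x" for A
    using that
  proof (induction A)
    case empty
    show ?case by (simp add: 0 d0)
  next
    case (insert k A)
    have "basis k \<in> free_sum r"
      using insert.prems x by (auto simp: in_free_sum_iff coeff_basis in_keys_iff)
    then have k: "smult (coeff x k) (basis k) \<in> free_sum r"
      "d (smult (coeff x k) (basis k)) = smult (coeff x k) (d (basis k))"
      by (rule sub(2), rule sc)
    have A: "(\<Sum>k\<in>A. smult (coeff x k) (basis k)) \<in> free_sum r"
      "d (\<Sum>k\<in>A. smult (coeff x k) (basis k)) = (\<Sum>k\<in>A. smult (coeff x k) (d (basis k)))"
      using insert by auto
    show ?case
      unfolding sum.insert[OF insert.hyps] using sub(1)[OF k(1) A(1)] add[OF k(1) A(1)] k A by simp
  qed
  from this[of "keys x"] show ?thesis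
    by (simp add: lin_ext_def flip: felem_expand)
qed

lemma free_resolution_cong:
  assumes "\<And>x. x \<in> free_sum r \<Longrightarrow> d x = d' x" and "free_resolution J r d"
  shows "free_resolution J r d'"
proof -
  have part: "x \<in> free_part r i \<Longrightarrow> d x = d' x" for x i
    using assms(1) free_part_subset_sum by blast
  have im: "d ` free_part r i = d' ` free_part r i" for i
    using part by (intro image_cong) auto
  have "linear_over (free_sum r) d'"
    unfolding linear_over_def
  proof (intro conjI ballI allI)
    note sub = felem.subspace_add[OF subspace_free_sum] felem.subspace_scale[OF subspace_free_sum]
    have d: "linear_over (free_sum r) d"
      using assms(2) by (simp add: free_resolution_def)
    show "d' (x + y) = d' x + d' y" if "x \<in> free_sum r" "y \<in> free_sum r" for x y
      using d that by (simp add: linear_over_def sub flip: assms(1))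
    show "d' (smult c x) = smult c (d' x)" if "x \<in> free_sum r" for c x
      using d that by (simp add: linear_over_def sub flip: assms(1))
  qed
  moreover have "{x \<in> free_part r (Suc i). d x = 0} = {x \<in> free_part r (Suc i). d' x = 0}" for i
    using part by auto
  moreover have "\<forall>x\<in>free_part r 0. d' x = 0"
    using part assms(2) by (simp add: free_resolution_def)
  ultimately show ?thesis
    using assms(2) unfolding free_resolution_def im by simp
qed

lemma minimal_free_resolution_cong:
  assumes "\<And>x. x \<in> free_sum r \<Longrightarrow> d x = d' x" and "minimal_free_resolution M J r d"
  shows "minimal_free_resolution M J r d'"
proof -
  have "d ` free_part r i = d' ` free_part r i" for i
    using assms(1) free_part_subset_sum by (intro image_cong) auto
  then show ?thesis
    using assms free_resolution_cong[OF assms(1)] by (simp add: minimal_free_resolution_def)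
qed

lemma dga_structure_cong:
  assumes eq: "\<And>x. x \<in> free_sum r \<Longrightarrow> d x = d' x" and dga: "dga_structure r d m"
  shows "dga_structure r d' m"
proof -
  have part: "x \<in> free_part r i \<Longrightarrow> d' x = d x" for x i
    using eq free_part_subset_sum by (metis subsetD)
  have leib: "d' (m x y) = m (d' x) y + smult ((-1) ^ i) (m x (d' y))"
    if "x \<in> free_part r i" "y \<in> free_part r j" for x y i j
  proof -
    have "\<forall>i j. \<forall>x\<in>free_part r i. \<forall>y\<in>free_part r j. m x y \<in> free_part r (i + j)"
      using dga unfolding dga_structure_def by (elim conjE)
    moreover have "\<forall>i j. \<forall>x\<in>free_part r i. \<forall>y\<in>free_part r j.
        d (m x y) = m (d x) y + smult ((-1) ^ i) (m x (d y))"
      using dga unfolding dga_structure_def by (elim conjE)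
    ultimately have "m x y \<in> free_part r (i + j)" "d (m x y) = m (d x) y + smult ((-1) ^ i) (m x (d y))"
      using that by blast+
    then show ?thesis
      by (simp only: part[OF that(1)] part[OF that(2)] part)
  qed
  then have leib': "\<forall>i j. \<forall>x\<in>free_part r i. \<forall>y\<in>free_part r j.
      d' (m x y) = m (d' x) y + smult ((-1) ^ i) (m x (d' y))"
    by blast
  show ?thesis
    using dga leib' unfolding dga_structure_def by (elim conjE) (intro conjI; assumption)
qed

lemma minimal_free_resolution_lin_ext:
  assumes "minimal_free_resolution M J r d"
  obtains D where "linear_map D" "\<And>x. x \<in> free_sum r \<Longrightarrow> D x = d x" "minimal_free_resolution M J r D"
proof -
  have lo: "linear_over (free_sum r) d"
    using assms by (simp add: minimal_free_resolution_def free_resolution_def)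
  note eq = linear_over_eq_lin_ext[OF lo]
  show thesis
    using that[OF linear_lin_ext eq[symmetric] minimal_free_resolution_cong[OF eq assms]] by blast
qed

lemma graded_linear_representative:
  assumes "graded_minimal_free_resolution C M J r \<delta> d"
  obtains D where "linear_map D" "\<And>x. x \<in> free_sum r \<Longrightarrow> D x = d x"
    "graded_minimal_free_resolution C M J r \<delta> D"
proof -
  have "minimal_free_resolution M J r d"
    using assms by (simp add: graded_minimal_free_resolution_def)
  then obtain D where D: "linear_map D" "\<And>x. x \<in> free_sum r \<Longrightarrow> D x = d x" "minimal_free_resolution M J r D"
    using minimal_free_resolution_lin_ext by blast
  have "D ` graded_piece C r \<delta> g = d ` graded_piece C r \<delta> g" for g
    using D(2) by (intro image_cong) (auto simp: graded_piece_def)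
  then have "graded_minimal_free_resolution C M J r \<delta> D"
    using assms D(3) by (simp add: graded_minimal_free_resolution_def)
  with D(1,2) show thesis by (rule that)
qed

section \<open>Finitely generated submodules\<close>

lemma is_ideal_coeff_image:
  assumes "felem.subspace N"
  shows "is_ideal ((\<lambda>x. coeff x k) ` N)"
proof (rule is_idealI)
  show "0 \<in> (\<lambda>x. coeff x k) ` N"
    using felem.subspace_0[OF assms] by (metis image_eqI lookup_zero)
  show "a + b \<in> (\<lambda>x. coeff x k) ` N"
    if "a \<in> (\<lambda>x. coeff x k) ` N" "b \<in> (\<lambda>x. coeff x k) ` N" for a b
    using that felem.subspace_add[OF assms] by (auto simp flip: lookup_add)
  show "c * a \<in> (\<lambda>x. coeff x k) ` N" if "a \<in> (\<lambda>x. coeff x k) ` N" for c a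
    using that felem.subspace_scale[OF assms] by (auto simp flip: lookup_smult)
qed

text \<open>Induction on the rank: the last coordinates of the elements of \<open>N\<close> form an ideal; lifts of its
  generators, together with generators of the submodule where the last coordinate vanishes,
  generate \<open>N\<close>.\<close>

lemma noetherian_submodule_fg:
  fixes N :: "'a::comm_ring_1 felem set"
  assumes noeth: "noetherian TYPE('a)" and N: "felem.subspace N" "N \<subseteq> free_part (\<lambda>_. a) n"
  shows "\<exists>B. finite B \<and> B \<subseteq> N \<and> felem.span B = N"
  using N
proof (induction a arbitrary: N)
  case 0
  have "x = 0" if "x \<in> N" for x
    by (rule poly_mapping_eqI) (use 0(2) that in \<open>auto simp: in_free_part_iff\<close>)
  then have "N = {0}"
    using felem.subspace_0[OF 0(1)] by blast
  then show ?case
    by (intro exI[of _ "{}"]) auto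
next
  case (Suc a)
  define I where "I = (\<lambda>x. coeff x (n, a)) ` N"
  have "is_ideal I"
    unfolding I_def by (rule is_ideal_coeff_image[OF Suc.prems(1)])
  then obtain B where B: "finite B" "I = ideal_gen B"
    using noeth by (auto simp: noetherian_def)
  have "B \<subseteq> I"
    using module.span_superset[OF module_mult] by (auto simp: B(2) ideal_gen_def)
  then have "\<forall>b\<in>B. \<exists>x\<in>N. coeff x (n, a) = b"
    by (auto simp: I_def)
  then obtain y where y: "\<And>b. b \<in> B \<Longrightarrow> y b \<in> N \<and> coeff (y b) (n, a) = b"
    by metis
  have "felem.subspace (N \<inter> free_part (\<lambda>_. a) n)"
    by (intro felem.subspace_inter Suc.prems subspace_free_part)
  from Suc.IH[OF this] obtain B' where B': "finite B'" "B' \<subseteq> N \<inter> free_part (\<lambda>_. a) n"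
    "felem.span B' = N \<inter> free_part (\<lambda>_. a) n"
    by auto
  define S where "S = felem.span (y ` B)"
  have S: "felem.subspace S"
    by (simp add: S_def)
  have "is_ideal ((\<lambda>z. coeff z (n, a)) ` S)"
    by (rule is_ideal_coeff_image[OF S])
  moreover have "b \<in> (\<lambda>z. coeff z (n, a)) ` S" if "b \<in> B" for b
    unfolding S_def
  proof (rule image_eqI)
    show "b = coeff (y b) (n, a)" using y[OF that] by simp
    show "y b \<in> felem.span (y ` B)" using that by (intro felem.span_base) simp
  qed
  ultimately have I_S: "I \<subseteq> (\<lambda>z. coeff z (n, a)) ` S"
    unfolding B(2) ideal_gen_def is_ideal_def by (intro module.span_minimal[OF module_mult]) auto
  have S_N: "S \<subseteq> N"
    unfolding S_def using y by (intro felem.span_minimal Suc.prems) auto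
  have "N \<subseteq> felem.span (y ` B \<union> B')"
  proof
    fix x assume x: "x \<in> N"
    then obtain z where z: "z \<in> S" "coeff x (n, a) = coeff z (n, a)"
      using I_S by (auto simp: I_def)
    have xz: "x - z \<in> N"
      using x z S_N felem.subspace_diff[OF Suc.prems(1)] by blast
    have "x - z \<in> free_part (\<lambda>_. a) n"
      unfolding in_free_part_iff
    proof (intro allI impI)
      fix k :: "nat \<times> nat" assume k: "\<not> (fst k = n \<and> snd k < a)"
      show "coeff (x - z) k = 0"
      proof (cases "k = (n, a)")
        case True
        then show ?thesis using z by (simp add: lookup_minus)
      next
        case False
        then have "\<not> (fst k = n \<and> snd k < Suc a)"
          using k by (cases k) auto
        then show ?thesis
          using subsetD[OF Suc.prems(2) xz] unfolding in_free_part_iff by blast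
      qed
    qed
    then have "x - z \<in> felem.span B'"
      using xz B'(3) by blast
    then have "x - z \<in> felem.span (y ` B \<union> B')" "z \<in> felem.span (y ` B \<union> B')"
      using z(1) felem.span_mono[of B' "y ` B \<union> B'"] felem.span_mono[of "y ` B" "y ` B \<union> B'"]
      by (auto simp: S_def)
    then have "(x - z) + z \<in> felem.span (y ` B \<union> B')"
      by (rule felem.span_add)
    then show "x \<in> felem.span (y ` B \<union> B')"
      by simp
  qed
  moreover have sub: "y ` B \<union> B' \<subseteq> N"
    using y B'(2) by auto
  ultimately have "felem.span (y ` B \<union> B') = N"
    using felem.span_minimal[OF sub Suc.prems(1)] by blast
  then show ?case
    using B(1) B'(1) sub by (intro exI[of _ "y ` B \<union> B'"]) auto
qed

lemma image_lin_ext_free_part: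
  "lin_ext g ` free_part r i = felem.span ((\<lambda>j. g (i, j)) ` {..<r i})"
proof
  show "lin_ext g ` free_part r i \<subseteq> felem.span ((\<lambda>j. g (i, j)) ` {..<r i})"
  proof
    fix y assume "y \<in> lin_ext g ` free_part r i"
    then obtain x where x: "x \<in> free_part r i" "y = lin_ext g x" by blast
    show "y \<in> felem.span ((\<lambda>j. g (i, j)) ` {..<r i})"
      unfolding x(2)
      by (rule linear_free_part_into[OF linear_lin_ext _ _ x(1)]) (auto intro: felem.span_base)
  qed
  show "felem.span ((\<lambda>j. g (i, j)) ` {..<r i}) \<subseteq> lin_ext g ` free_part r i"
  proof (rule felem.span_minimal)
    show "felem.subspace (lin_ext g ` free_part r i)"
      by (rule module_hom.subspace_image[OF linear_lin_ext subspace_free_part])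
    show "(\<lambda>j. g (i, j)) ` {..<r i} \<subseteq> lin_ext g ` free_part r i"
      by (auto intro!: image_eqI[of _ _ "basis (i, _)"] simp: basis_in_free_part)
  qed
qed

section \<open>Gradings\<close>

text \<open>The map \<open>proj g\<close> sends an element to its component of degree \<open>g\<close>; its properties express that
  the ring is the direct sum of the \<open>C g\<close>.\<close>

locale grading =
  fixes C :: "'g::ab_group_add \<Rightarrow> 'a::comm_ring_1 set" and proj :: "'g \<Rightarrow> 'a \<Rightarrow> 'a"
  assumes C_add: "a \<in> C g \<Longrightarrow> b \<in> C g \<Longrightarrow> a + b \<in> C g"
    and C_mult: "a \<in> C g \<Longrightarrow> b \<in> C h \<Longrightarrow> a * b \<in> C (g + h)"
    and C_one: "1 \<in> C 0"
    and proj_add: "proj g (a + b) = proj g a + proj g b"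
    and proj_in: "proj g a \<in> C g"
    and proj_same: "a \<in> C g \<Longrightarrow> proj g a = a"
    and proj_other: "a \<in> C g \<Longrightarrow> h \<noteq> g \<Longrightarrow> proj h a = 0"
    and finite_proj: "finite {g. proj g a \<noteq> 0}"
    and sum_proj: "(\<Sum>g | proj g a \<noteq> 0. proj g a) = a"
begin

lemma proj_zero [simp]: "proj g 0 = 0"
  using proj_add[of g 0 0] by simp

lemma C_zero [simp]: "0 \<in> C g"
  using proj_in[of g 0] by simp

lemma C_sum: "(\<And>x. x \<in> A \<Longrightarrow> f x \<in> C g) \<Longrightarrow> sum f A \<in> C g"
  by (induction A rule: infinite_finite_induct) (auto intro: C_add)

lemma C_neg: "a \<in> C g \<Longrightarrow> - a \<in> C g"
proof -
  assume a: "a \<in> C g"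
  have "proj h (-a) = 0" if "h \<noteq> g" for h
    using proj_add[of h a "-a"] proj_other[OF a that] by simp
  then have "{h. proj h (-a) \<noteq> 0} \<subseteq> {g}"
    by auto
  then have "(\<Sum>h | proj h (-a) \<noteq> 0. proj h (-a)) = (\<Sum>h\<in>{g}. proj h (-a))"
    by (intro sum.mono_neutral_left) auto
  then have "-a = proj g (-a)"
    using sum_proj[of "-a"] by simp
  then show "-a \<in> C g"
    using proj_in by metis
qed

text \<open>Like \<^const>\<open>graded_piece\<close>, but without a restriction to the free modules of a given resolution.\<close>

definition homog :: "(nat \<times> nat \<Rightarrow> 'g) \<Rightarrow> 'g \<Rightarrow> 'a felem set" where
  "homog \<delta> g = {x. \<forall>k. coeff x k \<in> C (g - \<delta> k)}"

definition component :: "(nat \<times> nat \<Rightarrow> 'g) \<Rightarrow> 'g \<Rightarrow> 'a felem \<Rightarrow> 'a felem" where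
  "component \<delta> g x = Poly_Mapping.mapp (\<lambda>k. proj (g - \<delta> k)) x"

lemma homogD: "x \<in> homog \<delta> g \<Longrightarrow> coeff x k \<in> C (g - \<delta> k)"
  by (simp only: homog_def mem_Collect_eq)

lemma graded_piece_eq: "graded_piece C r \<delta> g = free_sum r \<inter> homog \<delta> g"
  by (auto simp: graded_piece_def homog_def)

lemma coeff_component [simp]: "coeff (component \<delta> g x) k = proj (g - \<delta> k) (coeff x k)"
  by (auto simp: component_def lookup_mapp when_def in_keys_iff)

lemma component_add: "component \<delta> g (x + y) = component \<delta> g x + component \<delta> g y"
  by (rule poly_mapping_eqI) (simp add: lookup_add proj_add)

lemma component_zero [simp]: "component \<delta> g 0 = 0"
  by (rule poly_mapping_eqI) simp

lemma component_sum: "component \<delta> g (sum f A) = (\<Sum>a\<in>A. component \<delta> g (f a))"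
  by (induction A rule: infinite_finite_induct) (auto simp: component_add)

lemma component_homog: "component \<delta> g x \<in> homog \<delta> g"
  by (simp add: homog_def proj_in)

lemma component_same: "x \<in> homog \<delta> g \<Longrightarrow> component \<delta> g x = x"
  by (rule poly_mapping_eqI) (simp add: homogD proj_same)

lemma component_other: "x \<in> homog \<delta> g \<Longrightarrow> h \<noteq> g \<Longrightarrow> component \<delta> h x = 0"
  by (rule poly_mapping_eqI) (simp add: proj_other[OF homogD])

lemma component_free_part: "x \<in> free_part r i \<Longrightarrow> component \<delta> g x \<in> free_part r i"
  by (simp add: in_free_part_iff)

lemma homogI: "(\<And>k. coeff x k \<in> C (g - \<delta> k)) \<Longrightarrow> x \<in> homog \<delta> g"
  by (simp add: homog_def)

lemma homog_zero [simp]: "0 \<in> homog \<delta> g"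
  by (simp add: homog_def)

lemma homog_add: "x \<in> homog \<delta> g \<Longrightarrow> y \<in> homog \<delta> g \<Longrightarrow> x + y \<in> homog \<delta> g"
  by (rule homogI) (simp only: lookup_add C_add homogD)

lemma homog_smult:
  assumes "a \<in> C g" "x \<in> homog \<delta> h"
  shows "smult a x \<in> homog \<delta> (g + h)"
proof (rule homogI)
  fix k
  have "a * coeff x k \<in> C (g + (h - \<delta> k))"
    by (intro C_mult assms homogD)
  then show "coeff (smult a x) k \<in> C (g + h - \<delta> k)"
    by (simp add: algebra_simps)
qed

lemma homog_neg: "x \<in> homog \<delta> g \<Longrightarrow> - x \<in> homog \<delta> g"
  by (rule homogI) (simp only: lookup_uminus C_neg homogD)

lemma basis_homog: "basis k \<in> homog \<delta> (\<delta> k)"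
  using C_one by (auto simp: homog_def coeff_basis)

lemma of_ring_homog: "a \<in> C g \<Longrightarrow> \<delta> (0, 0) = 0 \<Longrightarrow> of_ring a \<in> homog \<delta> g"
  using homog_smult[of a g "basis (0, 0)" \<delta> 0] basis_homog[of "(0, 0)" \<delta>]
  by (simp add: of_ring_eq_smult)

lemma component_decompose: "\<exists>G. finite G \<and> x = (\<Sum>g\<in>G. component \<delta> g x)"
proof -
  define G where "G = (\<Union>k\<in>keys x. (\<lambda>h. h + \<delta> k) ` {h. proj h (coeff x k) \<noteq> 0})"
  have fin: "finite G"
    by (auto simp: G_def finite_proj)
  have "coeff x k = (\<Sum>g\<in>G. proj (g - \<delta> k) (coeff x k))" for k
  proof (cases "coeff x k = 0")
    case False
    then have k: "k \<in> keys x"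
      by (simp add: in_keys_iff)
    have "coeff x k = (\<Sum>h | proj h (coeff x k) \<noteq> 0. proj h (coeff x k))"
      by (rule sum_proj[symmetric])
    also have "\<dots> = (\<Sum>g\<in>(\<lambda>h. h + \<delta> k) ` {h. proj h (coeff x k) \<noteq> 0}. proj (g - \<delta> k) (coeff x k))"
      by (subst sum.reindex) (auto simp: inj_on_def)
    also have "\<dots> = (\<Sum>g\<in>G. proj (g - \<delta> k) (coeff x k))"
    proof (rule sum.mono_neutral_left[OF fin])
      show "(\<lambda>h. h + \<delta> k) ` {h. proj h (coeff x k) \<noteq> 0} \<subseteq> G"
        using k by (auto simp: G_def)
      show "\<forall>g\<in>G - (\<lambda>h. h + \<delta> k) ` {h. proj h (coeff x k) \<noteq> 0}. proj (g - \<delta> k) (coeff x k) = 0"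
      proof (rule ballI, rule ccontr)
        fix g assume g: "g \<in> G - (\<lambda>h. h + \<delta> k) ` {h. proj h (coeff x k) \<noteq> 0}"
          "proj (g - \<delta> k) (coeff x k) \<noteq> 0"
        have "g = (g - \<delta> k) + \<delta> k" by simp
        then show False using g by blast
      qed
    qed
    finally show ?thesis .
  qed simp
  then have "x = (\<Sum>g\<in>G. component \<delta> g x)"
    by (intro poly_mapping_eqI) (simp add: lookup_sum)
  with fin show ?thesis by blast
qed

lemma linear_homog:
  assumes f: "linear_map f" and basis: "\<And>k. k \<in> keys x \<Longrightarrow> f (basis k) \<in> homog \<delta>' (\<delta> k + h)"
    and x: "x \<in> homog \<delta> g"
  shows "f x \<in> homog \<delta>' (g + h)"
proof (rule homogI)
  fix l
  have "coeff x k * coeff (f (basis k)) l \<in> C (g + h - \<delta>' l)" if "k \<in> keys x" for k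
  proof -
    have "coeff x k * coeff (f (basis k)) l \<in> C ((g - \<delta> k) + (\<delta> k + h - \<delta>' l))"
      by (intro C_mult homogD x basis that)
    then show ?thesis
      by (simp add: algebra_simps)
  qed
  then show "coeff (f x) l \<in> C (g + h - \<delta>' l)"
    by (subst linear_expand[OF f]) (auto simp: lookup_sum intro: C_sum)
qed

text \<open>Splitting \<open>x\<close> into components and applying \<open>f\<close> gives homogeneous elements of the same degrees, so
  these are the components of \<open>f x\<close>.\<close>

lemma component_commute:
  assumes f: "linear_map f" and basis: "\<And>k. k \<in> keys x \<Longrightarrow> f (basis k) \<in> homog \<delta>' (\<delta> k)"
  shows "f (component \<delta> g x) = component \<delta>' g (f x)"
proof -
  obtain G where G: "finite G" "x = (\<Sum>g\<in>G. component \<delta> g x)"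
    using component_decompose by blast
  have keys: "keys (component \<delta> h x) \<subseteq> keys x" for h
    by (auto simp: in_keys_iff)
  have fh: "f (component \<delta> h x) \<in> homog \<delta>' h" for h
    using linear_homog[OF f, where h = 0, of "component \<delta> h x" \<delta>' \<delta> h] basis keys component_homog
    by (auto simp: subset_iff)
  have "component \<delta>' g (f x) = component \<delta>' g (\<Sum>h\<in>G. f (component \<delta> h x))"
    using G(2) by (metis linear_sum[OF f])
  also have "\<dots> = (\<Sum>h\<in>G. if h = g then f (component \<delta> h x) else 0)"
    unfolding component_sum
  proof (rule sum.cong[OF refl])
    fix h assume "h \<in> G"
    show "component \<delta>' g (f (component \<delta> h x)) = (if h = g then f (component \<delta> h x) else 0)"
      using component_same[OF fh[of h]] component_other[OF fh[of h], of g] by auto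
  qed
  also have "\<dots> = (if g \<in> G then f (component \<delta> g x) else 0)"
    using G(1) by simp
  also have "\<dots> = f (component \<delta> g x)"
  proof (cases "g \<in> G")
    case False
    have "component \<delta> g x = (\<Sum>h\<in>G. component \<delta> g (component \<delta> h x))"
      using G(2) by (metis component_sum)
    also have "\<dots> = 0"
      using False by (intro sum.neutral ballI component_other[OF component_homog]) auto
    finally show ?thesis
      using False by (simp add: linear_zero[OF f])
  qed simp
  finally show ?thesis by simp
qed

end

context grading
begin

lemma proj_sum: "proj g (sum f A) = (\<Sum>a\<in>A. proj g (f a))"
  by (induction A rule: infinite_finite_induct) (auto simp: proj_add)

lemma proj_times_homogeneous:
  assumes p: "p \<in> C h"
  shows "proj g (c * p) = proj (g - h) c * p"
proof -
  let ?K = "{k. proj k c \<noteq> 0}"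
  have "proj g (c * p) = proj g (\<Sum>k\<in>?K. proj k c * p)"
    by (simp add: sum_proj flip: sum_distrib_right)
  also have "\<dots> = (\<Sum>k\<in>?K. if k = g - h then proj k c * p else 0)"
    unfolding proj_sum
  proof (rule sum.cong[OF refl])
    fix k
    have "proj k c * p \<in> C (k + h)"
      by (intro C_mult proj_in p)
    then show "proj g (proj k c * p) = (if k = g - h then proj k c * p else 0)"
      using proj_same[of "proj k c * p" "k + h"] proj_other[of "proj k c * p" "k + h" g]
      by (cases "g = k + h") auto
  qed
  also have "\<dots> = proj (g - h) c * p"
    using finite_proj[of c] by (simp add: sum.delta)
  finally show ?thesis .
qed

lemma homogeneous_ideal_closed:
  assumes G: "\<And>p. p \<in> G \<Longrightarrow> \<exists>h. p \<in> C h" and a: "a \<in> ideal_gen G"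
  shows "proj g a \<in> ideal_gen G"
  using a unfolding ideal_gen_def
proof (induction a rule: module.span_induct_alt[OF module_mult, consumes 1, case_names base step])
  case base
  show ?case by (simp add: module.span_zero[OF module_mult])
next
  case (step c p y)
  obtain h where h: "p \<in> C h"
    using G step(1) by blast
  have "proj (g - h) c * p + proj g y \<in> module.span (*) G"
    by (intro module.span_add[OF module_mult] module.span_scale[OF module_mult]
        module.span_base[OF module_mult] step)
  then show ?case
    by (simp add: proj_add proj_times_homogeneous[OF h])
qed

lemma homogeneous_multiple_closed:
  assumes s: "s \<in> C h" and I: "\<And>a g. a \<in> I \<Longrightarrow> proj g a \<in> I" and a: "a \<in> (*) s ` I"
  shows "proj g a \<in> (*) s ` I"
proof -
  obtain b where b: "b \<in> I" "a = s * b"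
    using a by blast
  have "proj g a = s * proj (g - h) b"
    unfolding b(2) using proj_times_homogeneous[OF s, of g b] by (simp add: mult.commute)
  then show ?thesis
    using I[OF b(1)] by blast
qed

end

context grading
begin

lemma sign_map_homog:
  assumes "x \<in> homog \<delta> g"
  shows "sign_map x \<in> homog \<delta> g"
proof -
  have "sign_map (basis k) \<in> homog \<delta> (\<delta> k + 0)" for k :: "nat \<times> nat"
    using homog_neg[OF basis_homog[of k \<delta>]] basis_homog[of k \<delta>]
    by (cases "even (fst k)") (auto simp: sign_map_def)
  from linear_homog[OF linear_sign_map this assms] show ?thesis by simp
qed

text \<open>The shift by \<open>\<sigma>\<close> accounts for the division of the first differential by an element of degree
  \<open>\<sigma>\<close>, and the homotopy of multiplication by this element makes up for it.\<close>

lemma graded_dga_mult: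
  assumes r: "r 0 = 1" and \<delta>: "\<delta> (0, 0) = 0"
    and \<alpha>: "\<And>x g. x \<in> free_sum r \<Longrightarrow> x \<in> homog \<delta> g \<Longrightarrow> \<alpha> x \<in> C (g - \<sigma>)"
    and H: "\<And>x g. x \<in> free_sum r \<Longrightarrow> x \<in> homog \<delta> g \<Longrightarrow> H x \<in> homog \<delta> (g + \<sigma>)"
      "\<And>x. x \<in> free_sum r \<Longrightarrow> H x \<in> free_sum r"
  shows "graded_mult C r \<delta> (dga_mult \<alpha> H)"
  unfolding graded_mult_def graded_piece_eq
proof (intro allI ballI)
  fix g h x y assume "x \<in> free_sum r \<inter> homog \<delta> g" "y \<in> free_sum r \<inter> homog \<delta> h"
  then have x: "x \<in> free_sum r" "x \<in> homog \<delta> g" and y: "y \<in> free_sum r" "y \<in> homog \<delta> h"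
    by auto
  have x0: "coeff x (0, 0) \<in> C g" and y0: "coeff y (0, 0) \<in> C h"
    using homogD[OF x(2), of "(0, 0)"] homogD[OF y(2), of "(0, 0)"] \<delta> by auto
  have sx: "sign_map x \<in> free_sum r"
  proof (rule linear_in_subspace[OF linear_sign_map subspace_free_sum])
    fix k assume k: "k \<in> keys x"
    obtain i j where "k = (i, j)" "j < r i"
      using keys_free_sum[OF x(1) k] .
    then show "sign_map (basis k) \<in> free_sum r"
      unfolding sign_map_def lin_ext_basis
      by (intro felem.subspace_scale[OF subspace_free_sum]) (simp add: basis_in_free_sum)
  qed
  have one: "of_ring a \<in> free_sum r" for a
    using of_ring_in_free_part[of r, OF r] free_part_subset_sum by blast
  have "dga_mult \<alpha> H x y \<in> free_sum r"
    unfolding dga_mult_def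
    by (intro felem.subspace_add felem.subspace_diff felem.subspace_scale subspace_free_sum x y one H(2) sx)
  moreover have "dga_mult \<alpha> H x y \<in> homog \<delta> (g + h)"
  proof -
    have 1: "smult (coeff x (0, 0)) y \<in> homog \<delta> (g + h)"
      by (rule homog_smult[OF x0 y(2)])
    have 2: "smult (coeff y (0, 0)) x \<in> homog \<delta> (g + h)"
      using homog_smult[OF y0 x(2)] by (simp add: add.commute)
    have 3: "- of_ring (coeff x (0, 0) * coeff y (0, 0)) \<in> homog \<delta> (g + h)"
      by (intro homog_neg of_ring_homog C_mult x0 y0 \<delta>)
    have 4: "smult (\<alpha> x) (H y) \<in> homog \<delta> (g + h)"
      using homog_smult[OF \<alpha>[OF x] H(1)[OF y]] by (simp add: algebra_simps)
    have 5: "smult (\<alpha> y) (H (sign_map x)) \<in> homog \<delta> (g + h)"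
      using homog_smult[OF \<alpha>[OF y] H(1)[OF sx sign_map_homog[OF x(2)]]] by (simp add: algebra_simps)
    show ?thesis
      unfolding dga_mult_def diff_conv_add_uminus by (intro homog_add 1 2 3 4 5)
  qed
  ultimately show "dga_mult \<alpha> H x y \<in> free_sum r \<inter> homog \<delta> (g + h)"
    by simp
qed

lemma graded_basis:
  assumes gr: "graded_minimal_free_resolution C M J r \<delta> d" and j: "j < r i"
  shows "d (basis (i, j)) \<in> homog \<delta> (\<delta> (i, j))"
proof -
  have "basis (i, j) \<in> graded_piece C r \<delta> (\<delta> (i, j))"
    by (simp add: graded_piece_eq basis_in_free_sum j basis_homog)
  then show ?thesis
    using gr unfolding graded_minimal_free_resolution_def graded_piece_eq by blast
qed

end

section \<open>Existence of minimal graded resolutions\<close>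

lemma minimal_coeff_in:
  assumes "minimal_free_resolution M J r d" "is_ideal M" "x \<in> free_part r (Suc i)"
  shows "coeff (d x) k \<in> M"
proof -
  have "felem.span {smult a x |a x. a \<in> M \<and> x \<in> free_part r i} \<subseteq> {y. coeff y k \<in> M}"
  proof (rule felem.span_minimal)
    show "felem.subspace {y. coeff y k \<in> M}"
      by (rule felem.subspaceI) (auto simp: is_idealD[OF assms(2)] lookup_add)
  qed (auto simp: is_idealD[OF assms(2)])
  then show ?thesis
    using assms(1,3) unfolding minimal_free_resolution_def by blast
qed

lemma in_ideal_multiples:
  assumes "x \<in> free_part r i" "\<And>k. coeff x k \<in> M"
  shows "x \<in> felem.span {smult a x |a x. a \<in> M \<and> x \<in> free_part r i}"
proof (subst felem_expand, rule felem.span_sum)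
  fix k assume "k \<in> keys x"
  then obtain j where "k = (i, j)" "j < r i"
    using assms(1) by (auto elim: keys_free_part)
  then have "basis k \<in> free_part r i"
    by (simp add: basis_in_free_part)
  then show "smult (coeff x k) (basis k) \<in> felem.span {smult a x |a x. a \<in> M \<and> x \<in> free_part r i}"
    using assms(2) by (intro felem.span_base) blast
qed

text \<open>A ring that behaves like a local ring with maximal ideal \<open>M\<close> as far as homogeneous elements are
  concerned: a local ring with the trivial grading, or a polynomial ring with the ideal generated
  by the variables.\<close>

locale graded_local = grading C proj
  for C :: "'g::ab_group_add \<Rightarrow> 'a::comm_ring_1 set" and proj :: "'g \<Rightarrow> 'a \<Rightarrow> 'a" +
  fixes M :: "'a set"
  assumes noeth: "noetherian TYPE('a)"
    and M: "is_ideal M"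
    and unit: "a \<in> C g \<Longrightarrow> a \<notin> M \<Longrightarrow> \<exists>b. a * b = 1"
begin

text \<open>Take a homogeneous generating set of least cardinality. In a homogeneous relation no coefficient
  is a unit, since otherwise a generator could be omitted, so all coefficients lie in \<open>M\<close>. An
  arbitrary relation is a sum of homogeneous ones because the relations form a graded submodule.
  This replaces Nakayama's lemma in the construction of minimal resolutions.\<close>

lemma minimal_homogeneous_generators:
  assumes N: "felem.subspace N" "N \<subseteq> free_part (\<lambda>_. a) n"
    and hom: "\<And>x g. x \<in> N \<Longrightarrow> component \<delta> g x \<in> N"
  obtains b v \<gamma> where "\<And>j. j < b \<Longrightarrow> v j \<in> N" "\<And>j. j < b \<Longrightarrow> v j \<in> homog \<delta> (\<gamma> j)"
    "felem.span (v ` {..<b}) = N"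
    "\<And>x k. x \<in> free_part (\<lambda>_. b) m \<Longrightarrow> lin_ext (\<lambda>k. v (snd k)) x = 0 \<Longrightarrow> coeff x k \<in> M"
proof -
  define P where "P B \<longleftrightarrow> finite B \<and> (\<forall>x\<in>B. \<exists>g. x \<in> homog \<delta> g) \<and> felem.span B = N" for B
  obtain B0 where B0: "finite B0" "B0 \<subseteq> N" "felem.span B0 = N"
    using noetherian_submodule_fg[OF noeth N] by blast
  have "\<forall>x. \<exists>G. finite G \<and> x = (\<Sum>g\<in>G. component \<delta> g x)"
    using component_decompose by blast
  then obtain G where G: "\<And>x. finite (G x)" "\<And>x. x = (\<Sum>g\<in>G x. component \<delta> g x)"
    by metis
  define B1 where "B1 = (\<Union>x\<in>B0. (\<lambda>g. component \<delta> g x) ` G x)"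
  have "finite B1" "B1 \<subseteq> N"
    using B0 G(1) hom by (auto simp: B1_def)
  moreover have "\<forall>x\<in>B1. \<exists>g. x \<in> homog \<delta> g"
    using component_homog by (auto simp: B1_def)
  moreover have "N \<subseteq> felem.span B1"
    unfolding B0(3)[symmetric]
  proof (rule felem.span_minimal)
    show "B0 \<subseteq> felem.span B1"
    proof
      fix x assume x: "x \<in> B0"
      have "(\<Sum>g\<in>G x. component \<delta> g x) \<in> felem.span B1"
        using x by (intro felem.span_sum felem.span_base) (auto simp: B1_def)
      then show "x \<in> felem.span B1"
        using G(2) by metis
    qed
  qed simp
  ultimately have "P B1"
    using felem.span_minimal[OF _ N(1), of B1] by (auto simp: P_def)
  then have ex: "\<exists>c B. P B \<and> card B = c"
    by blast
  define c where "c = (LEAST c. \<exists>B. P B \<and> card B = c)"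
  obtain B where B: "P B" "card B = c"
    using LeastI_ex[OF ex] by (auto simp: c_def)
  have least: "c \<le> card B'" if "P B'" for B'
    unfolding c_def using that by (intro Least_le) blast
  have fin: "finite B"
    using B by (simp add: P_def)
  obtain v where v: "bij_betw v {..<c} B"
    using ex_bij_betw_nat_finite[OF fin] B(2) by (auto simp: atLeast0LessThan)
  have vB: "v j \<in> B" if "j < c" for j
    using v that by (auto simp: bij_betw_def)
  have "\<forall>j. \<exists>g. j < c \<longrightarrow> v j \<in> homog \<delta> g"
    using B(1) vB unfolding P_def by blast
  then obtain \<gamma> where \<gamma>: "\<And>j. j < c \<Longrightarrow> v j \<in> homog \<delta> (\<gamma> j)"
    by metis
  define f where "f = lin_ext (\<lambda>k. v (snd k))"
  have f: "linear_map f"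
    by (simp add: f_def linear_lin_ext)
  let ?\<delta> = "\<lambda>k::nat \<times> nat. \<gamma> (snd k)"
  have f_basis: "f (basis k) \<in> homog \<delta> (?\<delta> k)" if x: "k \<in> keys x" "x \<in> free_part (\<lambda>_. c) m" for k x
  proof -
    obtain j where "k = (m, j)" "j < c"
      using keys_free_part[OF x(2,1)] .
    then show ?thesis
      using \<gamma> by (simp add: f_def)
  qed
  have homog_kernel: "coeff y k \<in> M"
    if y: "y \<in> free_part (\<lambda>_. c) m" "y \<in> homog ?\<delta> g" "f y = 0" for y k g
  proof (rule ccontr)
    assume k: "coeff y k \<notin> M"
    then have "k \<in> keys y"
      using is_idealD(1)[OF M] by (auto simp: in_keys_iff)
    then obtain j where j: "k = (m, j)" "j < c"
      using keys_free_part[OF y(1)] by blast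
    obtain b where b: "coeff y k * b = 1"
      using unit[OF homogD[OF y(2)] k] by blast
    have "f y = (\<Sum>l\<in>{m} \<times> {..<c}. smult (coeff y l) (v (snd l)))"
      unfolding f_def by (rule lin_ext_superset) (use y(1) in \<open>auto simp: free_part_def\<close>)
    also have "\<dots> = smult (coeff y k) (v j) + (\<Sum>l\<in>{m} \<times> {..<c} - {k}. smult (coeff y l) (v (snd l)))"
      using j by (subst sum.remove[of _ k]) auto
    finally have "smult (coeff y k) (v j) = - (\<Sum>l\<in>{m} \<times> {..<c} - {k}. smult (coeff y l) (v (snd l)))"
      using y(3) by (simp add: add_eq_0_iff)
    moreover have "(\<Sum>l\<in>{m} \<times> {..<c} - {k}. smult (coeff y l) (v (snd l))) \<in> felem.span (B - {v j})"
    proof (intro felem.span_sum felem.span_scale felem.span_base)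
      fix l assume "l \<in> {m} \<times> {..<c} - {k}"
      then have l: "snd l < c" "snd l \<noteq> j"
        using j by auto
      then have "v (snd l) \<noteq> v j"
        using v j(2) by (auto simp: bij_betw_def inj_on_def)
      then show "v (snd l) \<in> B - {v j}"
        using vB l by simp
    qed
    ultimately have "smult b (smult (coeff y k) (v j)) \<in> felem.span (B - {v j})"
      by (simp add: felem.span_neg felem.span_scale del: felem.scale_scale)
    then have vj: "v j \<in> felem.span (B - {v j})"
      using b by (simp add: mult.commute)
    have "B \<subseteq> felem.span (B - {v j})"
      using vj by (auto intro: felem.span_base)
    then have "felem.span (B - {v j}) = N"
      using B(1) felem.span_mono[of "B - {v j}" B] felem.span_minimal[of B "felem.span (B - {v j})"]
      by (auto simp: P_def)
    then have "P (B - {v j})"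
      using B(1) by (auto simp: P_def)
    then have "c \<le> card (B - {v j})"
      by (rule least)
    moreover have "card (B - {v j}) < card B"
      using fin vB[OF j(2)] by (intro psubset_card_mono) auto
    ultimately show False
      using B(2) by simp
  qed
  show thesis
  proof (rule that[of c v \<gamma>])
    show "v j \<in> N" if "j < c" for j
      using vB[OF that] B(1) felem.span_base by (auto simp: P_def)
    show "felem.span (v ` {..<c}) = N"
      using v B(1) by (auto simp: bij_betw_def P_def)
    show "coeff x k \<in> M" if x: "x \<in> free_part (\<lambda>_. c) m" "lin_ext (\<lambda>k. v (snd k)) x = 0" for x k
    proof -
      have *: "coeff (component ?\<delta> g x) k \<in> M" for g
      proof (rule homog_kernel[of _ g])
        show "component ?\<delta> g x \<in> free_part (\<lambda>_. c) m"
          by (rule component_free_part) (rule x)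
        show "component ?\<delta> g x \<in> homog ?\<delta> g"
          by (rule component_homog)
        have "f (component ?\<delta> g x) = component \<delta> g (f x)"
          by (rule component_commute[OF f]) (rule f_basis[OF _ x(1)])
        then show "f (component ?\<delta> g x) = 0"
          using x(2) by (simp add: f_def)
      qed
      obtain H where H: "finite H" "x = (\<Sum>g\<in>H. component ?\<delta> g x)"
        using component_decompose by blast
      have "coeff x k = (\<Sum>g\<in>H. coeff (component ?\<delta> g x) k)"
        by (subst H(2)) (rule lookup_sum)
      also have "\<dots> \<in> M"
        using * by (intro module.subspace_sum[OF module_mult M[unfolded is_ideal_def]])
      finally show ?thesis .
    qed
  qed (use \<gamma> in auto)
qed

text \<open>Iterate the choice of minimal homogeneous generators for the kernels. The relations between
  minimal generators have coefficients in \<open>M\<close>, which is the minimality of the resolution. The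
  first differential has its values in \<open>M\<close> because a proper homogeneous ideal lies in \<open>M\<close>.\<close>

theorem graded_minimal_free_resolution_exists:
  assumes J: "is_ideal J" "J \<noteq> UNIV" and hom: "\<And>a g. a \<in> J \<Longrightarrow> proj g a \<in> J"
  shows "\<exists>r \<delta> d. graded_minimal_free_resolution C M J r \<delta> d"
proof -
  have J_M: "J \<subseteq> M"
  proof
    fix a assume a: "a \<in> J"
    have "proj g a \<in> M" for g
    proof (rule ccontr)
      assume "proj g a \<notin> M"
      then obtain b where "proj g a * b = 1"
        using unit[OF proj_in] by blast
      then have "1 \<in> J"
        using is_idealD(5)[OF J(1) hom[OF a]] by metis
      then have "c \<in> J" for c
        using is_idealD(4)[OF J(1), of 1 c] by simp
      then show False
        using J(2) by blast
    qed
    then have "(\<Sum>g | proj g a \<noteq> 0. proj g a) \<in> M"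
      by (intro module.subspace_sum[OF module_mult M[unfolded is_ideal_def]])
    then show "a \<in> M"
      by (simp add: sum_proj)
  qed
  \<comment> \<open>The recursion carries the rank and the degrees in one homological degree, those in the next
    one, and the images of the basis elements of the latter.\<close>
  define F where "F b n = (free_part (\<lambda>_. b) n :: 'a felem set)" for b n
  define P where "P n S = (case S of (a, \<delta>, b, \<gamma>, v) \<Rightarrow>
      (\<forall>j<b. v j \<in> F a n \<and> v j \<in> homog (\<lambda>k. \<delta> (snd k)) (\<gamma> j)) \<and>
      (\<forall>x\<in>F b (Suc n). lin_ext (\<lambda>k. v (snd k)) x = 0 \<longrightarrow> (\<forall>k. coeff x k \<in> M)) \<and>
      (n = 0 \<longrightarrow> a = 1 \<and> \<delta> 0 = 0 \<and> felem.span (v ` {..<b}) = of_ring ` J))"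
    for n and S :: "nat \<times> (nat \<Rightarrow> 'g) \<times> nat \<times> (nat \<Rightarrow> 'g) \<times> (nat \<Rightarrow> 'a felem)"
  define Q where "Q n S S' = (case S of (a, \<delta>, b, \<gamma>, v) \<Rightarrow> case S' of (a', \<delta>', b', \<gamma>', v') \<Rightarrow>
      a' = b \<and> \<delta>' = \<gamma> \<and>
      felem.span (v' ` {..<b'}) = {x \<in> F b (Suc n). lin_ext (\<lambda>k. v (snd k)) x = 0})"
    for n and S S' :: "nat \<times> (nat \<Rightarrow> 'g) \<times> nat \<times> (nat \<Rightarrow> 'g) \<times> (nat \<Rightarrow> 'a felem)"
  have "\<exists>S. \<forall>n. P n (S n) \<and> Q n (S n) (S (Suc n))"
  proof (rule dependent_nat_choice)
    have sub: "of_ring ` J \<subseteq> free_part (\<lambda>_. 1) 0"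
      by (auto simp: of_ring_in_free_part)
    have comp: "component (\<lambda>k. 0) g x \<in> of_ring ` J" if x: "x \<in> of_ring ` J" for x g
    proof -
      obtain a where a: "a \<in> J" "x = of_ring a"
        using x by blast
      have "component (\<lambda>k. 0) g x = of_ring (proj g a)"
        by (rule poly_mapping_eqI) (simp add: a(2) of_ring_def lookup_single when_def)
      then show ?thesis
        using hom[OF a(1)] by simp
    qed
    show "\<exists>S. P 0 S"
    proof (rule minimal_homogeneous_generators[OF subspace_of_ring_ideal[OF J(1)] sub comp, where m = "Suc 0"])
      fix b v \<gamma>
      assume "\<And>j. j < b \<Longrightarrow> v j \<in> of_ring ` J" "\<And>j. j < b \<Longrightarrow> v j \<in> homog (\<lambda>k. 0) (\<gamma> j)"
        "felem.span (v ` {..<b}) = of_ring ` J"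
        "\<And>x k. x \<in> free_part (\<lambda>_. b) (Suc 0) \<Longrightarrow> lin_ext (\<lambda>k. v (snd k)) x = 0 \<Longrightarrow> coeff x k \<in> M"
      then have "P 0 (1, \<lambda>_. 0, b, \<gamma>, v)"
        using sub unfolding P_def F_def by (simp add: subset_iff)
      then show "\<exists>S. P 0 S" ..
    qed
  next
    fix S n assume P: "P n S"
    obtain a \<delta> b \<gamma> v where S: "S = (a, \<delta>, b, \<gamma>, v)"
      by (cases S) auto
    let ?f = "lin_ext (\<lambda>k. v (snd k))"
    let ?N = "{x \<in> F b (Suc n). ?f x = 0}"
    have N: "felem.subspace ?N"
    proof -
      have "felem.subspace (F b (Suc n) \<inter> {x. ?f x = 0})"
        unfolding F_def
        by (intro felem.subspace_inter subspace_free_part module_hom.subspace_kernel[OF linear_lin_ext])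
      moreover have "F b (Suc n) \<inter> {x. ?f x = 0} = ?N" by blast
      ultimately show ?thesis by simp
    qed
    have sub: "?N \<subseteq> free_part (\<lambda>_. b) (Suc n)"
      by (auto simp: F_def)
    have comp: "component (\<lambda>k. \<gamma> (snd k)) g x \<in> ?N" if x: "x \<in> ?N" for x g
    proof -
      have xF: "x \<in> free_part (\<lambda>_. b) (Suc n)"
        using sub x by blast
      have "?f (component (\<lambda>k. \<gamma> (snd k)) g x) = component (\<lambda>k. \<delta> (snd k)) g (?f x)"
      proof (rule component_commute[OF linear_lin_ext])
        fix k assume "k \<in> keys x"
        then obtain j where "k = (Suc n, j)" "j < b"
          using keys_free_part[OF xF] by blast
        then show "?f (basis k) \<in> homog (\<lambda>k. \<delta> (snd k)) (\<gamma> (snd k))"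
          using P by (simp add: P_def S)
      qed
      then show ?thesis
        using x component_free_part[OF xF] by (simp add: F_def)
    qed
    show "\<exists>S'. P (Suc n) S' \<and> Q n S S'"
    proof (rule minimal_homogeneous_generators[OF N sub comp, where m = "Suc (Suc n)"])
      fix b' v' \<gamma>'
      assume A: "\<And>j. j < b' \<Longrightarrow> v' j \<in> ?N" "\<And>j. j < b' \<Longrightarrow> v' j \<in> homog (\<lambda>k. \<gamma> (snd k)) (\<gamma>' j)"
        "felem.span (v' ` {..<b'}) = ?N"
        "\<And>x k. x \<in> free_part (\<lambda>_. b') (Suc (Suc n)) \<Longrightarrow> lin_ext (\<lambda>k. v' (snd k)) x = 0 \<Longrightarrow> coeff x k \<in> M"
      have "P (Suc n) (b, \<gamma>, b', \<gamma>', v')"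
        unfolding P_def using A(1,2,4) by (simp add: F_def)
      moreover have "Q n S (b, \<gamma>, b', \<gamma>', v')"
        unfolding Q_def S using A(3) by simp
      ultimately show "\<exists>S'. P (Suc n) S' \<and> Q n S S'"
        by blast
    qed
  qed
  then obtain S where P: "\<And>n. P n (S n)" and Q: "\<And>n. Q n (S n) (S (Suc n))"
    by blast
  define r where "r n = fst (S n)" for n
  define \<delta> where "\<delta> k = fst (snd (S (fst k))) (snd k)" for k :: "nat \<times> nat"
  define v where "v n = snd (snd (snd (snd (S n))))" for n
  have S: "S n = (r n, \<lambda>j. \<delta> (n, j), r (Suc n), \<lambda>j. \<delta> (Suc n, j), v n)" for n
    using Q[of n] by (cases "S n"; cases "S (Suc n)") (auto simp: Q_def r_def \<delta>_def v_def)
  define d where "d = lin_ext (\<lambda>k. if fst k = 0 then 0 else v (fst k - 1) (snd k))"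
  have lin: "linear_map d"
    by (simp add: d_def linear_lin_ext)
  have F: "F (r n) m = free_part r m" if "n = m" for n m
    using that by (auto simp: F_def in_free_part_iff)
  have P': "v n j \<in> free_part r n" "v n j \<in> homog \<delta> (\<delta> (Suc n, j))" if "j < r (Suc n)" for n j
  proof -
    have vn: "v n j \<in> F (r n) n" "v n j \<in> homog (\<lambda>k. \<delta> (n, snd k)) (\<delta> (Suc n, j))"
      using P[of n] that by (auto simp: P_def S)
    then show "v n j \<in> free_part r n"
      by (simp add: F)
    show "v n j \<in> homog \<delta> (\<delta> (Suc n, j))"
    proof (rule homogI)
      fix k
      show "coeff (v n j) k \<in> C (\<delta> (Suc n, j) - \<delta> k)"
      proof (cases "fst k = n")
        case True
        then show ?thesis using homogD[OF vn(2), of k] by auto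
      next
        case False
        then show ?thesis
          using \<open>v n j \<in> free_part r n\<close> by (simp add: coeff_free_part_other)
      qed
    qed
  qed
  have minimal: "coeff x k \<in> M" if "x \<in> free_part r (Suc n)" "d x = 0" for x n k
  proof -
    have "lin_ext (\<lambda>k. v n (snd k)) x = d x"
      by (rule linear_eq_on_free_part[OF linear_lin_ext lin _ that(1)]) (simp add: d_def)
    then show ?thesis
      using P[of n] that by (cases k) (simp add: P_def S F)
  qed
  have d_part: "d x \<in> free_part r n" if "x \<in> free_part r (Suc n)" for x n
    by (rule linear_free_part_into[OF lin _ subspace_free_part that]) (simp add: d_def P')
  have im: "d ` free_part r (Suc n) = felem.span (v n ` {..<r (Suc n)})" for n
    unfolding d_def by (simp add: image_lin_ext_free_part)
  have exact: "{x \<in> free_part r (Suc n). d x = 0} = d ` free_part r (Suc (Suc n))" for n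
  proof -
    have "{x \<in> free_part r (Suc n). d x = 0} = {x \<in> free_part r (Suc n). lin_ext (\<lambda>k. v n (snd k)) x = 0}"
    proof -
      have "lin_ext (\<lambda>k. v n (snd k)) x = d x" if "x \<in> free_part r (Suc n)" for x
        by (rule linear_eq_on_free_part[OF linear_lin_ext lin _ that]) (simp add: d_def)
      then show ?thesis by auto
    qed
    also have "\<dots> = felem.span (v (Suc n) ` {..<r (Suc (Suc n))})"
      using Q[of n] by (simp add: Q_def S F)
    finally show ?thesis
      by (simp add: im)
  qed
  have base: "r 0 = 1" "\<delta> (0, 0) = 0" "d ` free_part r 1 = of_ring ` J"
    using P[of 0] im[of 0] by (auto simp: P_def S)
  have zero: "d x = 0" if "x \<in> free_part r 0" for x
    by (rule linear_eq_on_free_part[OF lin linear_0 _ that]) (simp add: d_def)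
  have res: "free_resolution J r d"
    unfolding free_resolution_def
    using base zero exact d_part linear_over_linear_map[OF lin] by (simp add: image_subset_iff)
  have "coeff (d x) k \<in> M" if x: "x \<in> free_part r (Suc i)" for x i k
  proof (cases i)
    case 0
    then have "d x \<in> of_ring ` J"
      using base(3) x by auto
    then show ?thesis
      using J_M is_idealD(1)[OF M] by (cases "k = (0,0)") (auto simp: of_ring_def lookup_single)
  next
    case (Suc n)
    have "d x \<in> d ` free_part r (Suc (Suc n))"
      using x Suc by simp
    then show ?thesis
      using exact[of n] minimal[of "d x" n k] by blast
  qed
  then have "minimal_free_resolution M J r d"
    unfolding minimal_free_resolution_def image_subset_iff
    by (intro conjI res allI ballI in_ideal_multiples d_part)
  moreover have "d ` graded_piece C r \<delta> g \<subseteq> graded_piece C r \<delta> g" for g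
  proof
    fix y assume "y \<in> d ` graded_piece C r \<delta> g"
    then obtain x where x: "x \<in> free_sum r" "x \<in> homog \<delta> g" "y = d x"
      by (auto simp: graded_piece_eq)
    have b: "d (basis k) \<in> free_sum r \<and> d (basis k) \<in> homog \<delta> (\<delta> k)" if k: "k \<in> keys x" for k
    proof -
      obtain i j where ij: "k = (i, j)" "j < r i"
        using keys_free_sum[OF x(1) k] .
      show ?thesis
      proof (cases i)
        case 0
        then show ?thesis
          using ij by (simp add: d_def felem.subspace_0 subspace_free_sum homog_def)
      next
        case (Suc n)
        then have j: "j < r (Suc n)" and d: "d (basis k) = v n j"
          using ij by (simp_all add: d_def)
        show ?thesis
          unfolding d using P'(2)[OF j] subsetD[OF free_part_subset_sum P'(1)[OF j]]
          by (simp add: ij(1) Suc)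
      qed
    qed
    have "d x \<in> homog \<delta> (g + 0)"
      by (rule linear_homog[OF lin _ x(2)]) (simp add: b)
    moreover have "d x \<in> free_sum r"
      by (rule linear_in_subspace[OF lin subspace_free_sum]) (simp add: b)
    ultimately show "y \<in> graded_piece C r \<delta> g"
      by (simp add: graded_piece_eq x(3))
  qed
  ultimately show ?thesis
    using base(2) unfolding graded_minimal_free_resolution_def by blast
qed

end

context graded_local
begin

lemma graded_mfr_admits_dgaI:
  assumes J: "is_ideal J" "J \<noteq> UNIV" "\<And>a g. a \<in> J \<Longrightarrow> proj g a \<in> J"
    and dga: "\<And>r d. free_resolution J r d \<Longrightarrow> linear_map d \<Longrightarrow> \<exists>m. dga_structure r d m"
  shows "graded_mfr_admits_dga C M J"
proof -
  have "\<exists>m. dga_structure r d m" if gr: "graded_minimal_free_resolution C M J r \<delta> d" for r \<delta> d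
  proof -
    have "minimal_free_resolution M J r d"
      using gr by (simp add: graded_minimal_free_resolution_def)
    then obtain D where D: "linear_map D" "\<And>x. x \<in> free_sum r \<Longrightarrow> D x = d x" "minimal_free_resolution M J r D"
      using minimal_free_resolution_lin_ext by blast
    then obtain m where "dga_structure r D m"
      using dga[of r D] by (auto simp: minimal_free_resolution_def)
    from dga_structure_cong[OF D(2) this] show ?thesis
      by (rule exI[where P = "dga_structure r d"])
  qed
  then show ?thesis
    unfolding graded_mfr_admits_dga_def using graded_minimal_free_resolution_exists[OF J] by blast
qed

end

section \<open>Local rings\<close>

text \<open>Zorn's lemma: a union of a chain of ideals that do not contain 1 is such an ideal.\<close>

lemma proper_ideal_in_maximal:
  fixes I :: "'a::comm_ring_1 set"
  assumes "is_ideal I" "I \<noteq> UNIV"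
  shows "\<exists>M. maximal_ideal M \<and> I \<subseteq> M"
proof -
  let ?A = "{J. is_ideal J \<and> I \<subseteq> J \<and> 1 \<notin> J}"
  have "\<exists>M\<in>?A. \<forall>X\<in>?A. M \<subseteq> X \<longrightarrow> X = M"
  proof (rule subset_Zorn_nonempty)
    have "I \<in> ?A"
      using assms ideal_eq_UNIV_iff by auto
    then show "?A \<noteq> {}"
      by blast
    fix \<C> assume C: "\<C> \<noteq> {}" "subset.chain ?A \<C>"
    have ideal: "is_ideal J" if "J \<in> \<C>" for J
      using C(2) that by (auto simp: subset.chain_def)
    have "is_ideal (\<Union>\<C>)"
    proof (rule is_idealI)
      show "0 \<in> \<Union>\<C>"
        using C(1) ideal is_idealD(1) by fastforce
      show "a + b \<in> \<Union>\<C>" if ab: "a \<in> \<Union>\<C>" "b \<in> \<Union>\<C>" for a b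
      proof -
        obtain X Y where XY: "X \<in> \<C>" "a \<in> X" "Y \<in> \<C>" "b \<in> Y"
          using ab by blast
        then have "X \<subseteq> Y \<or> Y \<subseteq> X"
          using C(2) by (auto simp: subset.chain_def)
        then show ?thesis
          using XY is_idealD(2)[OF ideal] by blast
      qed
      show "c * a \<in> \<Union>\<C>" if "a \<in> \<Union>\<C>" for c a
        using that is_idealD(4)[OF ideal] by blast
    qed
    then show "\<Union>\<C> \<in> ?A"
      using C unfolding subset.chain_def by blast
  qed
  then obtain M where M: "M \<in> ?A" "\<forall>X\<in>?A. M \<subseteq> X \<longrightarrow> X = M"
    by (rule bexE)
  have "J = M" if J: "is_ideal J" "M \<subseteq> J" "J \<noteq> UNIV" for J
  proof -
    have "1 \<notin> J"
      using J(3) ideal_eq_UNIV_iff[OF J(1)] by simp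
    then have "J \<in> ?A"
      using M(1) J(1,2) by auto
    then show ?thesis
      using M(2) J(2) by simp
  qed
  then have "maximal_ideal M"
    unfolding maximal_ideal_def using M(1) by auto
  then show ?thesis
    using M(1) by (intro exI[of _ M]) simp
qed

lemma local_ring_unit:
  fixes a :: "'a::comm_ring_1"
  assumes "\<And>M'. maximal_ideal M' \<Longrightarrow> M' = M" and "a \<notin> M"
  shows "\<exists>b. a * b = 1"
proof (rule ccontr)
  assume no: "\<nexists>b. a * b = 1"
  let ?I = "(*) a ` UNIV"
  have I: "is_ideal ?I"
    by (rule is_ideal_times) (rule is_idealI, auto)
  have "1 \<notin> ?I"
    using no by (metis imageE)
  then obtain M' where "maximal_ideal M'" "?I \<subseteq> M'"
    using proper_ideal_in_maximal[OF I] ideal_eq_UNIV_iff[OF I] by blast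
  moreover have "a \<in> ?I"
    by (metis mult.right_neutral rangeI)
  ultimately show False
    using assms by blast
qed

text \<open>Local rings fit into the graded setting with everything in degree 0; the group \<open>int\<close> is an
  arbitrary choice.\<close>

lemma trivial_grading:
  "grading (\<lambda>g::int. if g = 0 then UNIV else {0 :: 'a::comm_ring_1}) (\<lambda>g a. if g = 0 then a else 0)"
proof
  fix a :: 'a
  show "finite {g::int. (if g = 0 then a else 0) \<noteq> 0}"
    by (rule finite_subset[of _ "{0}"]) auto
  have "(\<Sum>g::int | (if g = 0 then a else 0) \<noteq> 0. if g = 0 then a else 0) = (\<Sum>g::int\<in>{0}. if g = 0 then a else 0)"
    by (rule sum.mono_neutral_left) auto
  then show "(\<Sum>g::int | (if g = 0 then a else 0) \<noteq> 0. if g = 0 then a else 0) = a"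
    by simp
qed (auto split: if_splits)

lemma local_mfr_admits_dga:
  fixes M :: "'a::comm_ring_1 set"
  assumes reg: "regular_local_ring M" and J: "is_ideal J" "J \<noteq> UNIV"
    and dga: "\<And>r d. free_resolution J r d \<Longrightarrow> linear_map d \<Longrightarrow> \<exists>m. dga_structure r d m"
  shows "mfr_admits_dga M J"
proof -
  interpret grading "\<lambda>g::int. if g = 0 then UNIV else {0 :: 'a}" "\<lambda>g a. if g = 0 then a else 0"
    by (rule trivial_grading)
  interpret graded_local "\<lambda>g::int. if g = 0 then UNIV else {0 :: 'a}" "\<lambda>g a. if g = 0 then a else 0" M
  proof
    show "noetherian TYPE('a)"
      using reg by (simp add: regular_local_ring_def)
    show M: "is_ideal M"
      using reg by (simp add: regular_local_ring_def maximal_ideal_def)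
    have "\<And>M'. maximal_ideal M' \<Longrightarrow> M' = M"
      using reg by (simp add: regular_local_ring_def)
    then show "\<exists>b. a * b = 1" if "a \<notin> M" for a
      using local_ring_unit that by blast
  qed
  have "\<exists>r \<delta> d. graded_minimal_free_resolution (\<lambda>g::int. if g = 0 then UNIV else {0 :: 'a}) M J r \<delta> d"
    using is_idealD(1)[OF J(1)] by (intro graded_minimal_free_resolution_exists J) auto
  then have "\<exists>r d. minimal_free_resolution M J r d"
    unfolding graded_minimal_free_resolution_def by blast
  moreover have "\<exists>m. dga_structure r d m" if min: "minimal_free_resolution M J r d" for r d
  proof -
    obtain D where D: "linear_map D" "\<And>x. x \<in> free_sum r \<Longrightarrow> D x = d x" "minimal_free_resolution M J r D"
      using minimal_free_resolution_lin_ext[OF min] by blast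
    then obtain m where "dga_structure r D m"
      using dga[of r D] by (auto simp: minimal_free_resolution_def)
    from dga_structure_cong[OF D(2) this] show ?thesis
      by (rule exI[where P = "dga_structure r d"])
  qed
  ultimately show ?thesis
    unfolding mfr_admits_dga_def by blast
qed

lemma noetherian_chain_stationary:
  fixes A :: "nat \<Rightarrow> 'a::comm_ring_1 set"
  assumes noeth: "noetherian TYPE('a)" and A: "\<And>n. is_ideal (A n)" "\<And>n. A n \<subseteq> A (Suc n)"
  shows "\<exists>n. \<forall>m\<ge>n. A m = A n"
proof -
  have mono: "A m \<subseteq> A n" if "m \<le> n" for m n
    using that A(2) by (rule lift_Suc_mono_le[rotated])
  have "is_ideal (\<Union>n. A n)"
  proof (rule is_idealI)
    show "0 \<in> (\<Union>n. A n)"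
      using is_idealD(1)[OF A(1)] by blast
    show "a + b \<in> (\<Union>n. A n)" if ab: "a \<in> (\<Union>n. A n)" "b \<in> (\<Union>n. A n)" for a b
    proof -
      obtain m n where "a \<in> A m" "b \<in> A n"
        using ab by blast
      then have "a \<in> A (max m n)" "b \<in> A (max m n)"
        using mono[of m "max m n"] mono[of n "max m n"] by auto
      then show ?thesis
        using is_idealD(2)[OF A(1)] by blast
    qed
    show "c * a \<in> (\<Union>n. A n)" if "a \<in> (\<Union>n. A n)" for c a
      using that is_idealD(4)[OF A(1)] by blast
  qed
  then obtain B where B: "finite B" "(\<Union>n. A n) = ideal_gen B"
    using noeth by (auto simp: noetherian_def)
  have "\<exists>n. B \<subseteq> A n"
  proof -
    have "B \<subseteq> (\<Union>n. A n)"
      using module.span_superset[OF module_mult] by (auto simp: B(2) ideal_gen_def)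
    then have "\<forall>b\<in>B. \<exists>n. b \<in> A n"
      by blast
    then obtain f where f: "\<And>b. b \<in> B \<Longrightarrow> b \<in> A (f b)"
      by metis
    have "b \<in> A (Max (f ` B))" if "b \<in> B" for b
      using f[OF that] mono[of "f b" "Max (f ` B)"] B(1) that by auto
    then show ?thesis by blast
  qed
  then obtain n where "B \<subseteq> A n" ..
  then have "(\<Union>n. A n) \<subseteq> A n"
    unfolding B(2) ideal_gen_def
    by (intro module.span_minimal[OF module_mult]) (use A(1) in \<open>auto simp: is_ideal_def\<close>)
  then show ?thesis
    using mono by (intro exI[of _ n]) blast
qed

text \<open>Treat the generators one at a time: multiply \<open>s\<close> by the highest power of the nilpotent generator
  \<open>b\<close> that does not make it zero. The result is killed by \<open>b\<close> and still by the earlier generators.\<close>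

lemma nil_ideal_annihilated:
  fixes I :: "'a::comm_ring_1 set"
  assumes noeth: "noetherian TYPE('a)" and I: "is_ideal I" and nil: "\<And>a. a \<in> I \<Longrightarrow> \<exists>n. a ^ n = 0"
  shows "\<exists>s. s \<noteq> 0 \<and> (\<forall>a\<in>I. s * a = 0)"
proof -
  obtain B where B: "finite B" "I = ideal_gen B"
    using noeth I by (auto simp: noetherian_def)
  have "B \<subseteq> I"
    using module.span_superset[OF module_mult] by (auto simp: B(2) ideal_gen_def)
  with B(1) have "\<exists>s. s \<noteq> 0 \<and> (\<forall>b\<in>B. s * b = 0)"
  proof (induction B)
    case empty
    show ?case by (intro exI[of _ 1]) auto
  next
    case (insert b B)
    then obtain s where s: "s \<noteq> 0" "\<And>c. c \<in> B \<Longrightarrow> s * c = 0"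
      by auto
    obtain n where n: "b ^ n = 0"
      using nil insert.prems by auto
    define m where "m = (LEAST m. s * b ^ m = 0)"
    have m: "s * b ^ m = 0"
      unfolding m_def by (rule LeastI[of _ n]) (simp add: n)
    then have "m \<noteq> 0"
      using s(1) by (metis mult.right_neutral power_0)
    then obtain k where k: "m = Suc k"
      using not0_implies_Suc by blast
    have "s * b ^ k \<noteq> 0"
      using not_less_Least[of k "\<lambda>m. s * b ^ m = 0"] k by (simp add: m_def)
    moreover have "s * b ^ k * c = 0" if "c \<in> insert b B" for c
    proof (cases "c = b")
      case True
      then show ?thesis using m by (simp add: k ac_simps)
    next
      case False
      then have "s * c = 0" using that s(2) by blast
      then show ?thesis by (metis mult.assoc mult.commute mult_zero_left)
    qed
    ultimately show ?case by blast
  qed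
  then obtain s where s: "s \<noteq> 0" "\<And>b. b \<in> B \<Longrightarrow> s * b = 0"
    by blast
  have "I \<subseteq> {a. s * a = 0}"
    unfolding B(2) ideal_gen_def
  proof (rule module.span_minimal[OF module_mult])
    show "module.subspace (*) {a. s * a = 0}"
      by (fold is_ideal_def, rule is_idealI) (auto simp: distrib_left mult.left_commute)
  qed (use s(2) in blast)
  with s(1) show ?thesis by blast
qed

text \<open>If \<open>a \<in> I\<close> is not nilpotent, the annihilators of its powers become stationary, so some power \<open>t\<close>
  satisfies: \<open>t\<^sup>m x = 0\<close> implies \<open>t x = 0\<close>. Hence all powers of \<open>t\<close> are injective on \<open>tI\<close>,
  and \<open>t\<^sup>2 \<in> tI\<close>. The square-zero homotopy for \<open>q = t\<^sup>2\<close> on a resolution of \<open>S/(tI)\<close> then yields a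
  multiplication on the resolutions of \<open>S/(q\<^sup>2 t I)\<close>.\<close>

theorem regular_local_dga:
  fixes M I :: "'a::comm_ring_1 set"
  assumes reg: "regular_local_ring M" and I: "is_ideal I" "I \<noteq> UNIV"
  shows "\<exists>s. s \<noteq> 0 \<and> mfr_admits_dga M ((*) s ` I)"
proof (cases "\<forall>a\<in>I. \<exists>n. a ^ n = 0")
  case True
  have noeth: "noetherian TYPE('a)"
    using reg by (simp add: regular_local_ring_def)
  obtain s where s: "s \<noteq> 0" "\<forall>a\<in>I. s * a = 0"
    using nil_ideal_annihilated[OF noeth I(1)] True by blast
  have "(*) s ` I = {0}"
    using s(2) is_idealD(1)[OF I(1)] by (auto simp: image_iff)
  moreover have "mfr_admits_dga M {0}"
  proof (rule local_mfr_admits_dga[OF reg])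
    show "is_ideal {0 :: 'a}"
      by (rule is_idealI) auto
    show "{0 :: 'a} \<noteq> UNIV"
      by (metis UNIV_I singletonD zero_neq_one)
    show "\<exists>m. dga_structure r d m" if "free_resolution {0} r d" "linear_map d" for r and d :: "'a felem \<Rightarrow> _"
      by (rule exI, rule dga_of_zero_ideal[OF that])
  qed
  ultimately show ?thesis
    using s(1) by metis
next
  case False
  then obtain a where a: "a \<in> I" "\<And>n. a ^ n \<noteq> 0"
    by blast
  have noeth: "noetherian TYPE('a)"
    using reg by (simp add: regular_local_ring_def)
  have "\<exists>n. \<forall>m\<ge>n. {x. a ^ m * x = 0} = {x. a ^ n * x = 0}"
  proof (rule noetherian_chain_stationary[OF noeth])
    show "is_ideal {x. a ^ n * x = 0}" for n
      by (rule is_idealI) (auto simp: distrib_left mult.left_commute)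
    show "{x. a ^ n * x = 0} \<subseteq> {x. a ^ Suc n * x = 0}" for n
      by (auto simp: mult.assoc)
  qed
  then obtain n where n: "\<And>m. m \<ge> n \<Longrightarrow> {x. a ^ m * x = 0} = {x. a ^ n * x = 0}"
    by blast
  \<comment> \<open>The exponent \<open>Suc n\<close> instead of \<open>n\<close> ensures that \<open>t\<close> lies in \<open>I\<close> even if \<open>n = 0\<close>.\<close>
  define t where "t = a ^ Suc n"
  have t: "t \<in> I" "\<And>m. t ^ m \<noteq> 0"
    using is_idealD(5)[OF I(1) a(1)] a(2) by (auto simp: t_def simp del: power_Suc simp flip: power_mult) (simp add: is_idealD(5)[OF I(1) a(1)])
  have stable: "t * x = 0" if "t ^ m * x = 0" for x m
  proof -
    have "a ^ (Suc n * Suc m) * x = 0"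
      using that by (simp add: t_def power_mult mult.assoc del: mult_Suc_right mult_Suc)
    then have "x \<in> {x. a ^ (Suc n * Suc m) * x = 0}"
      by simp
    also have "\<dots> = {x. a ^ Suc n * x = 0}"
      using n[of "Suc n * Suc m"] n[of "Suc n"] by simp
    finally show ?thesis
      by (simp add: t_def)
  qed
  let ?I = "(*) t ` I"
  define q where "q = t * t"
  have "mfr_admits_dga M ((*) (q * q) ` ?I)"
  proof (rule local_mfr_admits_dga[OF reg])
    show J: "is_ideal ((*) (q * q) ` ?I)"
      by (intro is_ideal_times I)
    have "(*) (q * q) ` ?I \<subseteq> I"
      using times_ideal_subset[OF I(1)] times_ideal_subset[OF is_ideal_times[OF I(1)]] by blast
    then show "(*) (q * q) ` ?I \<noteq> UNIV"
      using I(2) by blast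
    show "\<exists>m. dga_structure r d m" if "free_resolution ((*) (q * q) ` ?I) r d" "linear_map d" for r d
    proof (rule dga_of_square_multiple[OF that is_ideal_times[OF I(1)]])
      show "q \<in> ?I"
        using t(1) by (simp add: q_def)
      show "b = 0" if b: "b \<in> ?I" "q * q * b = 0" for b
      proof -
        obtain x where x: "b = t * x"
          using b(1) by blast
        have "t ^ 5 * x = 0"
          using b(2) by (simp add: x q_def eval_nat_numeral ac_simps)
        then show ?thesis
          using stable x by simp
      qed
    qed
  qed
  moreover have "(*) (q * q) ` ?I = (*) (t ^ 5) ` I"
    by (simp add: image_image q_def eval_nat_numeral ac_simps)
  ultimately show ?thesis
    using t(2)[of 5] by metis
qed

section \<open>Polynomial rings\<close>

type_synonym 'n expo = "'n \<Rightarrow>\<^sub>0 nat"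

lemma poly_expand: "p = (\<Sum>u\<in>keys p. single u (lookup p u))"
  by (rule poly_mapping_eqI)
     (auto simp: lookup_sum lookup_single when_def in_keys_iff)

lemma lookup_times:
  fixes f g :: "('n, 'k::field) mpol"
  shows "lookup (f * g) w = (\<Sum>u\<in>keys f. \<Sum>v\<in>keys g.
    if u + v = w then lookup f u * lookup g v else 0)"
proof -
  have "f * g = (\<Sum>u\<in>keys f. \<Sum>v\<in>keys g.
      single (u + v) (lookup f u * lookup g v))"
    by (subst (1) poly_expand[of f], subst (1) poly_expand[of g]) (simp add: sum_product mult_single)
  then show ?thesis
    by (simp add: lookup_sum lookup_single when_def)
qed

subsection \<open>A monomial order with values in the natural numbers\<close>

lemma ex_prime_labels: "\<exists>p :: ('n::finite) \<Rightarrow> nat. inj p \<and> (\<forall>i. prime (p i))"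
proof -
  obtain B where B: "B \<subseteq> {p::nat. prime p}" "finite B" "card B = card (UNIV :: 'n set)"
    using infinite_arbitrarily_large[OF primes_infinite] by metis
  then obtain p where "bij_betw p (UNIV :: 'n set) B"
    using finite_same_card_bij[of "UNIV :: 'n set" B] by auto
  then show ?thesis
    using B(1) by (intro exI[of _ p]) (auto simp: bij_betw_def)
qed

definition prime_label :: "'n::finite \<Rightarrow> nat" where
  "prime_label = (SOME p. inj p \<and> (\<forall>i. prime (p i)))"

lemma prime_label: "inj prime_label" "prime (prime_label i)"
  using someI_ex[OF ex_prime_labels] by (auto simp: prime_label_def)

text \<open>Assigning a prime to each variable makes exponent vectors into natural numbers, by unique
  factorisation. Their usual order is a well-founded total order compatible with multiplication,
  that is, a monomial order.\<close>

definition expo_number :: "('n::finite) expo \<Rightarrow> nat" where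
  "expo_number u = (\<Prod>i\<in>UNIV. prime_label i ^ lookup u i)"

lemma expo_number_add: "expo_number (u + v) = expo_number u * expo_number v"
  by (simp add: expo_number_def lookup_add power_add prod.distrib)

lemma expo_number_pos: "expo_number u > 0"
  by (simp add: expo_number_def prod_pos prime_gt_0_nat[OF prime_label(2)])

lemma expo_number_inject:
  fixes u v :: "('n::finite) expo"
  shows "expo_number u = expo_number v \<longleftrightarrow> u = v"
proof
  assume eq: "expo_number u = expo_number v"
  have "multiplicity (prime_label i) (expo_number w) = lookup w i" for i and w :: "'n expo"
  proof -
    let ?f = "\<lambda>p. lookup w (inv prime_label p)"
    have "expo_number w = (\<Prod>p\<in>range (prime_label :: 'n \<Rightarrow> nat). p ^ ?f p)"
      unfolding expo_number_def prod.reindex[OF prime_label(1)] o_def inv_f_f[OF prime_label(1)] ..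
    also have "multiplicity (prime_label i) \<dots> = ?f (prime_label i)"
      using prime_label(2) by (subst multiplicity_prod_prime_powers) auto
    finally show ?thesis
      by (simp add: inv_f_f[OF prime_label(1)])
  qed
  then show "u = v"
    using eq by (intro poly_mapping_eqI) metis
qed simp

lemma ex_leading_exponent:
  assumes "f \<noteq> 0"
  obtains u where "u \<in> keys f" "\<And>v. v \<in> keys f \<Longrightarrow> expo_number v \<le> expo_number u"
proof -
  have "finite (keys f)" "keys f \<noteq> {}"
    using assms by (auto simp: poly_mapping_eq_iff fun_eq_iff in_keys_iff)
  then have "Max (expo_number ` keys f) \<in> expo_number ` keys f"
    by (intro Max_in) auto
  then obtain u where "u \<in> keys f" "expo_number u = Max (expo_number ` keys f)"
    by (metis imageE)
  then show thesis
    using that[of u] by simp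
qed

text \<open>The product of the leading terms cannot cancel: a product of two smaller terms has a smaller
  number.\<close>

lemma mpol_no_zero_divisors:
  fixes f g :: "('n::finite, 'k::field) mpol"
  assumes "f \<noteq> 0" "g \<noteq> 0"
  shows "f * g \<noteq> 0"
proof -
  obtain u where u: "u \<in> keys f" "\<And>v. v \<in> keys f \<Longrightarrow> expo_number v \<le> expo_number u"
    using ex_leading_exponent[OF assms(1)] by blast
  obtain v where v: "v \<in> keys g" "\<And>w. w \<in> keys g \<Longrightarrow> expo_number w \<le> expo_number v"
    using ex_leading_exponent[OF assms(2)] by blast
  have top: "a + b = u + v \<longleftrightarrow> a = u \<and> b = v" if "a \<in> keys f" "b \<in> keys g" for a b
  proof
    assume "a + b = u + v"
    then have eq: "expo_number a * expo_number b = expo_number u * expo_number v"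
      by (simp flip: expo_number_add)
    have le: "expo_number a \<le> expo_number u" "expo_number b \<le> expo_number v"
      using u(2) v(2) that by auto
    have "expo_number a = expo_number u"
    proof (rule ccontr)
      assume "expo_number a \<noteq> expo_number u"
      then have "expo_number a * expo_number b < expo_number u * expo_number v"
        using le expo_number_pos[of b] expo_number_pos[of v]
        by (metis le_neq_implies_less mult_less_le_imp_less zero_le)
      then show False using eq by simp
    qed
    moreover from this have "expo_number b = expo_number v"
      using eq expo_number_pos[of u] by simp
    ultimately show "a = u \<and> b = v"
      by (simp add: expo_number_inject)
  qed simp
  have "lookup (f * g) (u + v) = (\<Sum>a\<in>keys f. \<Sum>b\<in>keys g.
      if a = u \<and> b = v then lookup f a * lookup g b else 0)"
    unfolding lookup_times by (intro sum.cong refl) (simp add: top)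
  also have "\<dots> = (\<Sum>a\<in>keys f. if a = u then lookup f u * lookup g v else 0)"
    using v(1) by (intro sum.cong refl) (auto simp: sum.delta)
  also have "\<dots> = lookup f u * lookup g v"
    using u(1) by (simp add: sum.delta)
  also have "\<dots> \<noteq> 0"
    using u(1) v(1) by (simp add: in_keys_iff)
  finally show ?thesis
    by auto
qed

subsection \<open>Dickson's lemma and Hilbert's basis theorem\<close>

lemma decreasing_nat_stationary:
  fixes X :: "nat \<Rightarrow> nat"
  assumes "\<And>m n. m \<le> n \<Longrightarrow> X n \<le> X m"
  shows "\<exists>N. \<forall>n\<ge>N. X n = X N"
proof -
  obtain N where N: "\<And>n. X N \<le> X n"
    using ex_has_least_nat[of "\<lambda>_. True" 0 X] by auto
  then show ?thesis
    using assms by (intro exI[of _ N]) (auto intro: le_antisym)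
qed

text \<open>Refine the sequence one coordinate at a time. A monotone sequence of natural numbers that
  decreases is constant from some point on, so a tail of it is increasing too.\<close>

lemma monotone_subsequence:
  fixes u :: "nat \<Rightarrow> 'n expo"
  assumes "finite A"
  shows "\<exists>r :: nat \<Rightarrow> nat. strict_mono r \<and>
    (\<forall>i\<in>A. \<forall>m n. m \<le> n \<longrightarrow> lookup (u (r m)) i \<le> lookup (u (r n)) i)"
  using assms
proof (induction A)
  case empty
  show ?case by (intro exI[of _ id]) (auto simp: strict_mono_def)
next
  case (insert i A)
  then obtain r :: "nat \<Rightarrow> nat" where r: "strict_mono r"
    "\<And>i m n. i \<in> A \<Longrightarrow> m \<le> n \<Longrightarrow> lookup (u (r m)) i \<le> lookup (u (r n)) i"
    by blast
  let ?X = "\<lambda>n. lookup (u (r n)) i"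
  have "\<exists>f :: nat \<Rightarrow> nat. strict_mono f \<and> (\<forall>m n. m \<le> n \<longrightarrow> ?X (f m) \<le> ?X (f n))"
  proof -
    obtain f :: "nat \<Rightarrow> nat" where f: "strict_mono f" "monoseq (\<lambda>n. ?X (f n))"
      using seq_monosub[of ?X] by blast
    from f(2) consider "\<And>m n. m \<le> n \<Longrightarrow> ?X (f m) \<le> ?X (f n)" | "\<And>m n. m \<le> n \<Longrightarrow> ?X (f n) \<le> ?X (f m)"
      unfolding monoseq_def by blast
    then show ?thesis
    proof cases
      case 1
      then show ?thesis using f(1) by blast
    next
      case 2
      obtain N where N: "\<And>n. n \<ge> N \<Longrightarrow> ?X (f n) = ?X (f N)"
        using decreasing_nat_stationary[of "\<lambda>n. ?X (f n)"] 2 by blast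
      have "?X (f (m + N)) \<le> ?X (f (n + N))" for m n
        using N[of "m + N"] N[of "n + N"] by simp
      moreover have "strict_mono (\<lambda>n. f (n + N))"
        using f(1) by (simp add: strict_mono_def)
      ultimately show ?thesis
        by (intro exI[of _ "\<lambda>n. f (n + N)"]) simp
    qed
  qed
  then obtain f :: "nat \<Rightarrow> nat" where f: "strict_mono f" "\<And>m n. m \<le> n \<Longrightarrow> ?X (f m) \<le> ?X (f n)"
    by blast
  have "strict_mono (\<lambda>n. r (f n))"
    using r(1) f(1) by (simp add: strict_mono_def)
  moreover have "lookup (u (r (f m))) j \<le> lookup (u (r (f n))) j"
    if "j \<in> insert i A" "m \<le> n" for j m n
  proof (cases "j = i")
    case False
    have "f m \<le> f n"
      using f(1) that(2) by (simp add: strict_mono_less_eq)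
    then show ?thesis
      using r(2) that(1) False by blast
  qed (use f(2) that(2) in simp)
  ultimately show ?case
    by (intro exI[of _ "\<lambda>n. r (f n)"]) blast
qed

abbreviation divides_expo :: "'n expo \<Rightarrow> 'n expo \<Rightarrow> bool" where
  "divides_expo u v \<equiv> (\<forall>i. lookup u i \<le> lookup v i)"

lemma ex_minimal_divisor:
  fixes L :: "('n::finite) expo set"
  assumes "w \<in> L"
  shows "\<exists>u\<in>L. divides_expo u w \<and> (\<forall>v\<in>L. divides_expo v u \<longrightarrow> v = u)"
proof -
  let ?deg = "\<lambda>u :: 'n expo. \<Sum>i\<in>UNIV. lookup u i"
  obtain u where u: "u \<in> L" "divides_expo u w"
    "\<And>v. v \<in> L \<Longrightarrow> divides_expo v w \<Longrightarrow> ?deg u \<le> ?deg v"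
    using ex_has_least_nat[of "\<lambda>u. u \<in> L \<and> divides_expo u w" w ?deg] assms by blast
  have "v = u" if v: "v \<in> L" "divides_expo v u" for v
  proof (rule ccontr)
    assume "v \<noteq> u"
    then obtain i where "lookup v i \<noteq> lookup u i"
      using poly_mapping_eqI[of v u] by blast
    then have "lookup v i < lookup u i"
      using v(2) by (simp add: le_neq_implies_less)
    then have "?deg v < ?deg u"
      using v(2) by (intro sum_strict_mono_ex1) auto
    moreover have "divides_expo v w"
      using v(2) u(2) order_trans by blast
    ultimately show False
      using u(3)[OF v(1)] by simp
  qed
  then show ?thesis
    using u(1,2) by blast
qed

text \<open>Dickson's lemma: among infinitely many exponent vectors, one divides another.\<close>

lemma finite_minimal_exponents:
  fixes L :: "('n::finite) expo set"
  shows "finite {u\<in>L. \<forall>v\<in>L. divides_expo v u \<longrightarrow> v = u}"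
proof (rule ccontr)
  assume "infinite {u\<in>L. \<forall>v\<in>L. divides_expo v u \<longrightarrow> v = u}"
  then obtain u :: "nat \<Rightarrow> 'n expo" where u: "inj u" "range u \<subseteq> {u\<in>L. \<forall>v\<in>L. divides_expo v u \<longrightarrow> v = u}"
    using infinite_countable_subset by blast
  obtain r :: "nat \<Rightarrow> nat" where r: "strict_mono r"
    "\<And>i m n. m \<le> n \<Longrightarrow> lookup (u (r m)) i \<le> lookup (u (r n)) i"
    using monotone_subsequence[of UNIV u] by auto
  have "u (r 0) = u (r 1)"
    using u(2) r(2)[of 0 1] by blast
  then have "r 0 = r 1"
    using u(1) by (simp add: inj_eq)
  then show False
    using r(1) by (simp add: strict_mono_eq)
qed

text \<open>By Dickson's lemma finitely many elements of \<open>I\<close> have, between them, all minimal leading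
  exponents, and they generate \<open>I\<close>: the leading term of any other element of \<open>I\<close> can be cancelled by a
  multiple of one of them, which makes the number of the leading exponent smaller.\<close>

theorem noetherian_mpol: "noetherian TYPE(('n::finite, 'k::field) mpol)"
  unfolding noetherian_def
proof (intro allI impI)
  fix I :: "('n, 'k) mpol set" assume I: "is_ideal I"
  define lead where "lead f u \<longleftrightarrow> u \<in> keys f \<and>
    (\<forall>v\<in>keys f. expo_number v \<le> expo_number u)" for f :: "('n, 'k) mpol" and u
  define L where "L = {u. \<exists>f\<in>I. lead f u}"
  define D where "D = {u\<in>L. \<forall>v\<in>L. divides_expo v u \<longrightarrow> v = u}"
  have "finite D"
    unfolding D_def by (rule finite_minimal_exponents)
  have "\<forall>u\<in>D. \<exists>f\<in>I. lead f u"
    by (auto simp: D_def L_def)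
  then obtain f where f: "\<And>u. u \<in> D \<Longrightarrow> f u \<in> I \<and> lead (f u) u"
    by metis
  let ?J = "ideal_gen (f ` D)"
  have J: "is_ideal ?J"
    by (simp add: ideal_gen_def is_ideal_def module.subspace_span[OF module_mult])
  have "?J \<subseteq> I"
    unfolding ideal_gen_def using f I
    by (intro module.span_minimal[OF module_mult]) (auto simp: is_ideal_def)
  moreover have "g \<in> ?J" if "g \<in> I" "\<And>v. v \<in> keys g \<Longrightarrow> expo_number v < n" for g n
    using that
  proof (induction n arbitrary: g)
    case 0
    then have "g = 0"
      by (intro poly_mapping_eqI) (auto simp: in_keys_iff)
    then show ?case
      using is_idealD(1)[OF J] by simp
  next
    case (Suc n)
    show ?case
    proof (cases "\<exists>u\<in>keys g. expo_number u = n")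
      case False
      then show ?thesis
        using Suc.prems by (intro Suc.IH) (auto simp: less_Suc_eq)
    next
      case True
      then obtain u where u: "u \<in> keys g" "expo_number u = n" by blast
      then have "lead g u"
        using Suc.prems(2) by (auto simp: lead_def less_Suc_eq_le)
      then have "u \<in> L"
        using Suc.prems(1) by (auto simp: L_def)
      then obtain d where d: "d \<in> D" "divides_expo d u"
        using ex_minimal_divisor[of u L] by (auto simp: D_def)
      have ud: "(u - d) + d = u"
        by (rule poly_mapping_eqI) (use d(2) in \<open>simp add: lookup_add lookup_minus\<close>)
      have fd: "f d \<in> I" "lead (f d) d"
        using f d(1) by auto
      define c where "c = lookup g u / lookup (f d) d"
      define h where "h = single (u - d) c * f d"
      have h: "h \<in> I" "h \<in> ?J"
        using is_idealD(4)[OF I fd(1)] is_idealD(4)[OF J] module.span_base[OF module_mult, of "f d"] d(1)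
        by (auto simp: h_def ideal_gen_def)
      have keys_h: "expo_number v \<le> n" if v: "v \<in> keys h" for v
      proof -
        obtain w where w: "w \<in> keys (f d)" "v = (u - d) + w"
          using v keys_mult[of "single (u - d) c" "f d"] by (auto simp: h_def split: if_splits)
        then have "expo_number v \<le> expo_number (u - d) * expo_number d"
          using fd(2) by (simp add: lead_def expo_number_add)
        then show ?thesis
          using u(2) ud by (simp flip: expo_number_add)
      qed
      have "lookup h u = c * lookup (f d) d"
      proof -
        have "lookup h u = (\<Sum>a\<in>keys (single (u - d) c). \<Sum>b\<in>keys (f d).
            if b = d then c * lookup (f d) d else 0)"
          unfolding h_def lookup_times
        proof (intro sum.cong refl)
          fix a b assume "a \<in> keys (single (u - d) c)"
          then have "a = u - d" by (auto split: if_splits)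
          moreover have "(u - d) + b = u \<longleftrightarrow> b = d"
            using ud by (metis add_left_imp_eq)
          ultimately show "(if a + b = u then lookup (single (u - d) c) a * lookup (f d) b else 0)
              = (if b = d then c * lookup (f d) d else 0)"
            by simp
        qed
        then show ?thesis
          using fd(2) by (auto simp: lead_def)
      qed
      also have "\<dots> = lookup g u"
        using fd(2) by (auto simp: c_def lead_def in_keys_iff)
      finally have hu: "lookup (g - h) u = 0"
        by (simp add: lookup_minus)
      have "g - h \<in> ?J"
      proof (rule Suc.IH)
        show "g - h \<in> I"
          using is_idealD(3)[OF I Suc.prems(1) h(1)] .
        fix v assume v: "v \<in> keys (g - h)"
        then have "v \<in> keys g \<or> v \<in> keys h"
          by (auto simp: in_keys_iff lookup_minus)
        then have "expo_number v \<le> n"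
          using Suc.prems(2) keys_h by (auto simp: less_Suc_eq_le)
        moreover have "v \<noteq> u"
          using v hu by (auto simp: in_keys_iff)
        ultimately show "expo_number v < n"
          using u(2) expo_number_inject[of v u] by linarith
      qed
      then have "(g - h) + h \<in> ?J"
        using h(2) by (rule is_idealD(2)[OF J])
      then show ?thesis by simp
    qed
  qed
  then have "g \<in> ?J" if "g \<in> I" for g
    using that finite_nat_set_iff_bounded[of "expo_number ` keys g"] by auto
  ultimately have "I = ?J"
    by blast
  then show "\<exists>B. finite B \<and> I = ideal_gen B"
    using \<open>finite D\<close> by (intro exI[of _ "f ` D"]) auto
qed

section \<open>Gradings of polynomial rings\<close>

text \<open>The gradings by total degree and by exponent vectors are the cases of an additive map \<open>deg\<close>
  with values in the integers and in the integer vectors.\<close>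

definition degree_component :: "('n expo \<Rightarrow> 'g) \<Rightarrow> 'g \<Rightarrow> ('n, 'k::field) mpol set" where
  "degree_component deg g = {p. \<forall>u\<in>keys p. deg u = g}"

definition degree_part :: "('n expo \<Rightarrow> 'g) \<Rightarrow> 'g \<Rightarrow> ('n, 'k::field) mpol \<Rightarrow> ('n, 'k) mpol" where
  "degree_part deg g p = Poly_Mapping.mapp (\<lambda>u c. if deg u = g then c else 0) p"

lemma lookup_degree_part:
  "lookup (degree_part deg g p) u = (if deg u = g then lookup p u else 0)"
  by (auto simp: degree_part_def lookup_mapp when_def in_keys_iff)

lemma degree_component_iff:
  "p \<in> degree_component deg g \<longleftrightarrow> (\<forall>u. deg u \<noteq> g \<longrightarrow> lookup p u = 0)"
  by (auto simp: degree_component_def in_keys_iff)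

lemma degree_grading:
  fixes deg :: "('n::finite) expo \<Rightarrow> 'g::ab_group_add"
  assumes deg: "deg 0 = 0" "\<And>u v. deg (u + v) = deg u + deg v"
  shows "grading (degree_component deg :: 'g \<Rightarrow> ('n, 'k::field) mpol set) (degree_part deg)"
proof
  fix a b :: "('n, 'k) mpol" and g h
  show "a + b \<in> degree_component deg g" if "a \<in> degree_component deg g" "b \<in> degree_component deg g"
    using that by (simp add: degree_component_iff lookup_add)
  show "a * b \<in> degree_component deg (g + h)" if a: "a \<in> degree_component deg g" and b: "b \<in> degree_component deg h"
    unfolding degree_component_def
  proof (intro CollectI ballI)
    fix w assume "w \<in> keys (a * b)"
    then obtain u v where "u \<in> keys a" "v \<in> keys b" "w = u + v"
      using keys_mult[of a b] by blast
    then show "deg w = g + h"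
      using a b by (simp add: degree_component_def deg)
  qed
  show "(1 :: ('n, 'k) mpol) \<in> degree_component deg 0"
    by (simp add: degree_component_def deg)
  show "degree_part deg g (a + b) = degree_part deg g a + degree_part deg g b"
    by (rule poly_mapping_eqI) (simp add: lookup_degree_part lookup_add)
  show "degree_part deg g a \<in> degree_component deg g"
    by (simp add: degree_component_iff lookup_degree_part)
  show "degree_part deg g a = a" if "a \<in> degree_component deg g"
    by (rule poly_mapping_eqI) (use that in \<open>auto simp: lookup_degree_part degree_component_iff\<close>)
  show "degree_part deg h a = 0" if "a \<in> degree_component deg g" "h \<noteq> g"
    by (rule poly_mapping_eqI) (use that in \<open>auto simp: lookup_degree_part degree_component_iff\<close>)
  have sub: "{g. degree_part deg g a \<noteq> 0} \<subseteq> deg ` keys a"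
  proof
    fix g assume "g \<in> {g. degree_part deg g a \<noteq> 0}"
    then obtain u where "lookup (degree_part deg g a) u \<noteq> 0"
      by (auto simp: poly_mapping_eq_iff fun_eq_iff)
    then show "g \<in> deg ` keys a"
      by (auto simp: lookup_degree_part in_keys_iff split: if_splits)
  qed
  then show fin: "finite {g. degree_part deg g a \<noteq> 0}"
    by (rule finite_subset) simp
  show "(\<Sum>g | degree_part deg g a \<noteq> 0. degree_part deg g a) = a"
  proof (rule poly_mapping_eqI)
    fix u
    have "lookup (\<Sum>g | degree_part deg g a \<noteq> 0. degree_part deg g a) u =
        (\<Sum>g | degree_part deg g a \<noteq> 0. if g = deg u then lookup a u else 0)"
      unfolding lookup_sum by (intro sum.cong refl) (auto simp: lookup_degree_part)
    also have "\<dots> = (if deg u \<in> {g. degree_part deg g a \<noteq> 0} then lookup a u else 0)"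
      using fin by (simp add: sum.delta)
    also have "\<dots> = lookup a u"
      using lookup_degree_part[of deg "deg u" a u] by (auto simp del: lookup_not_eq_zero_eq_in_keys)
    finally show "lookup (\<Sum>g | degree_part deg g a \<noteq> 0. degree_part deg g a) u = lookup a u" .
  qed
qed

lemma lookup_times_0:
  fixes f g :: "('n, 'k::field) mpol"
  shows "lookup (f * g) 0 = lookup f 0 * lookup g 0"
proof -
  have eq: "u + v = 0 \<longleftrightarrow> u = 0 \<and> v = 0" for u v :: "'n expo"
    by (auto simp: poly_mapping_eq_iff fun_eq_iff lookup_add)
  have "lookup (f * g) 0 = (\<Sum>a\<in>keys f. \<Sum>b\<in>keys g.
      if b = 0 then if a = 0 then lookup f 0 * lookup g 0 else 0 else 0)"
    unfolding lookup_times by (intro sum.cong refl) (simp add: eq)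
  also have "\<dots> = lookup f 0 * lookup g 0"
    by (cases "lookup g 0 = 0") (auto simp: sum.delta in_keys_iff)
  finally show ?thesis .
qed

lemma vars_ideal_eq: "vars_ideal = {p :: ('n::finite, 'k::field) mpol. lookup p 0 = 0}"
proof
  have "is_ideal {p :: ('n, 'k) mpol. lookup p 0 = 0}"
    by (rule is_idealI) (simp_all add: lookup_add lookup_times_0)
  moreover have "single i (Suc 0) \<noteq> (0 :: 'n expo)" for i
    by (metis lookup_single_eq lookup_zero nat.distinct(1))
  ultimately show "vars_ideal \<subseteq> {p :: ('n, 'k) mpol. lookup p 0 = 0}"
    unfolding vars_ideal_def ideal_gen_def
    by (intro module.span_minimal[OF module_mult])
      (auto simp: is_ideal_def monomial_def lookup_single when_def)
  show "{p :: ('n, 'k) mpol. lookup p 0 = 0} \<subseteq> vars_ideal"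
  proof
    fix p :: "('n, 'k) mpol" assume p: "p \<in> {p. lookup p 0 = 0}"
    have "(\<Sum>u\<in>keys p. single u (lookup p u)) \<in> vars_ideal"
      unfolding vars_ideal_def ideal_gen_def
    proof (rule module.span_sum[OF module_mult])
      fix u assume "u \<in> keys p"
      then have "u \<noteq> 0"
        using p by (auto simp: in_keys_iff)
      then obtain i where i: "lookup u i \<noteq> 0"
        by (auto simp: poly_mapping_eq_iff fun_eq_iff)
      have "(u - single i 1) + single i 1 = u"
        by (rule poly_mapping_eqI) (use i in \<open>auto simp: lookup_add lookup_minus lookup_single when_def\<close>)
      then have "single u (lookup p u) =
          single (u - single i 1) (lookup p u) *
          monomial (single i 1)"
        by (simp add: monomial_def mult_single)
      then show "single u (lookup p u) \<in>
          module.span (*) {monomial (single i 1) |i. True}"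
        by (simp only:) (intro module.span_scale[OF module_mult] module.span_base[OF module_mult], blast)
    qed
    then show "p \<in> vars_ideal"
      by (simp flip: poly_expand)
  qed
qed

lemma degree_graded_local:
  fixes deg :: "('n::finite) expo \<Rightarrow> 'g::ab_group_add"
  assumes deg: "deg 0 = 0" "\<And>u v. deg (u + v) = deg u + deg v" and deg_eq_0: "\<And>u. deg u = 0 \<Longrightarrow> u = 0"
  shows "graded_local (degree_component deg :: 'g \<Rightarrow> ('n, 'k::field) mpol set) (degree_part deg) vars_ideal"
proof (rule graded_local.intro[OF degree_grading[OF deg]])
  show "graded_local_axioms (degree_component deg :: 'g \<Rightarrow> ('n, 'k) mpol set) vars_ideal"
  proof
    show "noetherian TYPE(('n, 'k) mpol)"
      by (rule noetherian_mpol)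
    show "is_ideal (vars_ideal :: ('n, 'k) mpol set)"
      by (simp add: is_ideal_def vars_ideal_def ideal_gen_def module.subspace_span[OF module_mult])
    fix a :: "('n, 'k) mpol" and g assume a: "a \<in> degree_component deg g" "a \<notin> vars_ideal"
    then have a0: "lookup a 0 \<noteq> 0"
      by (simp add: vars_ideal_eq)
    then have "g = 0"
      using a(1) deg(1) by (auto simp: degree_component_iff)
    have "a = single 0 (lookup a 0)"
    proof (rule poly_mapping_eqI)
      fix u
      show "lookup a u = lookup (single 0 (lookup a 0)) u"
        using a(1) deg_eq_0[of u] unfolding \<open>g = 0\<close>
        by (cases "u = 0") (auto simp: degree_component_iff lookup_single when_def)
    qed
    moreover have "single 0 (lookup a 0) *
        single 0 (inverse (lookup a 0)) = (1 :: ('n, 'k) mpol)"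
      using a0 by (simp add: mult_single)
    ultimately show "\<exists>b. a * b = 1"
      by metis
  qed
qed

definition total_degree :: "('n::finite) expo \<Rightarrow> int" where
  "total_degree u = int (\<Sum>i\<in>UNIV. lookup u i)"

lemma std_component_eq: "std_component = degree_component total_degree"
  by (auto simp: fun_eq_iff std_component_def degree_component_def total_degree_def)

lemma std_graded_local:
  "graded_local (std_component :: int \<Rightarrow> ('n::finite, 'k::field) mpol set) (degree_part total_degree) vars_ideal"
  unfolding std_component_eq
proof (rule degree_graded_local)
  show "u = 0" if "total_degree u = 0" for u :: "'n expo"
    by (rule poly_mapping_eqI) (use that[unfolded total_degree_def of_nat_eq_0_iff] in simp)
qed (simp_all add: total_degree_def lookup_add sum.distrib)

text \<open>For \<open>I \<noteq> 0\<close> take \<open>s = q\<^sup>2\<close> with a nonzero homogeneous generator \<open>q\<close>, and \<open>s = 1\<close> for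
  \<open>I = 0\<close>.\<close>

theorem homogeneous_dga:
  fixes I :: "('n::finite, 'k::field) mpol set"
  assumes hom: "homogeneous_ideal I" and I_neq: "I \<noteq> UNIV"
  shows "\<exists>s. s \<noteq> 0 \<and> homogeneous s \<and> graded_mfr_admits_dga std_component vars_ideal ((*) s ` I)"
proof -
  interpret graded_local "std_component :: int \<Rightarrow> ('n, 'k) mpol set" "degree_part total_degree" vars_ideal
    by (rule std_graded_local)
  obtain G where G: "\<And>p. p \<in> G \<Longrightarrow> homogeneous p" "I = ideal_gen G"
    using hom by (auto simp: homogeneous_ideal_def)
  have I: "is_ideal I"
    by (simp add: is_ideal_def G(2) ideal_gen_def module.subspace_span[OF module_mult])
  have closed: "degree_part total_degree g a \<in> I" if "a \<in> I" for a g
    unfolding G(2)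
    by (rule homogeneous_ideal_closed) (use G that in \<open>auto simp: homogeneous_def\<close>)
  show ?thesis
  proof (cases "G \<subseteq> {0}")
    case True
    then have "I \<subseteq> {0}"
      unfolding G(2) ideal_gen_def
      by (intro module.span_minimal[OF module_mult]) (auto simp: module.subspace_single_0[OF module_mult])
    then have I0: "I = {0}"
      using is_idealD(1)[OF I] by blast
    have "graded_mfr_admits_dga std_component vars_ideal ((*) 1 ` I)"
    proof (rule graded_mfr_admits_dgaI)
      show "\<exists>m. dga_structure r d m" if res: "free_resolution ((*) 1 ` I) r d" and lin: "linear_map d" for r d
      proof -
        have "free_resolution {0} r d"
          using res by (simp add: I0)
        from dga_of_zero_ideal[OF this lin] show ?thesis
          by (rule exI[where P = "dga_structure r d"])
      qed
    qed (use I I_neq closed in auto)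
    moreover have "homogeneous (1 :: ('n, 'k) mpol)"
      using C_one by (auto simp: homogeneous_def)
    ultimately show ?thesis
      by (intro exI[of _ 1]) simp
  next
    case False
    then obtain q where q: "q \<in> G" "q \<noteq> 0" by blast
    then have qI: "q \<in> I"
      unfolding G(2) ideal_gen_def by (intro module.span_base[OF module_mult])
    obtain g where g: "q \<in> std_component g"
      using G(1)[OF q(1)] by (auto simp: homogeneous_def)
    have qq: "q * q \<in> std_component (g + g)"
      by (intro C_mult g)
    have nz: "q * q \<noteq> 0"
      using q(2) by (intro mpol_no_zero_divisors)
    have "graded_mfr_admits_dga std_component vars_ideal ((*) (q * q) ` I)"
    proof (rule graded_mfr_admits_dgaI)
      show "is_ideal ((*) (q * q) ` I)"
        by (rule is_ideal_times[OF I])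
      show "(*) (q * q) ` I \<noteq> UNIV"
        using times_ideal_subset[OF I] I_neq by blast
      show "degree_part total_degree h a \<in> (*) (q * q) ` I" if "a \<in> (*) (q * q) ` I" for a h
        by (rule homogeneous_multiple_closed[OF qq closed that])
      show "\<exists>m. dga_structure r d m" if "free_resolution ((*) (q * q) ` I) r d" "linear_map d" for r d
        by (rule dga_of_square_multiple[OF that I qI]) (use mpol_no_zero_divisors[OF nz] in blast)
    qed
    then show ?thesis
      using nz qq by (auto simp: homogeneous_def)
  qed
qed

section \<open>The fine grading and dehomogenisation\<close>

lemma lookup_map_zero: "f 0 = 0 \<Longrightarrow> lookup (Poly_Mapping.map f x) k = f (lookup x k)"
  by transfer (simp add: when_def)

definition fine_degree :: "('n::finite) expo \<Rightarrow> ('n \<Rightarrow>\<^sub>0 int)" where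
  "fine_degree u = Poly_Mapping.map int u"

lemma lookup_fine_degree [simp]: "lookup (fine_degree u) i = int (lookup u i)"
  by (simp add: fine_degree_def lookup_map_zero)

lemma fine_degree_eq_iff:
  "fine_degree u = g \<longleftrightarrow> (\<forall>i. int (lookup u i) = lookup g i)"
  by (simp add: poly_mapping_eq_iff fun_eq_iff)

lemma fine_component_eq: "fine_component = degree_component fine_degree"
  by (simp add: fun_eq_iff fine_component_def degree_component_def fine_degree_eq_iff)

lemma fine_degree_0: "fine_degree 0 = 0"
  by (simp add: fine_degree_eq_iff)

lemma fine_degree_add: "fine_degree (u + v) = fine_degree u + fine_degree v"
  by (simp add: fine_degree_eq_iff lookup_add)

lemma fine_degree_inject: "fine_degree u = fine_degree v \<longleftrightarrow> u = v"
  by (auto simp: fine_degree_eq_iff intro: poly_mapping_eqI)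

lemma fine_graded_local:
  "graded_local (fine_component :: ('n \<Rightarrow>\<^sub>0 int) \<Rightarrow> ('n::finite, 'k::field) mpol set)
     (degree_part fine_degree) vars_ideal"
  unfolding fine_component_eq
  by (rule degree_graded_local) (auto simp: fine_degree_0 fine_degree_add simp flip: fine_degree_inject)

definition nonneg :: "('n \<Rightarrow>\<^sub>0 int) \<Rightarrow> bool" where
  "nonneg g \<longleftrightarrow> (\<forall>i. 0 \<le> lookup g i)"

text \<open>The components of the fine grading are at most one-dimensional.\<close>

lemma fine_component_nonneg:
  assumes "p \<in> fine_component g" "p \<noteq> 0"
  obtains u c where "g = fine_degree u" "p = single u c" "c \<noteq> 0"
proof -
  obtain u where u: "lookup p u \<noteq> 0"
    using assms(2) by (auto simp: poly_mapping_eq_iff fun_eq_iff)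
  then have g: "fine_degree u = g"
    using assms(1) by (auto simp: fine_component_eq degree_component_iff)
  have "p = single u (lookup p u)"
  proof (rule poly_mapping_eqI)
    fix v
    show "lookup p v = lookup (single u (lookup p u)) v"
      using assms(1) unfolding g[symmetric]
      by (cases "v = u") (auto simp: fine_component_eq degree_component_iff lookup_single when_def fine_degree_inject)
  qed
  then show thesis
    using that g u by metis
qed

definition expo_of :: "('n \<Rightarrow>\<^sub>0 int) \<Rightarrow> 'n expo" where
  "expo_of g = Poly_Mapping.map nat g"

lemma fine_degree_expo_of: "nonneg g \<Longrightarrow> fine_degree (expo_of g) = g"
  by (simp add: fine_degree_eq_iff expo_of_def lookup_map_zero nonneg_def)

lemma single_in_fine_component:
  "fine_degree u = g \<Longrightarrow> single u c \<in> fine_component g"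
  by (auto simp: fine_component_eq degree_component_iff lookup_single when_def)

text \<open>The value of a polynomial at the point with all coordinates 1. It is injective on each component
  of the fine grading, so identities between homogeneous elements may be checked after setting
  the variables to 1.\<close>

definition at_one :: "('n, 'k::field) mpol \<Rightarrow> 'k" where
  "at_one p = (\<Sum>u\<in>keys p. lookup p u)"

lemma at_one_superset:
  "finite A \<Longrightarrow> keys p \<subseteq> A \<Longrightarrow> at_one p = (\<Sum>u\<in>A. lookup p u)"
  unfolding at_one_def by (rule sum.mono_neutral_left) (auto simp: in_keys_iff)

lemma at_one_0 [simp]: "at_one 0 = 0"
  by (simp add: at_one_def)

lemma at_one_add: "at_one (p + q) = at_one p + at_one q"
proof -
  let ?A = "keys p \<union> keys q"
  have "keys (p + q) \<subseteq> ?A"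
    by (rule keys_add)
  then show ?thesis
    by (simp add: at_one_superset[of ?A] lookup_add sum.distrib)
qed

lemma at_one_single [simp]: "at_one (single u c) = c"
  by (simp add: at_one_superset[of "{u}"])

lemma at_one_sum: "at_one (sum f A) = (\<Sum>a\<in>A. at_one (f a))"
  by (induction A rule: infinite_finite_induct) (auto simp: at_one_add)

lemma at_one_times: "at_one (p * q) = at_one p * at_one q"
proof -
  have "p * q = (\<Sum>u\<in>keys p. \<Sum>v\<in>keys q.
      single (u + v) (lookup p u * lookup q v))"
    by (subst (1) poly_expand[of p], subst (1) poly_expand[of q]) (simp add: sum_product mult_single)
  then have "at_one (p * q) = (\<Sum>u\<in>keys p. \<Sum>v\<in>keys q.
      lookup p u * lookup q v)"
    by (simp add: at_one_sum)
  then show ?thesis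
    by (simp add: at_one_def sum_product)
qed

lemma at_one_inject:
  assumes "p \<in> fine_component g" "q \<in> fine_component g" "at_one p = at_one q"
  shows "p = q"
proof (cases "p = 0")
  case True
  show ?thesis
  proof (rule ccontr)
    assume "p \<noteq> q"
    then have "q \<noteq> 0" using True by simp
    then obtain u c where "q = single u c" "c \<noteq> 0"
      using fine_component_nonneg[OF assms(2)] by metis
    then show False
      using assms(3) True by simp
  qed
next
  case False
  then obtain u c where u: "g = fine_degree u" "p = single u c" "c \<noteq> 0"
    using fine_component_nonneg[OF assms(1)] by metis
  then have "q \<noteq> 0"
    using assms(3) by auto
  then obtain v b where v: "g = fine_degree v" "q = single v b"
    using fine_component_nonneg[OF assms(2)] by metis
  then show ?thesis
    using u assms(3) by (simp add: fine_degree_inject)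
qed

definition dehom :: "('n, 'k::field) mpol felem \<Rightarrow> 'k felem" where
  "dehom x = Poly_Mapping.map at_one x"

lemma coeff_dehom [simp]: "coeff (dehom x) k = at_one (coeff x k)"
  by (simp add: dehom_def lookup_map_zero)

lemma dehom_add: "dehom (x + y) = dehom x + dehom y"
  by (rule poly_mapping_eqI) (simp add: lookup_add at_one_add)

lemma dehom_0 [simp]: "dehom 0 = 0"
  by (rule poly_mapping_eqI) simp

lemma dehom_smult: "dehom (smult a x) = smult (at_one a) (dehom x)"
  by (rule poly_mapping_eqI) (simp add: at_one_times)

lemma at_one_1 [simp]: "at_one 1 = 1"
  by (metis at_one_single single_one)

lemma dehom_basis [simp]: "dehom (basis k) = basis k"
  by (rule poly_mapping_eqI) (simp add: coeff_basis)

lemma dehom_sum: "dehom (sum f A) = (\<Sum>a\<in>A. dehom (f a))"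
  by (induction A rule: infinite_finite_induct) (auto simp: dehom_add)

lemma dehom_free_part: "x \<in> free_part r i \<Longrightarrow> dehom x \<in> free_part r i"
  by (simp add: in_free_part_iff)

lemma dehom_of_ring: "dehom (of_ring a) = of_ring (at_one a)"
  by (simp add: of_ring_eq_smult dehom_smult)

lemma dehom_linear:
  assumes F: "linear_map F" and f: "linear_map f"
    and basis: "\<And>k. k \<in> keys x \<Longrightarrow> dehom (F (basis k)) = f (basis k)"
  shows "dehom (F x) = f (dehom x)"
proof -
  have "dehom (F x) = (\<Sum>k\<in>keys x. smult (at_one (coeff x k)) (f (basis k)))"
    by (simp add: linear_expand[OF F, of x] dehom_sum dehom_smult basis)
  also have "\<dots> = f (\<Sum>k\<in>keys x. smult (at_one (coeff x k)) (basis k))"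
    by (simp add: linear_sum[OF f] linear_smult[OF f])
  also have "(\<Sum>k\<in>keys x. smult (at_one (coeff x k)) (basis k)) = dehom x"
    by (subst (3) felem_expand) (simp add: dehom_sum dehom_smult)
  finally show ?thesis .
qed

text \<open>The inverse of dehomogenisation in a given degree \<open>g\<close>. The function \<^const>\<open>expo_of\<close> truncates
  negative entries, so the result is homogeneous only if \<open>g - \<delta> k\<close> has none on the support of \<open>v\<close>.\<close>

definition rehom :: "(nat \<times> nat \<Rightarrow> 'n \<Rightarrow>\<^sub>0 int) \<Rightarrow> ('n \<Rightarrow>\<^sub>0 int) \<Rightarrow> 'k::field felem \<Rightarrow> ('n, 'k) mpol felem" where
  "rehom \<delta> g v = Poly_Mapping.mapp (\<lambda>k. single (expo_of (g - \<delta> k))) v"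

lemma coeff_rehom: "coeff (rehom \<delta> g v) k = single (expo_of (g - \<delta> k)) (coeff v k)"
  by (auto simp: rehom_def lookup_mapp when_def in_keys_iff)

lemma dehom_rehom [simp]: "dehom (rehom \<delta> g v) = v"
  by (rule poly_mapping_eqI) (simp add: coeff_rehom)

lemma rehom_free_part: "v \<in> free_part r i \<Longrightarrow> rehom \<delta> g v \<in> free_part r i"
  by (simp add: in_free_part_iff coeff_rehom)

interpretation fine: graded_local fine_component "degree_part fine_degree" vars_ideal
  by (rule fine_graded_local)

lemma rehom_homog:
  assumes "\<And>k. k \<in> keys v \<Longrightarrow> nonneg (g - \<delta> k)"
  shows "rehom \<delta> g v \<in> fine.homog \<delta> g"
proof (rule fine.homogI)
  fix k
  show "coeff (rehom \<delta> g v) k \<in> fine_component (g - \<delta> k)"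
  proof (cases "k \<in> keys v")
    case True
    then show ?thesis
      unfolding coeff_rehom by (intro single_in_fine_component fine_degree_expo_of assms)
  next
    case False
    then show ?thesis
      by (simp add: coeff_rehom in_keys_iff)
  qed
qed

lemma dehom_inject:
  assumes "x \<in> fine.homog \<delta> g" "y \<in> fine.homog \<delta> g" "dehom x = dehom y"
  shows "x = y"
proof (rule poly_mapping_eqI)
  fix k
  have "at_one (coeff x k) = at_one (coeff y k)"
    using assms(3) by (metis coeff_dehom)
  then show "coeff x k = coeff y k"
    using fine.homogD[OF assms(1)] fine.homogD[OF assms(2)] by (intro at_one_inject)
qed

text \<open>Setting the variables to 1 turns the resolution into a complex over the field. It is exact: the
  degrees of the basis elements are bounded by that of the monomial \<open>\<mu>\<close>, so each cycle lifts to a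
  homogeneous element of degree \<open>\<mu>\<close>, which is a cycle by the injectivity of dehomogenisation and
  hence a boundary; in degree 0 the complex resolves the zero module since \<open>\<mu>\<close> becomes 1. So the
  general construction with \<open>q = 1\<close> gives a square-zero homotopy \<open>h\<close> over the field. The matrix entry
  of \<open>h\<close> from the basis element \<open>j\<close> to the basis element \<open>k\<close> is made homogeneous of degree \<open>\<mu>\<close> by the
  monomial with exponent \<open>\<delta> j + \<mu> - \<delta> k\<close>, and this is a polynomial because
  \<open>\<delta> j \<ge> 0\<close> and \<open>\<mu> \<ge> \<delta> k\<close>.\<close>

theorem fine_square_zero_homotopy:
  fixes d :: "('n::finite, 'k::field) mpol felem \<Rightarrow> ('n, 'k) mpol felem"
  assumes res: "free_resolution I r d" and lin: "linear_map d"
    and graded: "\<And>i j. j < r i \<Longrightarrow> d (basis (i, j)) \<in> fine.homog \<delta> (\<delta> (i, j))"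
    and m: "monomial \<mu> \<in> I"
    and bounds: "\<And>i j. j < r i \<Longrightarrow> nonneg (\<delta> (i, j))" "\<And>i j. j < r i \<Longrightarrow> nonneg (fine_degree \<mu> - \<delta> (i, j))"
  shows "\<exists>H. square_zero_homotopy r d (monomial \<mu>) H \<and>
    (\<forall>i. \<forall>j<r i. H (basis (i, j)) \<in> fine.homog \<delta> (\<delta> (i, j) + fine_degree \<mu>))"
proof -
  note D = free_resolutionD[OF res]
  let ?\<sigma> = "fine_degree \<mu>"
  define c where "c = lin_ext (\<lambda>k. dehom (d (basis k)))"
  have lin_c: "linear_map c"
    by (simp add: c_def linear_lin_ext)
  have c: "dehom (d x) = c (dehom x)" for x
    by (rule dehom_linear[OF lin lin_c]) (simp add: c_def)
  have m1: "at_one (monomial \<mu> :: ('n, 'k) mpol) = 1"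
    by (simp add: monomial_def)
  have c_part: "c x \<in> free_part r i" if "x \<in> free_part r (Suc i)" for x i
    by (rule linear_free_part_into[OF lin_c _ subspace_free_part that])
      (simp add: c_def dehom_free_part D(3) basis_in_free_part)
  have c0: "c x = 0" if "x \<in> free_part r 0" for x
    by (rule linear_eq_on_free_part[OF lin_c linear_0 _ that])
      (simp add: c_def D(2) basis_in_free_part)
  have cc: "c (c x) = 0" if "x \<in> free_part r (Suc i)" for x i
  proof (rule linear_eq_on_free_part[OF linear_comp[OF lin_c lin_c] linear_0 _ that])
    fix j assume "j < r (Suc i)"
    then have "dehom (d (d (basis (Suc i, j)))) = 0"
      using D(6)[of "basis (Suc i, j)" i] by (simp add: basis_in_free_part)
    then show "c (c (basis (Suc i, j))) = 0"
      by (simp add: c)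
  qed
  have hom_d: "d x \<in> fine.homog \<delta> g" if x: "x \<in> free_part r i" "x \<in> fine.homog \<delta> g" for x i g
  proof -
    have "d (basis k) \<in> fine.homog \<delta> (\<delta> k + 0)" if k: "k \<in> keys x" for k
    proof -
      obtain j where "k = (i, j)" "j < r i"
        using keys_free_part[OF x(1) k] .
      then show ?thesis
        using graded by simp
    qed
    from fine.linear_homog[OF lin this x(2)] show ?thesis by simp
  qed
  have exact_c: "v \<in> c ` free_part r (Suc (Suc i))" if v: "v \<in> free_part r (Suc i)" "c v = 0" for v i
  proof -
    \<comment> \<open>The degree \<open>?\<sigma>\<close> is large enough for a homogeneous lift of every vector.\<close>
    let ?x = "rehom \<delta> ?\<sigma> v"
    have x: "?x \<in> free_part r (Suc i)"
      by (rule rehom_free_part) (rule v)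
    have xh: "?x \<in> fine.homog \<delta> ?\<sigma>"
    proof (rule rehom_homog)
      fix k assume k: "k \<in> keys v"
      obtain j where "k = (Suc i, j)" "j < r (Suc i)"
        using keys_free_part[OF v(1) k] .
      then show "nonneg (?\<sigma> - \<delta> k)"
        using bounds(2) by simp
    qed
    have "d ?x = 0"
    proof (rule dehom_inject)
      show "d ?x \<in> fine.homog \<delta> ?\<sigma>"
        by (rule hom_d[OF x xh])
      show "0 \<in> fine.homog \<delta> ?\<sigma>"
        by (simp add: fine.homog_def)
      show "dehom (d ?x) = dehom 0"
        using v(2) by (simp add: c)
    qed
    then obtain y where y: "y \<in> free_part r (Suc (Suc i))" "?x = d y"
      using D(5)[OF x] by blast
    then have "v = c (dehom y)"
      by (metis c dehom_rehom)
    then show ?thesis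
      using dehom_free_part[OF y(1)] by blast
  qed
  have res_c: "free_resolution UNIV r c"
    unfolding free_resolution_def
  proof (intro conjI allI ballI)
    show "r 0 = 1" by (rule D(1))
    show "linear_over (free_sum r) c" by (rule linear_over_linear_map[OF lin_c])
    show "c ` free_part r (Suc i) \<subseteq> free_part r i" for i
      using c_part by blast
    show "{x \<in> free_part r (Suc i). c x = 0} = c ` free_part r (Suc (Suc i))" for i
      using exact_c c_part[of _ "Suc i"] cc[of _ "Suc i"] by blast
    show "c ` free_part r 1 = of_ring ` UNIV"
    proof
      show "c ` free_part r 1 \<subseteq> range of_ring"
      proof
        fix y assume "y \<in> c ` free_part r 1"
        then have "y \<in> free_part r 0"
          using c_part[of _ 0] by auto
        then have "y = of_ring (coeff y (0, 0))"
          using D(1) by (intro free_part_0[of r])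
        then show "y \<in> range of_ring"
          by (rule range_eqI)
      qed
      show "range of_ring \<subseteq> c ` free_part r 1"
      proof
        fix y :: "'k felem" assume "y \<in> range of_ring"
        then obtain a where a: "y = of_ring a" by blast
        have "of_ring (monomial \<mu>) \<in> d ` free_part r 1"
          using D(4) m by blast
        then obtain x where x: "x \<in> free_part r 1" "d x = of_ring (monomial \<mu>)"
          by (metis imageE)
        have "c (dehom x) = of_ring 1"
          using x(2) by (simp add: dehom_of_ring m1 flip: c)
        then have "c (smult a (dehom x)) = y"
          by (simp add: linear_smult[OF lin_c] a)
        moreover have "smult a (dehom x) \<in> free_part r 1"
          by (intro felem.subspace_scale subspace_free_part dehom_free_part x)
        ultimately show "y \<in> c ` free_part r 1" by blast
      qed
    qed
  qed (rule c0)
  obtain h where h: "square_zero_homotopy r c (1 * 1) h"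
    using square_zero_homotopy_exists[OF res_c lin_c, of 1] by blast
  then have lin_h: "linear_map h"
    and h_part: "\<And>x i. x \<in> free_part r i \<Longrightarrow> h x \<in> free_part r (Suc i)"
    and h_hom: "\<And>x i. x \<in> free_part r i \<Longrightarrow> c (h x) + h (c x) = x"
    and hh: "\<And>x i. x \<in> free_part r i \<Longrightarrow> h (h x) = 0"
    by (auto simp: square_zero_homotopy_def)
  define H where "H = lin_ext (\<lambda>k. rehom \<delta> (\<delta> k + ?\<sigma>) (h (basis k)))"
  have lin_H: "linear_map H"
    by (simp add: H_def linear_lin_ext)
  have H: "dehom (H x) = h (dehom x)" for x
    by (rule dehom_linear[OF lin_H lin_h]) (simp add: H_def)
  have H_homog: "H (basis (i, j)) \<in> fine.homog \<delta> (\<delta> (i, j) + ?\<sigma>)" if j: "j < r i" for i j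
    unfolding H_def lin_ext_basis
  proof (rule rehom_homog)
    fix k assume k: "k \<in> keys (h (basis (i, j)))"
    have "h (basis (i, j)) \<in> free_part r (Suc i)"
      by (rule h_part) (simp add: basis_in_free_part j)
    then obtain l where l: "k = (Suc i, l)" "l < r (Suc i)"
      using k by (rule keys_free_part)
    show "nonneg (\<delta> (i, j) + ?\<sigma> - \<delta> k)"
      unfolding nonneg_def
    proof
      fix t
      have "0 \<le> lookup (\<delta> (i, j)) t" "0 \<le> lookup (?\<sigma> - \<delta> k) t"
        using bounds(1)[OF j] bounds(2)[OF l(2)] l(1) by (auto simp: nonneg_def)
      then show "0 \<le> lookup (\<delta> (i, j) + ?\<sigma> - \<delta> k) t"
        unfolding lookup_add lookup_minus by linarith
    qed
  qed
  \<comment> \<open>The identities for \<open>H\<close> are checked on basis elements, where both sides are homogeneous of the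
    same degree, so it suffices to compare them after setting the variables to 1.\<close>
  have H_part: "H x \<in> free_part r (Suc i)" if "x \<in> free_part r i" for x i
    by (rule linear_free_part_into[OF lin_H _ subspace_free_part that])
      (simp add: H_def rehom_free_part h_part basis_in_free_part)
  have hom_H: "H x \<in> fine.homog \<delta> (g + ?\<sigma>)" if x: "x \<in> free_part r i" "x \<in> fine.homog \<delta> g" for x i g
  proof (rule fine.linear_homog[OF lin_H _ x(2)])
    fix k assume k: "k \<in> keys x"
    obtain j where "k = (i, j)" "j < r i"
      using keys_free_part[OF x(1) k] .
    then show "H (basis k) \<in> fine.homog \<delta> (\<delta> k + ?\<sigma>)"
      using H_homog by simp
  qed
  have "square_zero_homotopy r d (monomial \<mu>) H"
    unfolding square_zero_homotopy_def
  proof (intro conjI allI ballI lin_H)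
    fix i and x :: "('n, 'k) mpol felem" assume x: "x \<in> free_part r i"
    show "H x \<in> free_part r (Suc i)"
      by (rule H_part[OF x])
    show "H (H x) = 0"
    proof (rule linear_eq_on_free_part[OF linear_comp[OF lin_H lin_H] linear_0 _ x])
      fix j assume j: "j < r i"
      have b: "basis (i, j) \<in> free_part r i"
        using j by (simp add: basis_in_free_part)
      show "H (H (basis (i, j))) = 0"
      proof (rule dehom_inject)
        show "H (H (basis (i, j))) \<in> fine.homog \<delta> (\<delta> (i, j) + ?\<sigma> + ?\<sigma>)"
          by (rule hom_H[OF H_part[OF b] H_homog[OF j]])
        show "dehom (H (H (basis (i, j)))) = dehom 0"
          using hh[of "basis (i, j)" i] j by (simp add: H basis_in_free_part)
      qed (simp add: fine.homog_def)
    qed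
    show "d (H x) + H (d x) = smult (monomial \<mu>) x"
    proof (rule linear_eq_on_free_part[OF _ _ _ x])
      show "linear_map (\<lambda>x. d (H x) + H (d x))"
        by (rule linear_plus[OF linear_comp[OF lin lin_H] linear_comp[OF lin_H lin]])
      show "linear_map (smult (monomial \<mu>) :: ('n, 'k) mpol felem \<Rightarrow> _)"
        by (rule linear_scale[OF linear_id])
      fix j assume j: "j < r i"
      let ?b = "basis (i, j) :: ('n, 'k) mpol felem"
      have b: "?b \<in> free_part r i"
        using j by (simp add: basis_in_free_part)
      have 1: "d (H ?b) \<in> fine.homog \<delta> (\<delta> (i, j) + ?\<sigma>)"
        by (rule hom_d[OF H_part[OF b] H_homog[OF j]])
      have 2: "H (d ?b) \<in> fine.homog \<delta> (\<delta> (i, j) + ?\<sigma>)"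
      proof (cases i)
        case 0
        then show ?thesis
          using b D(2) by (simp add: linear_zero[OF lin_H] fine.homog_def)
      next
        case (Suc n)
        have "d ?b \<in> free_part r n"
          using b D(3) unfolding Suc by blast
        then show ?thesis
          using graded[OF j] by (rule hom_H)
      qed
      have 3: "smult (monomial \<mu>) ?b \<in> fine.homog \<delta> (\<delta> (i, j) + ?\<sigma>)"
      proof (rule fine.homogI)
        fix k
        show "coeff (smult (monomial \<mu>) ?b) k \<in> fine_component (\<delta> (i, j) + ?\<sigma> - \<delta> k)"
          by (cases "k = (i, j)") (auto simp: coeff_basis monomial_def intro: single_in_fine_component)
      qed
      have "d (H ?b) + H (d ?b) \<in> fine.homog \<delta> (\<delta> (i, j) + ?\<sigma>)"
        by (intro fine.homog_add 1 2)
      from this 3 show "d (H ?b) + H (d ?b) = smult (monomial \<mu>) ?b"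
      proof (rule dehom_inject)
        show "dehom (d (H ?b) + H (d ?b)) = dehom (smult (monomial \<mu>) ?b)"
          using h_hom[of "basis (i, j)" i] j by (simp add: dehom_add c H dehom_smult m1 basis_in_free_part)
      qed
    qed
  qed
  with H_homog show ?thesis by blast
qed

section \<open>Monomial ideals\<close>

lemma monomial_add: "monomial (u + v) = monomial u * monomial v"
  by (simp add: monomial_def mult_single)

lemma monomial_neq_0 [simp]: "monomial u \<noteq> 0"
  by (metis lookup_single_eq lookup_zero monomial_def zero_neq_one)

lemma ex_expo_quotient:
  assumes "divides_expo v u"
  obtains w where "u = w + v"
proof -
  have "u = (u - v) + v"
    by (rule poly_mapping_eqI) (use assms in \<open>simp add: lookup_add lookup_minus\<close>)
  then show thesis by (rule that)
qed

lemma monomial_dvd_iff: "(monomial v :: ('n, 'k::field) mpol) dvd monomial u \<longleftrightarrow> divides_expo v u"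
proof
  assume "divides_expo v u"
  then obtain w where "u = w + v"
    by (rule ex_expo_quotient)
  then show "(monomial v :: ('n, 'k) mpol) dvd monomial u"
    by (simp add: monomial_add)
next
  assume "(monomial v :: ('n, 'k) mpol) dvd monomial u"
  then obtain g :: "('n, 'k) mpol" where g: "monomial u = monomial v * g" ..
  have "u \<in> keys (monomial u :: ('n, 'k) mpol)"
    by (simp add: monomial_def)
  then obtain w where "u = v + w"
    using keys_mult[of "monomial v" g] unfolding g by (auto simp: monomial_def)
  then show "divides_expo v u"
    by (simp add: lookup_add)
qed

lemma min_gens_eq:
  "min_gens (I :: ('n::finite, 'k::field) mpol set) =
     {u\<in>{u. monomial u \<in> I}. \<forall>v\<in>{u. monomial u \<in> I}. divides_expo v u \<longrightarrow> v = u}"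
  by (auto simp: min_gens_def monomial_dvd_iff)

lemma ex_min_gen_dividing:
  fixes I :: "('n::finite, 'k::field) mpol set"
  assumes "monomial u \<in> I"
  obtains v where "v \<in> min_gens I" "divides_expo v u"
  using ex_minimal_divisor[of u "{u. monomial u \<in> I}"] assms by (auto simp: min_gens_eq)

lemma finite_min_gens: "finite (min_gens (I :: ('n::finite, 'k::field) mpol set))"
  unfolding min_gens_eq by (rule finite_minimal_exponents)

lemma divides_lcm_exponent:
  assumes "finite U" "v \<in> U"
  shows "divides_expo v (lcm_exponent U)"
proof
  fix i
  have "lookup (lcm_exponent U) i = (SUP u\<in>U. lookup u i)"
    unfolding lcm_exponent_def by (subst lookup_Abs_poly_mapping) auto
  moreover have "lookup v i \<le> (SUP u\<in>U. lookup u i)"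
    using assms by (intro cSUP_upper) auto
  ultimately show "lookup v i \<le> lookup (lcm_exponent U) i"
    by simp
qed

lemma gens_lcm_in_ideal:
  fixes I :: "('n::finite, 'k::field) mpol set"
  assumes I: "is_ideal I" and u: "monomial u \<in> I"
  shows "gens_lcm I \<in> I"
proof -
  obtain v where v: "v \<in> min_gens I" "divides_expo v u"
    using ex_min_gen_dividing[OF u] .
  obtain w where "lcm_exponent (min_gens I) = w + v"
    using divides_lcm_exponent[OF finite_min_gens v(1)] by (rule ex_expo_quotient)
  moreover have "monomial v \<in> I"
    using v(1) by (simp add: min_gens_def)
  ultimately show ?thesis
    using is_idealD(4)[OF I] by (simp add: gens_lcm_def monomial_add)
qed

lemma single_multiple_of_variable:
  fixes p :: "('n::finite, 'k::field) mpol"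
  assumes "p \<in> fine_component g" "lookup g t > 0"
  shows "\<exists>a. p = monomial (single t 1) * a"
proof (cases "p = 0")
  case False
  obtain u c where u: "g = fine_degree u" "p = single u c"
    using fine_component_nonneg[OF assms(1) False] by metis
  then have "divides_expo (single t 1) u"
    using assms(2) by (auto simp: lookup_single when_def)
  then obtain w where "u = w + single t 1"
    by (rule ex_expo_quotient)
  then have "p = monomial (single t 1) * single w c"
    by (simp add: u monomial_def mult_single add.commute)
  then show ?thesis ..
qed (auto intro: exI[of _ 0])

text \<open>Let \<open>w\<close> be the boundary of a basis element \<open>b\<close>. If the degree of \<open>b\<close> exceeds the least common
  multiple in the variable \<open>x\<^sub>t\<close>, then \<open>w = x\<^sub>t d y\<close> for some \<open>y\<close>. In higher homological degrees
  all coefficients of \<open>w\<close> are divisible by \<open>x\<^sub>t\<close>, as the basis elements one degree lower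
  satisfy the bound, and the quotient of \<open>w\<close> by \<open>x\<^sub>t\<close> is again a cycle. In degree 1, \<open>w\<close> is a
  scalar multiple of a monomial of \<open>I\<close> that stays in \<open>I\<close> when divided by \<open>x\<^sub>t\<close>.
  Now \<open>b - x\<^sub>t y\<close> is a cycle whose coefficient at \<open>b\<close> is 1 modulo the variables, against minimality. The lower bound holds because
  \<open>w\<close> has a nonzero coefficient.\<close>

theorem fine_degree_bounds:
  fixes I :: "('n::finite, 'k::field) mpol set"
  assumes res: "free_resolution I r d" and lin: "linear_map d" and I: "is_ideal I"
    and graded: "\<And>i j. j < r i \<Longrightarrow> d (basis (i, j)) \<in> fine.homog \<delta> (\<delta> (i, j))"
    and \<delta>0: "\<delta> (0, 0) = 0"
    and minimal: "\<And>i x k. x \<in> free_part r (Suc i) \<Longrightarrow> d x = 0 \<Longrightarrow> coeff x k \<in> vars_ideal"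
    and j: "j < r i"
  shows "nonneg (\<delta> (i, j)) \<and> nonneg (fine_degree (lcm_exponent (min_gens I)) - \<delta> (i, j))"
  using j
proof (induction i arbitrary: j)
  case 0
  then have "j = 0"
    using free_resolutionD(1)[OF res] by simp
  then show ?case
    by (simp add: \<delta>0 nonneg_def)
next
  case (Suc i)
  note D = free_resolutionD[OF res]
  let ?\<mu> = "lcm_exponent (min_gens I)"
  let ?b = "basis (Suc i, j) :: ('n, 'k) mpol felem"
  define w where "w = d ?b"
  have b: "?b \<in> free_part r (Suc i)"
    using Suc.prems by (simp add: basis_in_free_part)
  have w: "w \<in> free_part r i" "w \<in> fine.homog \<delta> (\<delta> (Suc i, j))"
    using D(3)[OF b] graded[OF Suc.prems] by (auto simp: w_def)
  have not_unit: "(1 :: ('n, 'k) mpol) \<notin> vars_ideal"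
    by (simp add: vars_ideal_eq)
  have M: "is_ideal (vars_ideal :: ('n, 'k) mpol set)"
    by (rule fine.M)
  have "w \<noteq> 0"
  proof
    assume "w = 0"
    then have "coeff ?b (Suc i, j) \<in> vars_ideal"
      by (intro minimal[OF b]) (simp add: w_def)
    then show False
      using not_unit by simp
  qed
  have key: "\<exists>l u c. k = (i, l) \<and> l < r i \<and> \<delta> (Suc i, j) - \<delta> (i, l) = fine_degree u \<and>
      coeff w k = single u c \<and> c \<noteq> 0" if k: "k \<in> keys w" for k
  proof -
    obtain l where l: "k = (i, l)" "l < r i"
      using keys_free_part[OF w(1) k] .
    have "coeff w k \<in> fine_component (\<delta> (Suc i, j) - \<delta> k)" "coeff w k \<noteq> 0"
      using fine.homogD[OF w(2)] k by (auto simp: in_keys_iff)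
    then show ?thesis
      using l fine_component_nonneg by metis
  qed
  have "keys w \<noteq> {}"
    using \<open>w \<noteq> 0\<close> by (auto simp: poly_mapping_eq_iff fun_eq_iff in_keys_iff)
  then obtain k0 where k0: "k0 \<in> keys w" by blast
  obtain l0 u0 where l0: "l0 < r i" "\<delta> (Suc i, j) - \<delta> (i, l0) = fine_degree u0"
    using key[OF k0] by blast
  have "0 \<le> lookup (\<delta> (Suc i, j)) t" for t
  proof -
    have "lookup (\<delta> (Suc i, j)) t - lookup (\<delta> (i, l0)) t = int (lookup u0 t)"
      using arg_cong[OF l0(2), of "\<lambda>g. lookup g t"] by (simp add: lookup_minus)
    moreover have "0 \<le> lookup (\<delta> (i, l0)) t"
      using Suc.IH[OF l0(1)] by (simp add: nonneg_def)
    ultimately show ?thesis by linarith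
  qed
  moreover have "lookup (\<delta> (Suc i, j)) t \<le> int (lookup ?\<mu> t)" for t
  proof (rule ccontr)
    assume "\<not> ?thesis"
    then have big: "int (lookup ?\<mu> t) < lookup (\<delta> (Suc i, j)) t"
      by simp
    let ?X = "monomial (single t 1) :: ('n, 'k) mpol"
    have "\<exists>y\<in>free_part r (Suc i). w = smult ?X (d y)"
    proof (cases i)
      case 0
      have "w \<in> of_ring ` I"
        using D(4) b unfolding w_def 0 by auto
      then obtain p where p: "p \<in> I" "w = of_ring p" by blast
      obtain u c where u: "\<delta> (Suc i, j) = fine_degree u" "p = single u c" "c \<noteq> 0"
      proof -
        have "p \<in> fine_component (\<delta> (Suc i, j))" "p \<noteq> 0"
          using fine.homogD[OF w(2), of "(0, 0)"] \<delta>0 p(2) \<open>w \<noteq> 0\<close> by auto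
        then show thesis
          using that fine_component_nonneg by metis
      qed
      have "monomial u = single 0 (inverse c) * p"
        using u by (simp add: monomial_def mult_single)
      then have "monomial u \<in> I"
        using is_idealD(4)[OF I p(1)] by simp
      then obtain v where v: "v \<in> min_gens I" "divides_expo v u"
        by (rule ex_min_gen_dividing)
      have "lookup v t \<le> lookup ?\<mu> t"
        using divides_lcm_exponent[OF finite_min_gens v(1)] by blast
      then have "lookup v t < lookup u t"
        using big unfolding u(1) by simp
      then have "divides_expo (single t 1 + v) u"
        using v(2) by (auto simp: lookup_add lookup_single when_def Suc_le_eq)
      then obtain z where z: "u = z + (single t 1 + v)"
        by (rule ex_expo_quotient)
      define p' where "p' = single z c * monomial v"
      have "p = ?X * p'"
        by (simp add: u(2) z p'_def monomial_def mult_single ac_simps)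
      moreover have "p' \<in> I"
        unfolding p'_def using v(1) by (intro is_idealD(4)[OF I]) (simp add: min_gens_def)
      then have "of_ring p' \<in> d ` free_part r 1"
        unfolding D(4) by (rule imageI)
      then obtain y where "y \<in> free_part r 1" "d y = of_ring p'"
        by (metis imageE)
      ultimately show ?thesis
        using 0 p(2) by (intro bexI[of _ y]) simp_all
    next
      case (Suc n)
      have "\<exists>a. coeff w k = ?X * a" if k: "k \<in> keys w" for k
      proof -
        obtain l where l: "k = (i, l)" "l < r i"
          using key[OF k] by blast
        have "lookup (\<delta> (i, l)) t \<le> int (lookup ?\<mu> t)"
          using Suc.IH[OF l(2)] by (simp add: nonneg_def lookup_minus)
        then have "0 < lookup (\<delta> (Suc i, j) - \<delta> k) t"
          using big unfolding l(1) lookup_minus by linarith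
        then show ?thesis
          by (rule single_multiple_of_variable[OF fine.homogD[OF w(2)]])
      qed
      then obtain a where a: "\<And>k. k \<in> keys w \<Longrightarrow> coeff w k = ?X * a k"
        by metis
      define z where "z = (\<Sum>k\<in>keys w. smult (a k) (basis k))"
      have "w = (\<Sum>k\<in>keys w. smult (coeff w k) (basis k))"
        by (rule felem_expand)
      also have "\<dots> = smult ?X z"
        unfolding z_def felem.scale_sum_right by (intro sum.cong refl) (simp add: a)
      finally have wz: "w = smult ?X z" .
      have z: "z \<in> free_part r (Suc n)"
        unfolding z_def
      proof (intro felem.subspace_sum[OF subspace_free_part] felem.subspace_scale[OF subspace_free_part])
        fix k assume "k \<in> keys w"
        then show "basis k \<in> free_part r (Suc n)"
          using key[of k] Suc by (auto simp: basis_in_free_part)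
      qed
      have "smult ?X (d z) = 0"
        using D(6)[OF b] wz by (simp add: w_def linear_smult[OF lin])
      then have "?X * coeff (d z) k = 0" for k
        by (metis lookup_smult lookup_zero)
      then have "coeff (d z) k = 0" for k
        using mpol_no_zero_divisors[of ?X "coeff (d z) k"] by auto
      then have "d z = 0"
        by (intro poly_mapping_eqI) simp
      then obtain y where "y \<in> free_part r (Suc (Suc n))" "z = d y"
        using D(5)[OF z] by blast
      then show ?thesis
        using wz Suc by blast
    qed
    then obtain y where y: "y \<in> free_part r (Suc i)" "w = smult ?X (d y)"
      by blast
    have "?b - smult ?X y \<in> free_part r (Suc i)"
      using b y(1) by (intro felem.subspace_diff felem.subspace_scale subspace_free_part)
    moreover have "d (?b - smult ?X y) = 0"
      using y(2) by (simp add: linear_diff[OF lin] linear_smult[OF lin] w_def)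
    ultimately have "coeff (?b - smult ?X y) (Suc i, j) \<in> vars_ideal"
      by (rule minimal)
    moreover have "?X * coeff y (Suc i, j) \<in> vars_ideal"
    proof -
      have "?X \<in> vars_ideal"
        unfolding vars_ideal_def ideal_gen_def by (intro module.span_base[OF module_mult]) blast
      then show ?thesis
        by (rule is_idealD(5)[OF M])
    qed
    ultimately have "coeff (?b - smult ?X y) (Suc i, j) + ?X * coeff y (Suc i, j) \<in> vars_ideal"
      by (rule is_idealD(2)[OF M])
    then show False
      using not_unit by (simp add: lookup_minus)
  qed
  ultimately show ?case
    by (simp add: nonneg_def lookup_minus)
qed

section \<open>Resolutions of multiples of monomial ideals\<close>

lemma fine_component_cancel_monomial:
  fixes a :: "('n::finite, 'k::field) mpol"
  assumes "monomial \<mu> * a \<in> fine_component g"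
  shows "a \<in> fine_component (g - fine_degree \<mu>)"
  unfolding fine_component_eq degree_component_def
proof (intro CollectI ballI)
  fix u assume u: "u \<in> keys a"
  have "lookup (monomial \<mu> * a) (\<mu> + u) = lookup a u"
    using u by (simp add: lookup_times monomial_def sum.delta)
  then have "\<mu> + u \<in> keys (monomial \<mu> * a)"
    using u by (simp add: in_keys_iff)
  then have "fine_degree (\<mu> + u) = g"
    using assms by (simp add: fine_component_eq degree_component_def)
  then show "fine_degree u = g - fine_degree \<mu>"
    by (auto simp: fine_degree_add)
qed

lemma monomial_ideal_closed:
  assumes "monomial_ideal (I :: ('n::finite, 'k::field) mpol set)" "a \<in> I"
  shows "degree_part fine_degree g a \<in> I"
proof -
  obtain U where U: "I = ideal_gen (monomial ` U)"
    using assms(1) by (auto simp: monomial_ideal_def)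
  show ?thesis
    using assms(2) unfolding U
    by (rule fine.homogeneous_ideal_closed[rotated])
      (auto simp: monomial_def intro: single_in_fine_component)
qed

lemma monomial_ideal_cases:
  fixes I :: "('n::finite, 'k::field) mpol set"
  assumes "monomial_ideal I"
  obtains "I = {0}" | u where "monomial u \<in> I"
proof -
  obtain U where U: "I = ideal_gen (monomial ` U)"
    using assms by (auto simp: monomial_ideal_def)
  show thesis
  proof (cases "U = {}")
    case True
    then show thesis
      using that(1) by (simp add: U ideal_gen_def module.span_empty[OF module_mult])
  next
    case False
    then obtain u where "u \<in> U" by blast
    then have "monomial u \<in> I"
      unfolding U ideal_gen_def by (intro module.span_base[OF module_mult]) simp
    then show thesis by (rule that(2))
  qed
qed

lemma is_ideal_monomial_ideal: "monomial_ideal I \<Longrightarrow> is_ideal I"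
  by (auto simp: monomial_ideal_def is_ideal_def ideal_gen_def module.subspace_span[OF module_mult])

text \<open>The degree of the least common multiple is subtracted from the degrees of all basis elements of
  positive homological degree, so that the divided differential becomes homogeneous of degree 0.
  Its kernels are those of the original differential, so minimality in the form needed for
  \<open>fine_degree_bounds\<close> is inherited. For the zero ideal all products of elements of positive degree are zero.\<close>

lemma fine_dga:
  fixes I :: "('n::finite, 'k::field) mpol set"
  assumes mono: "monomial_ideal I"
    and gr: "graded_minimal_free_resolution fine_component vars_ideal ((*) (gens_lcm I) ` I) r \<delta> d"
    and lin: "linear_map d"
  shows "\<exists>m. dga_structure r d m \<and> graded_mult fine_component r \<delta> m"
proof -
  have I: "is_ideal I"
    by (rule is_ideal_monomial_ideal[OF mono])
  have min: "minimal_free_resolution vars_ideal ((*) (gens_lcm I) ` I) r d" and \<delta>0: "\<delta> (0, 0) = 0"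
    using gr by (auto simp: graded_minimal_free_resolution_def)
  then have res: "free_resolution ((*) (gens_lcm I) ` I) r d"
    by (simp add: minimal_free_resolution_def)
  note D = free_resolutionD[OF res]
  from mono show ?thesis
  proof (cases rule: monomial_ideal_cases)
    case 1
    have "free_resolution {0} r d"
      using res unfolding 1 by simp
    from dga_of_zero_ideal[OF this lin]
    have "dga_structure r d (dga_mult (\<lambda>_. 0) (\<lambda>_. 0))" .
    moreover have "graded_mult fine_component r \<delta> (dga_mult (\<lambda>_. 0) (\<lambda>_. 0))"
      by (rule fine.graded_dga_mult[where \<sigma> = 0])
        (simp_all only: D(1) \<delta>0 fine.homog_zero fine.C_zero felem.subspace_0[OF subspace_free_sum])
    ultimately show ?thesis
      by (intro exI[of _ "dga_mult (\<lambda>_. 0) (\<lambda>_. 0)"]) simp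
  next
    case (2 u)
    define \<mu> where "\<mu> = lcm_exponent (min_gens I)"
    have lcm: "gens_lcm I = monomial \<mu>"
      by (simp add: gens_lcm_def \<mu>_def)
    let ?\<sigma> = "fine_degree \<mu>" and ?m = "monomial \<mu> :: ('n, 'k) mpol"
    have mI: "?m \<in> I"
      using gens_lcm_in_ideal[OF I 2] by (simp add: lcm)
    note res' = res[unfolded lcm]
    have inj: "a = 0" if "a \<in> I" "?m * a = 0" for a
      using mpol_no_zero_divisors[of ?m a] that(2) by auto
    define d' where "d' = rescaled ?m I d"
    note R = rescaled_eq[OF res' lin I, folded d'_def]
    have lin': "linear_map d'"
      by (simp add: d'_def linear_rescaled)
    have resR: "free_resolution I r d'"
      unfolding d'_def by (rule free_resolution_rescaled[OF res' lin I]) (rule inj)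
    define \<delta>' where "\<delta>' k = (if fst k = 0 then 0 else \<delta> k - ?\<sigma>)" for k :: "nat \<times> nat"
    have \<delta>'0: "\<delta>' (0, 0) = 0"
      by (simp add: \<delta>'_def)
    have shift: "x \<in> fine.homog \<delta> (g + ?\<sigma>) \<longleftrightarrow> x \<in> fine.homog \<delta>' g"
      if x: "x \<in> free_part r (Suc i)" for x i g
    proof -
      have "coeff x k \<in> fine_component (g + ?\<sigma> - \<delta> k) \<longleftrightarrow> coeff x k \<in> fine_component (g - \<delta>' k)" for k
      proof (cases "fst k = Suc i")
        case True
        then show ?thesis by (simp add: \<delta>'_def algebra_simps)
      next
        case False
        then show ?thesis by (simp add: coeff_free_part_other[OF x])
      qed
      then show ?thesis
        by (simp only: fine.homog_def mem_Collect_eq)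
    qed
    have graded': "d' (basis (i, j)) \<in> fine.homog \<delta>' (\<delta>' (i, j))" if j: "j < r i" for i j
    proof -
      have b: "(basis (i, j) :: ('n, 'k) mpol felem) \<in> free_part r i"
        using j by (simp add: basis_in_free_part)
      have g: "d (basis (i, j)) \<in> fine.homog \<delta> (\<delta> (i, j))"
        by (rule fine.graded_basis[OF gr j])
      consider "i = 0" | "i = Suc 0" | n where "i = Suc (Suc n)"
        using not0_implies_Suc by metis
      then show ?thesis
      proof cases
        case 1
        then show ?thesis
          using R(1) b by (simp add: fine.homog_def)
      next
        case 2
        then obtain a where a: "d' (basis (i, j)) = of_ring a"
          using R(2)[of "basis (i, j)"] b by auto
        then have "d (basis (i, j)) = of_ring (?m * a)"
          using R(3)[of "basis (i, j)"] b 2 by simp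
        then have "?m * a \<in> fine_component (\<delta> (i, j))"
          using fine.homogD[OF g, of "(0, 0)"] \<delta>0 by simp
        then have "a \<in> fine_component (\<delta>' (i, j))"
          using fine_component_cancel_monomial 2 by (simp add: \<delta>'_def)
        then show ?thesis
          unfolding a by (intro fine.of_ring_homog \<delta>'0)
      next
        case 3
        then have eq: "d' (basis (i, j)) = d (basis (i, j))" and p: "d (basis (i, j)) \<in> free_part r (Suc n)"
          using R(4) D(3)[of _ "Suc n"] b by auto
        have "\<delta> (i, j) = \<delta>' (i, j) + ?\<sigma>"
          using 3 by (simp add: \<delta>'_def)
        then show ?thesis
          unfolding eq using g shift[OF p] by simp
      qed
    qed
    have minimal': "coeff x k \<in> vars_ideal" if x: "x \<in> free_part r (Suc i)" "d' x = 0" for i x k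
    proof -
      obtain y where y: "y \<in> free_part r (Suc (Suc i))" "x = d' y"
        using free_resolutionD(5)[OF resR x] by blast
      then have "x = d y"
        using R(4) by simp
      then show ?thesis
        using minimal_coeff_in[OF min fine.M y(1)] by simp
    qed
    have bounds: "nonneg (\<delta>' (i, j)) \<and> nonneg (?\<sigma> - \<delta>' (i, j))" if "j < r i" for i j
      unfolding \<mu>_def
      by (rule fine_degree_bounds[OF resR lin' I graded' \<delta>'0 minimal' that])
    obtain H where H: "square_zero_homotopy r d' ?m H"
      "\<And>i j. j < r i \<Longrightarrow> H (basis (i, j)) \<in> fine.homog \<delta>' (\<delta>' (i, j) + ?\<sigma>)"
      using fine_square_zero_homotopy[OF resR lin' graded' mI] bounds by blast
    have lin_H: "linear_map H"
      and H_part: "\<And>x i. x \<in> free_part r i \<Longrightarrow> H x \<in> free_part r (Suc i)"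
      using H(1) by (auto simp: square_zero_homotopy_def)
    let ?mul = "dga_mult (augmentation d') (positive_part H)"
    have dga: "dga_structure r d ?mul"
      unfolding d'_def
      by (rule dga_of_square_zero_homotopy[OF res' lin I]) (use inj H(1) in \<open>auto simp: d'_def\<close>)
    have posH: "positive_part H (basis (i, j)) \<in> free_sum r \<and>
        positive_part H (basis (i, j)) \<in> fine.homog \<delta> (\<delta> (i, j) + ?\<sigma>)" if j: "j < r i" for i j
    proof (cases i)
      case 0
      then show ?thesis
        by (simp add: positive_part_def felem.subspace_0[OF subspace_free_sum] fine.homog_def)
    next
      case (Suc n)
      have b: "(basis (i, j) :: ('n, 'k) mpol felem) \<in> free_part r i"
        using j by (simp add: basis_in_free_part)
      have eq: "positive_part H (basis (i, j)) = H (basis (i, j))"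
        using Suc by (simp add: positive_part_def)
      have "H (basis (i, j)) \<in> free_sum r"
        using H_part[OF b] free_part_subset_sum by blast
      moreover have "\<delta> (i, j) = \<delta>' (i, j) + ?\<sigma>"
        using Suc by (simp add: \<delta>'_def)
      ultimately show ?thesis
        unfolding eq using H(2)[OF j] shift[OF H_part[OF b]] by simp
    qed
    have lin_pos: "linear_map (positive_part H)"
      by (simp add: positive_part_def linear_lin_ext)
    have "graded_mult fine_component r \<delta> ?mul"
    proof (rule fine.graded_dga_mult[where \<sigma> = ?\<sigma>])
      show "r 0 = 1" by (rule D(1))
      show "\<delta> (0, 0) = 0" by (rule \<delta>0)
      fix x :: "('n, 'k) mpol felem" assume x: "x \<in> free_sum r"
      show "positive_part H x \<in> free_sum r"
      proof (rule linear_in_subspace[OF lin_pos subspace_free_sum])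
        fix k assume k: "k \<in> keys x"
        obtain i j where "k = (i, j)" "j < r i"
          using keys_free_sum[OF x k] .
        then show "positive_part H (basis k) \<in> free_sum r"
          using posH by simp
      qed
      fix g assume xg: "x \<in> fine.homog \<delta> g"
      show "positive_part H x \<in> fine.homog \<delta> (g + ?\<sigma>)"
      proof (rule fine.linear_homog[OF lin_pos _ xg])
        fix k assume k: "k \<in> keys x"
        obtain i j where "k = (i, j)" "j < r i"
          using keys_free_sum[OF x k] .
        then show "positive_part H (basis k) \<in> fine.homog \<delta> (\<delta> k + ?\<sigma>)"
          using posH by simp
      qed
      let ?A = "lin_ext (\<lambda>k. if fst k = 1 then d' (basis k) else 0)"
      have "?A x \<in> fine.homog \<delta>' (g + (- ?\<sigma>))"
      proof (rule fine.linear_homog[OF linear_lin_ext _ xg])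
        fix k assume k: "k \<in> keys x"
        obtain i j where ij: "k = (i, j)" "j < r i"
          using keys_free_sum[OF x k] .
        show "?A (basis k) \<in> fine.homog \<delta>' (\<delta> k + (- ?\<sigma>))"
        proof (cases "i = 1")
          case True
          then have "?A (basis k) = d' (basis (i, j))" "\<delta> k + (- ?\<sigma>) = \<delta>' (i, j)"
            using ij by (simp_all add: \<delta>'_def)
          then show ?thesis
            using graded'[OF ij(2)] by simp
        next
          case False
          then show ?thesis
            using ij by (simp add: fine.homog_def)
        qed
      qed
      from fine.homogD[OF this, of "(0, 0)"] show "augmentation d' x \<in> fine_component (g - ?\<sigma>)"
        by (simp add: augmentation_def \<delta>'0)
    qed
    with dga show ?thesis by blast
  qed
qed

lemma gens_lcm_multiple_ideal:
  fixes I :: "('n::finite, 'k::field) mpol set"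
  assumes mono: "monomial_ideal I" and proper: "I \<noteq> UNIV"
  shows "is_ideal ((*) (gens_lcm I) ` I)" and "(*) (gens_lcm I) ` I \<noteq> UNIV"
    and "a \<in> (*) (gens_lcm I) ` I \<Longrightarrow> degree_part fine_degree g a \<in> (*) (gens_lcm I) ` I"
proof -
  have I: "is_ideal I"
    by (rule is_ideal_monomial_ideal[OF mono])
  show "is_ideal ((*) (gens_lcm I) ` I)"
    by (rule is_ideal_times[OF I])
  show "(*) (gens_lcm I) ` I \<noteq> UNIV"
    using times_ideal_subset[OF I] proper by blast
  have "gens_lcm I \<in> fine_component (fine_degree (lcm_exponent (min_gens I)))"
    unfolding gens_lcm_def monomial_def by (rule single_in_fine_component) (rule refl)
  then show "a \<in> (*) (gens_lcm I) ` I \<Longrightarrow> degree_part fine_degree g a \<in> (*) (gens_lcm I) ` I"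
    by (rule fine.homogeneous_multiple_closed[OF _ monomial_ideal_closed[OF mono]])
qed

theorem monomial_fine_dga:
  fixes I :: "('n::finite, 'k::field) mpol set"
  assumes mono: "monomial_ideal I" and proper: "I \<noteq> UNIV"
  shows "graded_mfr_admits_graded_dga fine_component vars_ideal ((*) (gens_lcm I) ` I)"
  unfolding graded_mfr_admits_graded_dga_def
proof (intro conjI allI impI)
  let ?J = "(*) (gens_lcm I) ` I"
  show "\<exists>r \<delta> d. graded_minimal_free_resolution fine_component vars_ideal ?J r \<delta> d"
    by (rule fine.graded_minimal_free_resolution_exists[OF gens_lcm_multiple_ideal[OF mono proper]])
  fix r \<delta> and d :: "('n, 'k) mpol felem \<Rightarrow> ('n, 'k) mpol felem"
  assume gr: "graded_minimal_free_resolution fine_component vars_ideal ?J r \<delta> d"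
  from graded_linear_representative[OF this] obtain D where D: "linear_map D" "\<And>x. x \<in> free_sum r \<Longrightarrow> D x = d x"
    "graded_minimal_free_resolution fine_component vars_ideal ?J r \<delta> D"
    by blast
  then obtain m where m: "dga_structure r D m" "graded_mult fine_component r \<delta> m"
    using fine_dga[OF mono D(3,1)] by blast
  from dga_structure_cong[OF D(2) m(1)] m(2)
  show "\<exists>m. dga_structure r d m \<and> graded_mult fine_component r \<delta> m"
    by (intro exI[of _ m] conjI)
qed

section \<open>Transport along isomorphisms of resolutions\<close>

lemma linear_free_sum_eq:
  assumes "linear_map f" "linear_map g" "\<And>i x. x \<in> free_part r i \<Longrightarrow> f x = g x" "x \<in> free_sum r"
  shows "f x = g x"
proof (rule linear_eq_on_basis[OF assms(1,2)])
  fix k assume k: "k \<in> keys x"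
  obtain i j where "k = (i, j)" "j < r i"
    using keys_free_sum[OF assms(4) k] .
  then show "f (basis k) = g (basis k)"
    using assms(3)[of "basis (i, j)" i] by (simp add: basis_in_free_part)
qed

lemma linear_free_sum_into:
  assumes "linear_map f" "\<And>i x. x \<in> free_part r i \<Longrightarrow> f x \<in> free_part r' i" "x \<in> free_sum r"
  shows "f x \<in> free_sum r'"
proof (rule linear_in_subspace[OF assms(1) subspace_free_sum])
  fix k assume k: "k \<in> keys x"
  obtain i j where "k = (i, j)" "j < r i"
    using keys_free_sum[OF assms(3) k] .
  then show "f (basis k) \<in> free_sum r'"
    using assms(2)[of "basis (i, j)" i] free_part_subset_sum by (force simp: basis_in_free_part)
qed

lemma dga_structure_transport:
  fixes f f' :: "'a::comm_ring_1 felem \<Rightarrow> 'a felem"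
  assumes dga: "dga_structure r d m"
    and res: "free_resolution J r d" "free_resolution J r' d'"
    and f: "linear_map f" "\<And>i x. x \<in> free_part r' i \<Longrightarrow> f x \<in> free_part r i"
      "\<And>i x. x \<in> free_part r' i \<Longrightarrow> d (f x) = f (d' x)"
    and f': "linear_map f'" "\<And>i x. x \<in> free_part r i \<Longrightarrow> f' x \<in> free_part r' i"
      "\<And>i x. x \<in> free_part r i \<Longrightarrow> f (f' x) = x" "\<And>i x. x \<in> free_part r' i \<Longrightarrow> f' (f x) = x"
    and one: "f (basis (0, 0)) = basis (0, 0)"
  shows "dga_structure r' d' (\<lambda>x y. f' (m (f x) (f y)))"
proof -
  note D = free_resolutionD[OF res(1)] and D' = free_resolutionD[OF res(2)]
  have m: "\<forall>y\<in>free_sum r. linear_over (free_sum r) (\<lambda>x. m x y)"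
    "\<forall>x\<in>free_sum r. linear_over (free_sum r) (m x)"
    "\<forall>a b. m (of_ring a) (of_ring b) = of_ring (a * b)"
    "\<forall>x\<in>free_sum r. m (of_ring 1) x = x \<and> m x (of_ring 1) = x"
    "\<forall>i j. \<forall>x\<in>free_part r i. \<forall>y\<in>free_part r j. d (m x y) = m (d x) y + smult ((-1) ^ i) (m x (d y))"
    "\<forall>i j. \<forall>x\<in>free_part r i. \<forall>y\<in>free_part r j. m x y \<in> free_part r (i + j)"
    "\<forall>i j. \<forall>x\<in>free_part r i. \<forall>y\<in>free_part r j. m x y = smult ((-1) ^ (i * j)) (m y x)"
    "\<forall>i j k. \<forall>x\<in>free_part r i. \<forall>y\<in>free_part r j. \<forall>z\<in>free_part r k. m (m x y) z = m x (m y z)"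
    using dga unfolding dga_structure_def by - (elim conjE, assumption)+
  have fs: "f x \<in> free_sum r" if "x \<in> free_sum r'" for x
    by (rule linear_free_sum_into[OF f(1,2) that])
  have f'f: "f' (f x) = x" if "x \<in> free_sum r'" for x
    by (rule linear_free_sum_eq[OF linear_comp[OF f'(1) f(1)] linear_id _ that]) (rule f'(4))
  have f_one: "f (of_ring a) = of_ring a" for a
    by (simp add: of_ring_eq_smult linear_smult[OF f(1)] one)
  have f'_one: "f' (of_ring a) = of_ring a" for a
  proof -
    have "of_ring a \<in> free_part r' 0"
      using D'(1) by (rule of_ring_in_free_part)
    then have "f' (f (of_ring a)) = of_ring a"
      by (rule f'(4))
    then show ?thesis by (simp add: f_one)
  qed
  have f'_chain: "d' (f' z) = f' (d z)" if z: "z \<in> free_part r i" for z i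
  proof -
    have z': "f' z \<in> free_part r' i"
      by (rule f'(2)[OF z])
    have "f (d' (f' z)) = d z"
      using f(3)[OF z'] f'(3)[OF z] by simp
    moreover have "f' (f (d' (f' z))) = d' (f' z)"
    proof (cases i)
      case 0
      then show ?thesis
        using z' D'(2) linear_zero[OF f(1)] linear_zero[OF f'(1)] by simp
    next
      case (Suc n)
      then show ?thesis
        using D'(3)[of "f' z" n] z' f'(4) by simp
    qed
    ultimately show ?thesis by simp
  qed
  show ?thesis
    unfolding dga_structure_def
  proof (intro conjI allI ballI)
    show "linear_over (free_sum r') (\<lambda>x. f' (m (f x) (f y)))" if "y \<in> free_sum r'" for y
      using m(1) fs fs[OF that]
      by (simp add: linear_over_def linear_add[OF f(1)] linear_smult[OF f(1)] linear_add[OF f'(1)] linear_smult[OF f'(1)])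
    show "linear_over (free_sum r') (\<lambda>y. f' (m (f x) (f y)))" if "x \<in> free_sum r'" for x
      using m(2) fs fs[OF that]
      by (simp add: linear_over_def linear_add[OF f(1)] linear_smult[OF f(1)] linear_add[OF f'(1)] linear_smult[OF f'(1)])
    show "f' (m (f (of_ring a)) (f (of_ring b))) = of_ring (a * b)" for a b
      using m(3) by (simp add: f_one f'_one)
    show "f' (m (f (of_ring 1)) (f x)) = x" "f' (m (f x) (f (of_ring 1))) = x" if "x \<in> free_sum r'" for x
      using m(4) fs[OF that] f'f[OF that] by (simp_all add: f_one)
    fix i j and x y :: "'a felem" assume x: "x \<in> free_part r' i" and y: "y \<in> free_part r' j"
    have fx: "f x \<in> free_part r i" and fy: "f y \<in> free_part r j"
      using f(2) x y by auto
    have xy: "m (f x) (f y) \<in> free_part r (i + j)"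
      using m(6) fx fy by blast
    have "d' (f' (m (f x) (f y))) = f' (m (d (f x)) (f y) + smult ((-1) ^ i) (m (f x) (d (f y))))"
      using m(5) fx fy f'_chain[OF xy] by simp
    then show "d' (f' (m (f x) (f y))) = f' (m (f (d' x)) (f y)) + smult ((-1) ^ i) (f' (m (f x) (f (d' y))))"
      by (simp add: f(3)[OF x] f(3)[OF y] linear_add[OF f'(1)] linear_smult[OF f'(1)])
    show "f' (m (f x) (f y)) \<in> free_part r' (i + j)"
      by (rule f'(2)[OF xy])
    have "m (f x) (f y) = smult ((-1) ^ (i * j)) (m (f y) (f x))"
      using m(7) fx fy by blast
    then show "f' (m (f x) (f y)) = smult ((-1) ^ (i * j)) (f' (m (f y) (f x)))"
      by (simp add: linear_smult[OF f'(1)])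
    fix k and z :: "'a felem" assume z: "z \<in> free_part r' k"
    have fz: "f z \<in> free_part r k"
      by (rule f(2)[OF z])
    have yz: "m (f y) (f z) \<in> free_part r (j + k)"
      using m(6) fy fz by blast
    have "m (m (f x) (f y)) (f z) = m (f x) (m (f y) (f z))"
      using m(8) fx fy fz by blast
    then show "f' (m (f (f' (m (f x) (f y)))) (f z)) = f' (m (f x) (f (f' (m (f y) (f z)))))"
      by (simp add: f'(3)[OF xy] f'(3)[OF yz])
  qed
qed

section \<open>Uniqueness of minimal graded resolutions\<close>

context grading
begin

text \<open>The lifting of the identity of \<open>S/J\<close> to the resolutions. A preimage of a homogeneous element may
  be replaced by its component of the right degree.\<close>

lemma comparison_map:
  assumes gr: "graded_minimal_free_resolution C M J r \<delta> d" "graded_minimal_free_resolution C M J r' \<delta>' d'"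
    and lin: "linear_map d" "linear_map d'"
  shows "\<exists>f. linear_map f \<and> (\<forall>i. \<forall>x\<in>free_part r i. f x \<in> free_part r' i) \<and>
    (\<forall>i. \<forall>j<r i. f (basis (i, j)) \<in> homog \<delta>' (\<delta> (i, j))) \<and>
    f (basis (0, 0)) = basis (0, 0) \<and> (\<forall>i. \<forall>x\<in>free_part r i. d' (f x) = f (d x))"
proof -
  have res: "free_resolution J r d" "free_resolution J r' d'" and \<delta>0: "\<delta> (0, 0) = 0" "\<delta>' (0, 0) = 0"
    using gr by (auto simp: graded_minimal_free_resolution_def minimal_free_resolution_def)
  note D = free_resolutionD[OF res(1)] and D' = free_resolutionD[OF res(2)]
  have "\<exists>T. linear_map T \<and> (\<forall>i. \<forall>x\<in>free_part r i. T x \<in> free_part r' (i + 0)) \<and>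
    (\<forall>i. \<forall>j<r i. T (basis (i, j)) \<in> homog \<delta>' (\<delta> (i, j))) \<and>
    (\<forall>j<r 0. T (basis (0, j)) = basis (0, 0)) \<and>
    (\<forall>i. \<forall>x\<in>free_part r (Suc i). d' (T x) = 0 + smult 1 (T (d x)))"
  proof (rule lift_along_resolution[where A = "\<lambda>k. homog \<delta>' (\<delta> k)" and ?T0.0 = "\<lambda>_. basis (0, 0)"
        and \<theta> = "\<lambda>_. 0" and \<epsilon> = 1, OF lin linear_0 D(3,6)])
    show "y \<in> d' ` free_part r' (Suc (Suc (n + 0)))" if "y \<in> free_part r' (Suc (n + 0))" "d' y = 0" for n y
      using D'(5) that by simp
    show "basis (0, 0) \<in> free_part r' 0 \<inter> homog \<delta>' (\<delta> (0, j))" if "j < r 0" for j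
      using that D(1) D'(1) basis_homog[of "(0, 0)" \<delta>'] by (simp add: basis_in_free_part \<delta>0)
    show "0 + smult 1 (lin_ext (\<lambda>_. basis (0, 0)) (d x)) \<in> d' ` free_part r' (Suc 0)"
      if x: "x \<in> free_part r (Suc 0)" for x
    proof -
      have "d x \<in> of_ring ` J"
        using D(4) x by auto
      then obtain a where a: "a \<in> J" "d x = of_ring a" by blast
      have "lin_ext (\<lambda>_. basis (0, 0)) (of_ring a) = of_ring a"
        by (simp add: of_ring_eq_smult linear_smult[OF linear_lin_ext])
      then show ?thesis
        using D'(4) a by auto
    qed
    show "\<exists>z. z \<in> free_part r' (Suc (n + 0)) \<and> z \<in> homog \<delta>' (\<delta> (Suc n, j)) \<and> d' z = y"
      if j: "j < r (Suc n)" and t: "\<And>l. l < r n \<Longrightarrow> t (n, l) \<in> homog \<delta>' (\<delta> (n, l))"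
        and y: "y = 0 + smult 1 (lin_ext t (d (basis (Suc n, j))))"
        and im: "y \<in> d' ` free_part r' (Suc (n + 0))" for n j t y
    proof -
      let ?g = "\<delta> (Suc n, j)"
      have b: "d (basis (Suc n, j)) \<in> free_part r n"
        using j by (intro D(3)) (simp add: basis_in_free_part)
      have "lin_ext t (d (basis (Suc n, j))) \<in> homog \<delta>' (?g + 0)"
      proof (rule linear_homog[OF linear_lin_ext _ graded_basis[OF gr(1) j]])
        fix k assume k: "k \<in> keys (d (basis (Suc n, j)))"
        obtain l where "k = (n, l)" "l < r n"
          using keys_free_part[OF b k] .
        then show "lin_ext t (basis k) \<in> homog \<delta>' (\<delta> k + 0)"
          using t by simp
      qed
      then have y_hom: "y \<in> homog \<delta>' ?g"
        by (simp add: y)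
      obtain z where z: "z \<in> free_part r' (Suc n)" "y = d' z"
        using im by auto
      have "d' (component \<delta>' ?g z) = component \<delta>' ?g (d' z)"
      proof (rule component_commute[OF lin(2)])
        fix k assume k: "k \<in> keys z"
        obtain l where "k = (Suc n, l)" "l < r' (Suc n)"
          using keys_free_part[OF z(1) k] .
        then show "d' (basis k) \<in> homog \<delta>' (\<delta>' k)"
          using graded_basis[OF gr(2)] by simp
      qed
      then have "d' (component \<delta>' ?g z) = y"
        using component_same[OF y_hom] z(2) by simp
      then show ?thesis
        using component_free_part[OF z(1)] component_homog
        by (intro exI[of _ "component \<delta>' ?g z"] conjI) simp_all
    qed
  qed (simp_all add: felem.subspace_0 subspace_free_part linear_zero[OF lin(2)])
  then obtain T where T: "linear_map T" "\<And>i x. x \<in> free_part r i \<Longrightarrow> T x \<in> free_part r' i"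
    "\<And>i j. j < r i \<Longrightarrow> T (basis (i, j)) \<in> homog \<delta>' (\<delta> (i, j))"
    "T (basis (0, 0)) = basis (0, 0)" "\<And>i x. x \<in> free_part r (Suc i) \<Longrightarrow> d' (T x) = T (d x)"
    using D(1) by auto
  have "d' (T x) = T (d x)" if x: "x \<in> free_part r i" for x i
    using x T(5) T(2)[OF x] by (cases i) (auto simp: D(2) D'(2) linear_zero[OF T(1)])
  with T show ?thesis by blast
qed

end

text \<open>Order the basis by \<open>\<delta>\<close>. A basis element of highest degree in the support of \<open>x\<close> also occurs in
  \<open>\<phi> x\<close>, which gives injectivity; surjectivity onto the basis elements follows by induction on
  their degree.\<close>

lemma triangular_bij:
  fixes \<phi> :: "'a::comm_ring_1 felem \<Rightarrow> 'a felem" and \<delta> :: "nat \<times> nat \<Rightarrow> int"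
  assumes lin: "linear_map \<phi>" and part: "\<And>x. x \<in> free_part r i \<Longrightarrow> \<phi> x \<in> free_part r i"
    and tri: "\<And>j l. j < r i \<Longrightarrow> l < r i \<Longrightarrow> coeff (\<phi> (basis (i, j)) - basis (i, j)) (i, l) \<noteq> 0 \<Longrightarrow>
      \<delta> (i, l) < \<delta> (i, j)"
  shows "\<And>x. x \<in> free_part r i \<Longrightarrow> \<phi> x = 0 \<Longrightarrow> x = 0" and "\<phi> ` free_part r i = free_part r i"
proof -
  show "x = 0" if x: "x \<in> free_part r i" "\<phi> x = 0" for x
  proof (rule ccontr)
    assume "x \<noteq> 0"
    then have "keys x \<noteq> {}"
      by (auto simp: poly_mapping_eq_iff fun_eq_iff in_keys_iff)
    then have "Max (\<delta> ` keys x) \<in> \<delta> ` keys x"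
      by (intro Max_in) auto
    then obtain k where k: "k \<in> keys x" "\<delta> k = Max (\<delta> ` keys x)"
      by (metis imageE)
    then have max: "\<delta> l \<le> \<delta> k" if "l \<in> keys x" for l
      using that by simp
    obtain j where j: "k = (i, j)" "j < r i"
      using keys_free_part[OF x(1) k(1)] .
    have lin': "linear_map (\<lambda>x. \<phi> x - x)"
      by (rule linear_minus[OF lin linear_id])
    have "coeff (\<phi> x - x) k = (\<Sum>l\<in>keys x. coeff x l * coeff (\<phi> (basis l) - basis l) k)"
      by (subst linear_expand[OF lin']) (simp add: lookup_sum)
    also have "\<dots> = 0"
    proof (intro sum.neutral ballI)
      fix l assume l: "l \<in> keys x"
      obtain j' where "l = (i, j')" "j' < r i"
        using keys_free_part[OF x(1) l] .
      then have "coeff (\<phi> (basis l) - basis l) k = 0"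
        using tri[of j' j] max[OF l] j by fastforce
      then show "coeff x l * coeff (\<phi> (basis l) - basis l) k = 0"
        by simp
    qed
    finally have "coeff x k = 0"
      using x(2) by simp
    then show False
      using k(1) by (simp add: in_keys_iff)
  qed
  show "\<phi> ` free_part r i = free_part r i"
  proof
    show "\<phi> ` free_part r i \<subseteq> free_part r i"
      using part by blast
    define b where "b = Min ((\<lambda>j. \<delta> (i, j)) ` {..<r i})"
    have b: "b \<le> \<delta> (i, j)" if "j < r i" for j
      unfolding b_def using that by (intro Min_le) auto
    have sub: "felem.subspace (\<phi> ` free_part r i)"
      by (rule module_hom.subspace_image[OF lin subspace_free_part])
    have "basis (i, j) \<in> \<phi> ` free_part r i" if "j < r i" for j
      using that
    proof (induction "nat (\<delta> (i, j) - b)" arbitrary: j rule: less_induct)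
      case less
      let ?e = "basis (i, j) :: 'a felem"
      have e: "?e \<in> free_part r i"
        using less.prems by (simp add: basis_in_free_part)
      have \<nu>: "\<phi> ?e - ?e \<in> free_part r i"
        using part[OF e] e by (intro felem.subspace_diff subspace_free_part)
      have "(\<Sum>k\<in>keys (\<phi> ?e - ?e). smult (coeff (\<phi> ?e - ?e) k) (basis k)) \<in> \<phi> ` free_part r i"
      proof (intro felem.subspace_sum[OF sub] felem.subspace_scale[OF sub])
        fix k assume k: "k \<in> keys (\<phi> ?e - ?e)"
        obtain l where l: "k = (i, l)" "l < r i"
          using keys_free_part[OF \<nu> k] .
        then have "\<delta> (i, l) < \<delta> (i, j)"
          using tri[OF less.prems l(2)] k by (simp add: in_keys_iff)
        then have "nat (\<delta> (i, l) - b) < nat (\<delta> (i, j) - b)"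
          using b[OF l(2)] by simp
        then show "basis k \<in> \<phi> ` free_part r i"
          using less.hyps l by simp
      qed
      then have 1: "\<phi> ?e - ?e \<in> \<phi> ` free_part r i"
        by (simp flip: felem_expand)
      have 2: "\<phi> ?e \<in> \<phi> ` free_part r i"
        using e by blast
      have "\<phi> ?e - (\<phi> ?e - ?e) \<in> \<phi> ` free_part r i"
        by (rule felem.subspace_diff[OF sub 2 1])
      then show ?case by simp
    qed
    then have "basis k \<in> \<phi> ` free_part r i" if "k \<in> keys x" "x \<in> free_part r i" for k x
      using keys_free_part[OF that(2,1)] by metis
    then show "free_part r i \<subseteq> \<phi> ` free_part r i"
      using linear_in_subspace[OF linear_id sub] by blast
  qed
qed

interpretation std: graded_local std_component "degree_part total_degree" vars_ideal
  by (rule std_graded_local)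

text \<open>This positivity is what makes perturbations with coefficients in the ideal of the variables
  triangular.\<close>

lemma std_vars_positive:
  fixes a :: "('n::finite, 'k::field) mpol"
  assumes "a \<in> std_component g" "a \<in> vars_ideal" "a \<noteq> 0"
  shows "0 < g"
proof -
  obtain u where u: "lookup a u \<noteq> 0"
    using assms(3) by (auto simp: poly_mapping_eq_iff fun_eq_iff)
  then have "u \<noteq> 0"
    using assms(2) by (auto simp: vars_ideal_eq)
  then obtain i where "lookup u i \<noteq> 0"
    by (auto simp: poly_mapping_eq_iff fun_eq_iff)
  then have "(\<Sum>i\<in>UNIV. lookup u i) \<noteq> 0"
    by auto
  moreover have "total_degree u = g"
    using assms(1) u by (auto simp: std_component_eq degree_component_iff)
  ultimately show ?thesis
    by (simp only: total_degree_def of_nat_0_less_iff flip: neq0_conv)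
qed

text \<open>The difference of \<open>\<phi>\<close> and the identity is null-homotopic, hence by minimality its matrix entries
  lie in the ideal of the variables. They are homogeneous, so nonzero entries have positive
  degree, and \<open>\<phi>\<close> is triangular.\<close>

lemma std_endomorphism_bij:
  fixes \<phi> :: "('n::finite, 'k::field) mpol felem \<Rightarrow> ('n, 'k) mpol felem"
  assumes gr: "graded_minimal_free_resolution std_component vars_ideal J r \<delta> d" and lin: "linear_map d"
    and \<phi>: "linear_map \<phi>" "\<And>i x. x \<in> free_part r i \<Longrightarrow> \<phi> x \<in> free_part r i"
      "\<And>i j. j < r i \<Longrightarrow> \<phi> (basis (i, j)) \<in> std.homog \<delta> (\<delta> (i, j))"
      "\<phi> (basis (0, 0)) = basis (0, 0)" "\<And>i x. x \<in> free_part r i \<Longrightarrow> d (\<phi> x) = \<phi> (d x)"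
  shows "\<And>x. x \<in> free_part r i \<Longrightarrow> \<phi> x = 0 \<Longrightarrow> x = 0" and "\<phi> ` free_part r i = free_part r i"
proof -
  have min: "minimal_free_resolution vars_ideal J r d"
    using gr by (simp add: graded_minimal_free_resolution_def)
  then have res: "free_resolution J r d"
    by (simp add: minimal_free_resolution_def)
  note D = free_resolutionD[OF res]
  have M: "is_ideal (vars_ideal :: ('n, 'k) mpol set)"
    by (rule std.M)
  have "\<exists>H. linear_map H \<and> (\<forall>i. \<forall>x\<in>free_part r i. H x \<in> free_part r (Suc i)) \<and>
    (\<forall>i. \<forall>x\<in>free_part r i. d (H x) + H (d x) = \<phi> x - x)"
  proof (rule null_homotopy[OF res lin])
    show "linear_map (\<lambda>x. \<phi> x - x)"
      by (rule linear_minus[OF \<phi>(1) linear_id])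
    show "\<phi> x - x \<in> free_part r i" if "x \<in> free_part r i" for x i
      using \<phi>(2)[OF that] that by (intro felem.subspace_diff subspace_free_part)
    show "d (\<phi> x - x) = \<phi> (d x) - d x" if "x \<in> free_part r i" for x i
      using \<phi>(5)[OF that] by (simp add: linear_diff[OF lin])
    have "d 0 \<in> d ` free_part r (Suc 0)"
      by (intro imageI felem.subspace_0 subspace_free_part)
    then show "\<phi> (basis (0, 0)) - basis (0, 0) \<in> d ` free_part r (Suc 0)"
      by (simp add: \<phi>(4) linear_zero[OF lin])
  qed
  then obtain H where H: "linear_map H" "\<And>i x. x \<in> free_part r i \<Longrightarrow> H x \<in> free_part r (Suc i)"
    "\<And>i x. x \<in> free_part r i \<Longrightarrow> d (H x) + H (d x) = \<phi> x - x"
    by blast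
  have in_M: "coeff (\<phi> x - x) k \<in> vars_ideal" if x: "x \<in> free_part r i" for x i k
  proof -
    have 1: "coeff (d (H x)) k \<in> vars_ideal"
      by (rule minimal_coeff_in[OF min M H(2)[OF x]])
    have "coeff (d x) l \<in> vars_ideal" for l
    proof (cases i)
      case 0
      then show ?thesis
        using x D(2) is_idealD(1)[OF M] by simp
    next
      case (Suc n)
      then show ?thesis
        using minimal_coeff_in[OF min M] x by blast
    qed
    then have 2: "coeff (H (d x)) k \<in> vars_ideal"
      unfolding linear_expand[OF H(1), of "d x"] lookup_sum lookup_smult
      by (intro module.subspace_sum[OF module_mult M[unfolded is_ideal_def]] is_idealD(5)[OF M])
    show ?thesis
      using is_idealD(2)[OF M 1 2] by (simp flip: lookup_add add: H(3)[OF x])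
  qed
  have tri: "\<delta> (i, l) < \<delta> (i, j)"
    if j: "j < r i" and nz: "coeff (\<phi> (basis (i, j)) - basis (i, j)) (i, l) \<noteq> 0" for j l
  proof -
    let ?e = "basis (i, j) :: ('n, 'k) mpol felem"
    have e: "?e \<in> free_part r i"
      using j by (simp add: basis_in_free_part)
    have "\<phi> ?e + - ?e \<in> std.homog \<delta> (\<delta> (i, j))"
      by (intro std.homog_add std.homog_neg \<phi>(3)[OF j] std.basis_homog)
    then have "coeff (\<phi> ?e - ?e) (i, l) \<in> std_component (\<delta> (i, j) - \<delta> (i, l))"
      by (simp add: std.homogD)
    from std_vars_positive[OF this in_M[OF e] nz] show ?thesis
      by simp
  qed
  note T = triangular_bij[OF \<phi>(1), where \<delta> = \<delta>, OF \<phi>(2)]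
  show "x = 0" if "x \<in> free_part r i" "\<phi> x = 0" for x
    by (rule T(1)[OF _ _ that]) (auto intro: tri)
  show "\<phi> ` free_part r i = free_part r i"
    by (rule T(2)) (auto intro: tri)
qed

text \<open>The composites of the comparison maps in both directions are bijective, hence so are the
  comparison maps.\<close>

lemma std_dga_transfer:
  fixes d d' :: "('n::finite, 'k::field) mpol felem \<Rightarrow> ('n, 'k) mpol felem"
  assumes gr: "graded_minimal_free_resolution std_component vars_ideal J r \<delta> d"
      "graded_minimal_free_resolution std_component vars_ideal J r' \<delta>' d'"
    and lin: "linear_map d" "linear_map d'" and dga: "dga_structure r d m"
  shows "\<exists>m'. dga_structure r' d' m'"
proof -
  have res: "free_resolution J r d" "free_resolution J r' d'"
    using gr by (auto simp: graded_minimal_free_resolution_def minimal_free_resolution_def)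
  obtain f where f: "linear_map f" "\<And>i x. x \<in> free_part r' i \<Longrightarrow> f x \<in> free_part r i"
    "\<And>i j. j < r' i \<Longrightarrow> f (basis (i, j)) \<in> std.homog \<delta> (\<delta>' (i, j))"
    "f (basis (0, 0)) = basis (0, 0)" "\<And>i x. x \<in> free_part r' i \<Longrightarrow> d (f x) = f (d' x)"
    using std.comparison_map[OF gr(2,1) lin(2,1)] by blast
  obtain g where g: "linear_map g" "\<And>i x. x \<in> free_part r i \<Longrightarrow> g x \<in> free_part r' i"
    "\<And>i j. j < r i \<Longrightarrow> g (basis (i, j)) \<in> std.homog \<delta>' (\<delta> (i, j))"
    "g (basis (0, 0)) = basis (0, 0)" "\<And>i x. x \<in> free_part r i \<Longrightarrow> d' (g x) = g (d x)"
    using std.comparison_map[OF gr lin] by blast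
  have hom: "p (q (basis (i, j))) \<in> std.homog \<delta>1 (\<delta>1 (i, j))"
    if "linear_map p" "\<And>i j. j < r2 i \<Longrightarrow> p (basis (i, j)) \<in> std.homog \<delta>1 (\<delta>2 (i, j))"
      "q (basis (i, j)) \<in> free_part r2 i" "q (basis (i, j)) \<in> std.homog \<delta>2 (\<delta>1 (i, j))"
    for p q :: "('n, 'k) mpol felem \<Rightarrow> ('n, 'k) mpol felem" and r2 \<delta>1 \<delta>2 i j
  proof -
    have "p (basis k) \<in> std.homog \<delta>1 (\<delta>2 k + 0)" if k: "k \<in> keys (q (basis (i, j)))" for k
    proof -
      obtain l where "k = (i, l)" "l < r2 i"
        using keys_free_part[OF \<open>q (basis (i, j)) \<in> free_part r2 i\<close> k] .
      then show ?thesis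
        using \<open>\<And>i j. j < r2 i \<Longrightarrow> p (basis (i, j)) \<in> std.homog \<delta>1 (\<delta>2 (i, j))\<close> by simp
    qed
    from std.linear_homog[OF that(1) this that(4)] show ?thesis by simp
  qed
  \<comment> \<open>Injectivity of \<open>g f\<close> makes \<open>f\<close> injective, and surjectivity of \<open>f g\<close> makes \<open>f\<close> surjective.\<close>
  have inj: "x = 0" if "x \<in> free_part r' i" "g (f x) = 0" for x i
  proof (rule std_endomorphism_bij(1)[OF gr(2) lin(2), where \<phi> = "\<lambda>x. g (f x)", OF _ _ _ _ _ that])
    show "linear_map (\<lambda>x. g (f x))"
      by (rule linear_comp[OF g(1) f(1)])
    show "g (f (basis (i, j))) \<in> std.homog \<delta>' (\<delta>' (i, j))" if "j < r' i" for i j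
      by (rule hom[OF g(1), of r \<delta>' \<delta>]) (auto simp: g(3) f(2,3) that basis_in_free_part)
    show "d' (g (f x)) = g (f (d' x))" if "x \<in> free_part r' i" for x i
      using f(5)[OF that] g(5)[OF f(2)[OF that]] by simp
  qed (auto simp: f(2,4) g(2,4))
  have surj: "(\<lambda>x. f (g x)) ` free_part r i = free_part r i" for i
  proof (rule std_endomorphism_bij(2)[OF gr(1) lin(1), where \<phi> = "\<lambda>x. f (g x)"])
    show "linear_map (\<lambda>x. f (g x))"
      by (rule linear_comp[OF f(1) g(1)])
    show "f (g (basis (i, j))) \<in> std.homog \<delta> (\<delta> (i, j))" if "j < r i" for i j
      by (rule hom[OF f(1), of r' \<delta> \<delta>']) (auto simp: f(3) g(2,3) that basis_in_free_part)
    show "d (f (g x)) = f (g (d x))" if "x \<in> free_part r i" for x i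
      using g(5)[OF that] f(5)[OF g(2)[OF that]] by simp
  qed (auto simp: f(2,4) g(2,4))
  have "\<exists>x. x \<in> free_part r' i \<and> f x = basis (i, j)" if j: "j < r i" for i j
  proof -
    have "basis (i, j) \<in> (\<lambda>x. f (g x)) ` free_part r i"
      unfolding surj using j by (simp add: basis_in_free_part)
    then obtain y where "y \<in> free_part r i" "basis (i, j) = f (g y)"
      by blast
    then show ?thesis
      using g(2) by metis
  qed
  then have "\<forall>i j. \<exists>x. j < r i \<longrightarrow> x \<in> free_part r' i \<and> f x = basis (i, j)"
    by blast
  then obtain w where w: "\<And>i j. j < r i \<Longrightarrow> w i j \<in> free_part r' i \<and> f (w i j) = basis (i, j)"
    by metis
  define f' where "f' = lin_ext (\<lambda>k. w (fst k) (snd k))"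
  have lin': "linear_map f'"
    by (simp add: f'_def linear_lin_ext)
  have f'_part: "f' x \<in> free_part r' i" if "x \<in> free_part r i" for x i
    by (rule linear_free_part_into[OF lin' _ subspace_free_part that]) (simp add: f'_def w)
  have ff': "f (f' x) = x" if "x \<in> free_part r i" for x i
    by (rule linear_eq_on_free_part[OF linear_comp[OF f(1) lin'] linear_id _ that]) (simp add: f'_def w)
  have f'f: "f' (f x) = x" if x: "x \<in> free_part r' i" for x i
  proof -
    have "f' (f x) - x \<in> free_part r' i"
      using f'_part[OF f(2)[OF x]] x by (intro felem.subspace_diff subspace_free_part)
    moreover have "g (f (f' (f x) - x)) = 0"
      using ff'[OF f(2)[OF x]] by (simp add: linear_diff[OF f(1)] linear_zero[OF g(1)])
    ultimately have "f' (f x) - x = 0"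
      by (rule inj)
    then show ?thesis by simp
  qed
  have "dga_structure r' d' (\<lambda>x y. f' (m (f x) (f y)))"
    by (rule dga_structure_transport[OF dga res f(1,2,5) lin' f'_part ff' f'f f(4)])
  then show ?thesis
    by (rule exI[where P = "dga_structure r' d'"])
qed

definition coarse :: "('n::finite \<Rightarrow>\<^sub>0 int) \<Rightarrow> int" where
  "coarse g = (\<Sum>i\<in>UNIV. lookup g i)"

lemma fine_component_subset_std: "fine_component g \<subseteq> std_component (coarse g)"
proof
  fix p assume p: "p \<in> fine_component g"
  have "total_degree u = coarse g" if "u \<in> keys p" for u
  proof -
    have "fine_degree u = g"
      using p that by (simp add: fine_component_eq degree_component_def)
    then show ?thesis
      by (auto simp: total_degree_def coarse_def)
  qed
  then show "p \<in> std_component (coarse g)"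
    by (simp add: std_component_eq degree_component_def)
qed

lemma coarsen_resolution:
  assumes gr: "graded_minimal_free_resolution fine_component vars_ideal J r \<delta> d" and lin: "linear_map d"
  shows "graded_minimal_free_resolution std_component vars_ideal J r (\<lambda>k. coarse (\<delta> k)) d"
proof -
  have min: "minimal_free_resolution vars_ideal J r d" and \<delta>0: "\<delta> (0, 0) = 0"
    using gr by (auto simp: graded_minimal_free_resolution_def)
  have res: "free_resolution J r d"
    using min by (simp add: minimal_free_resolution_def)
  note D = free_resolutionD[OF res]
  have "d ` graded_piece std_component r (\<lambda>k. coarse (\<delta> k)) g
      \<subseteq> graded_piece std_component r (\<lambda>k. coarse (\<delta> k)) g" for g
  proof
    fix y assume "y \<in> d ` graded_piece std_component r (\<lambda>k. coarse (\<delta> k)) g"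
    then obtain x where x: "x \<in> free_sum r" "x \<in> std.homog (\<lambda>k. coarse (\<delta> k)) g" "y = d x"
      by (auto simp: std.graded_piece_eq)
    have "d x \<in> std.homog (\<lambda>k. coarse (\<delta> k)) (g + 0)"
    proof (rule std.linear_homog[OF lin _ x(2)])
      fix k assume k: "k \<in> keys x"
      obtain i j where ij: "k = (i, j)" "j < r i"
        using keys_free_sum[OF x(1) k] .
      show "d (basis k) \<in> std.homog (\<lambda>k. coarse (\<delta> k)) (coarse (\<delta> k) + 0)"
      proof (rule std.homogI)
        fix l
        have "coeff (d (basis k)) l \<in> fine_component (\<delta> k - \<delta> l)"
          using fine.homogD[OF fine.graded_basis[OF gr ij(2)]] ij(1) by simp
        moreover have "coarse (\<delta> k - \<delta> l) = coarse (\<delta> k) + 0 - coarse (\<delta> l)"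
          by (simp add: coarse_def lookup_minus sum_subtractf)
        ultimately show "coeff (d (basis k)) l \<in> std_component (coarse (\<delta> k) + 0 - coarse (\<delta> l))"
          using fine_component_subset_std by (metis subsetD)
      qed
    qed
    moreover have "d x \<in> free_sum r"
    proof (rule linear_in_subspace[OF lin subspace_free_sum])
      fix k assume k: "k \<in> keys x"
      obtain i j where ij: "k = (i, j)" "j < r i"
        using keys_free_sum[OF x(1) k] .
      show "d (basis k) \<in> free_sum r"
      proof (cases i)
        case 0
        then show ?thesis
          using ij D(2)[of "basis (0, j)"]
          by (simp add: basis_in_free_part felem.subspace_0 subspace_free_sum)
      next
        case (Suc n)
        then show ?thesis
          using ij D(3)[of "basis (Suc n, j)" n] free_part_subset_sum[of r n]
          by (auto simp: basis_in_free_part)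
      qed
    qed
    ultimately show "y \<in> graded_piece std_component r (\<lambda>k. coarse (\<delta> k)) g"
      by (simp add: std.graded_piece_eq x(3))
  qed
  then show ?thesis
    unfolding graded_minimal_free_resolution_def using min by (auto simp: \<delta>0 coarse_def)
qed

theorem monomial_std_dga:
  fixes I :: "('n::finite, 'k::field) mpol set"
  assumes mono: "monomial_ideal I" and proper: "I \<noteq> UNIV"
  shows "graded_mfr_admits_dga std_component vars_ideal ((*) (gens_lcm I) ` I)"
proof -
  let ?J = "(*) (gens_lcm I) ` I"
  obtain r0 \<delta>0 d0 where gr0: "graded_minimal_free_resolution fine_component vars_ideal ?J r0 \<delta>0 d0"
    using fine.graded_minimal_free_resolution_exists[OF gens_lcm_multiple_ideal[OF mono proper]] by blast
  obtain D0 where D0: "linear_map D0" "graded_minimal_free_resolution fine_component vars_ideal ?J r0 \<delta>0 D0"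
    using graded_linear_representative[OF gr0] by blast
  obtain m0 where m0: "dga_structure r0 D0 m0"
    using fine_dga[OF mono D0(2,1)] by blast
  note std0 = coarsen_resolution[OF D0(2,1)]
  have "\<exists>m. dga_structure r d m"
    if gr: "graded_minimal_free_resolution std_component vars_ideal ?J r \<delta> d" for r \<delta> d
  proof -
    obtain D where D: "linear_map D" "\<And>x. x \<in> free_sum r \<Longrightarrow> D x = d x"
      "graded_minimal_free_resolution std_component vars_ideal ?J r \<delta> D"
      using graded_linear_representative[OF gr] by blast
    obtain m where "dga_structure r D m"
      using std_dga_transfer[OF std0 D(3) D0(1) D(1) m0] by blast
    from dga_structure_cong[OF D(2) this] show ?thesis
      by (rule exI[where P = "dga_structure r d"])
  qed
  then show ?thesis
    unfolding graded_mfr_admits_dga_def using std0 by blast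
qed

section \<open>The three parts together\<close>

lemma homogeneous_gens_lcm: "homogeneous (gens_lcm I)"
  unfolding homogeneous_def gens_lcm_def std_component_eq degree_component_def monomial_def
  by (intro exI) auto

theorem theorem2p1:
  shows
    "(\<forall>(M :: 'a::comm_ring_1 set) I.
        regular_local_ring M \<and> is_ideal I \<and> I \<noteq> UNIV \<longrightarrow>
        (\<exists>s. s \<noteq> 0 \<and> mfr_admits_dga M ((*) s ` I)))
     \<and>
     (\<forall>I :: ('n::finite, 'k::field) mpol set.
        homogeneous_ideal I \<and> I \<noteq> UNIV \<longrightarrow>
        (\<exists>s. s \<noteq> 0 \<and> homogeneous s \<and>
             graded_mfr_admits_dga std_component vars_ideal ((*) s ` I)))
     \<and>
     (\<forall>I :: ('n, 'k) mpol set.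
        monomial_ideal I \<and> I \<noteq> UNIV \<longrightarrow>
        gens_lcm I \<noteq> 0 \<and> homogeneous (gens_lcm I) \<and>
        graded_mfr_admits_dga std_component vars_ideal ((*) (gens_lcm I) ` I) \<and>
        graded_mfr_admits_graded_dga fine_component vars_ideal ((*) (gens_lcm I) ` I))"
proof (intro conjI allI impI; elim conjE)
  show "\<exists>s. s \<noteq> 0 \<and> mfr_admits_dga M ((*) s ` I)"
    if "regular_local_ring M" "is_ideal I" "I \<noteq> UNIV" for M I :: "'a set"
    using that by (rule regular_local_dga)
  fix I :: "('n, 'k) mpol set" assume I: "I \<noteq> UNIV"
  show "\<exists>s. s \<noteq> 0 \<and> homogeneous s \<and> graded_mfr_admits_dga std_component vars_ideal ((*) s ` I)"
    if "homogeneous_ideal I"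
    using that I by (rule homogeneous_dga)
  assume mono: "monomial_ideal I"
  show "gens_lcm I \<noteq> 0"
    by (simp add: gens_lcm_def)
  show "homogeneous (gens_lcm I)"
    by (rule homogeneous_gens_lcm)
  show "graded_mfr_admits_dga std_component vars_ideal ((*) (gens_lcm I) ` I)"
    using mono I by (rule monomial_std_dga)
  show "graded_mfr_admits_graded_dga fine_component vars_ideal ((*) (gens_lcm I) ` I)"
    using mono I by (rule monomial_fine_dga)
qed

end
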